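(* Let $\boldsymbol\Lambda$, $\mathbf c$ be given by either choice (i) or choice (ii) of the context. In choice (i) assume in addition that the mesh sequence $\mathcal T_h^{\mathcal B}$ is such that the $L^2(\mathcal B)$-projection $P_0$ from $H^1(\mathcal B)^d$ onto $S_h$ is $H^1$-stable, i.e. $|P_0\mathbf v|_{1,\mathcal B}\le c|\mathbf v|_{1,\mathcal B}$ for all $\mathbf v\in H^1(\mathcal B)^d$, with $c$ independent of $h_s$. Let $\mathbf f\in L^2(\Omega)^d$, $\mathbf g\in L^2(\mathcal B)^d$, $\mathbf d\in H^1(\mathcal B)^d$. Let $(\mathbf u,p,\mathbf X,\boldsymbol\lambda)\in H^1_0(\Omega)^d\times L^2_0(\Omega)\times H^1(\mathcal B)^d\times\boldsymbol\Lambda$ be the solution of $$\begin{aligned}&\mathbf a_f(\mathbf u,\mathbf v)-({\rm div}\,\mathbf v,p)+\mathbf c(\boldsymbol\lambda,\mathbf v(\overline{\mathbf X}))=(\mathbf f,\mathbf v)&&\forall\mathbf v\in H^1_0(\Omega)^d\\&({\rm div}\,\mathbf u,q)=0&&\forall q\in L^2_0(\Omega)\\&\mathbf a_s(\mathbf X,\mathbf Y)-\mathbf c(\boldsymbol\lambda,\mathbf Y)=(\mathbf g,\mathbf Y)_{\mathcal B}&&\forall\mathbf Y\in H^1(\mathcal B)^d\\&\mathbf c(\boldsymbol\mu,\mathbf u(\overline{\mathbf X})-\mathbf X)=\mathbf c(\boldsymbol\mu,\mathbf d)&&\forall\boldsymbol\mu\in\boldsymbol\Lambda,\end{aligned}$$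 and let $(\mathbf u_h,p_h,\mathbf X_h,\boldsymbol\lambda_h)\in V_h\times Q_h\times S_h\times\boldsymbol\Lambda_h$ be the solution of the discrete problem obtained by replacing the spaces $H^1_0(\Omega)^d$, $L^2_0(\Omega)$, $H^1(\mathcal B)^d$, $\boldsymbol\Lambda$ of trial and test functions by $V_h,Q_h,S_h,\boldsymbol\Lambda_h$ respectively. Then $$\|\mathbf u-\mathbf u_h\|_1+\|p-p_h\|_0+\|\mathbf X-\mathbf X_h\|_{1,\mathcal B}+\|\boldsymbol\lambda-\boldsymbol\lambda_h\|_{\boldsymbol\Lambda}\le C\inf_{\substack{\mathbf v\in V_h,\ q\in Q_h\\ \mathbf Y\in S_h,\ \boldsymbol\mu\in S_h}}\big(\|\mathbf u-\mathbf v\|_1+\|p-q\|_0+\|\mathbf X-\mathbf Y\|_{1,\mathcal B}+\|\boldsymbol\lambda-\boldsymbol\mu\|_{\boldsymbol\Lambda}\big),$$ with a constant $C$ independent of $h_x$, $h_s$ and of the solutions.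
   Context: $d\in\{2,3\}$; $\Omega,\mathcal B\subset\mathbb R^d$ are bounded Lipschitz polytopal domains; $\overline{\mathbf X}\in W^{1,\infty}(\mathcal B)^d$ is invertible onto its image with Lipschitz inverse, and the closure of $\overline{\mathbf X}(\mathcal B)$ is contained in $\Omega$. $\mathbf v(\overline{\mathbf X})=\mathbf v\circ\overline{\mathbf X}$. $(\cdot,\cdot)$, $(\cdot,\cdot)_{\mathcal B}$ are the $L^2(\Omega)$, $L^2(\mathcal B)$ scalar products; $\|\cdot\|_0$ is the $L^2(\Omega)$ norm, $\|\cdot\|_1$, $\|\cdot\|_{1,\mathcal B}$ the $H^1(\Omega)$, $H^1(\mathcal B)$ norms, $|\cdot|_{1,\mathcal B}$ the $H^1(\mathcal B)$ seminorm; $L^2_0(\Omega)$ the zero-mean functions in $L^2(\Omega)$. $\mathbf a_f(\mathbf u,\mathbf v)=\alpha(\mathbf u,\mathbf v)+\nu(\nabla_{\rm sym}\mathbf u,\nabla_{\rm sym}\mathbf v)$ and $\mathbf a_s(\mathbf X,\mathbf Y)=\beta(\mathbf X,\mathbf Y)_{\mathcal B}+\gamma(\nabla_s\mathbf X,\nabla_s\mathbf Y)_{\mathcal B}$, with constants $\alpha,\nu,\gamma>0$, $\beta\ge0$, $\nabla_{\rm sym}\mathbf u=\frac12(\nabla\mathbf u+\nabla\mathbf u^\top)$. Discretization: $\mathcal T_h$ and $\mathcal T_h^{\mathcal B}$ are families of (shape-)regular simplicial meshes of $\Omega$ and $\mathcal B$, with meshsizes $h_x$ and $h_s$. $V_h\subset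 H^1_0(\Omega)^d$, $Q_h\subset L^2_0(\Omega)$ are finite element spaces on $\mathcal T_h$ that are stable for the Stokes problem: there is $\overline\beta_{\rm div}>0$ independent of $h_x$ with $\sup_{\mathbf v_h\in V_h}({\rm div}\,\mathbf v_h,q_h)/\|\mathbf v_h\|_1\ge\overline\beta_{\rm div}\|q_h\|_0$ for all $q_h\in Q_h$. $S_h=\{\mathbf Y\in H^1(\mathcal B)^d:\mathbf Y|_T\in P^1(T)^d\ \forall T\in\mathcal T_h^{\mathcal B}\}$ and $\boldsymbol\Lambda_h=S_h$. Choice (i): $\boldsymbol\Lambda=(H^1(\mathcal B)^d)'$ with the dual norm, $\mathbf c$ the duality pairing, so that $\mathbf c(\boldsymbol\mu_h,\mathbf Y)=(\boldsymbol\mu_h,\mathbf Y)_{\mathcal B}$ for $\boldsymbol\mu_h\in\boldsymbol\Lambda_h$, $\mathbf Y\in H^1(\mathcal B)^d$ (elements of $S_h$ are regarded as elements of $\boldsymbol\Lambda$ in this way). Choice (ii): $\boldsymbol\Lambda=H^1(\mathcal B)^d$ with its norm, $\mathbf c(\boldsymbol\mu,\mathbf Y)=(\nabla_s\boldsymbol\mu,\nabla_s\mathbf Y)_{\mathcal B}+(\boldsymbol\mu,\mathbf Y)_{\mathcal B}$. *)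

theory Defs
  imports "HOL-Analysis.Analysis"
begin

text \<open>
  Elements of Lebesgue and Sobolev spaces on a set \<open>D\<close> are represented by total functions; their
  values outside \<open>D\<close> and on null sets are irrelevant, and all function spaces below are closed
  under almost everywhere equality on \<open>D\<close>.
\<close>

section \<open>Lebesgue spaces\<close>

definition L2 :: "'a::euclidean_space set \<Rightarrow> ('a \<Rightarrow> 'b::euclidean_space) set" where
  "L2 D = {f. f \<in> borel_measurable (lebesgue_on D) \<and>
              integrable (lebesgue_on D) (\<lambda>x. (norm (f x))\<^sup>2)}"

definition l2_inner ::
  "'a::euclidean_space set \<Rightarrow> ('a \<Rightarrow> 'b::euclidean_space) \<Rightarrow> ('a \<Rightarrow> 'b) \<Rightarrow> real" where
  "l2_inner D f g = (LINT x|lebesgue_on D. f x \<bullet> g x)"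

definition l2_norm :: "'a::euclidean_space set \<Rightarrow> ('a \<Rightarrow> 'b::euclidean_space) \<Rightarrow> real" where
  "l2_norm D f = sqrt (l2_inner D f f)"

definition L2_zero_mean :: "'a::euclidean_space set \<Rightarrow> ('a \<Rightarrow> real) set" where
  "L2_zero_mean D = {q \<in> L2 D. (LINT x|lebesgue_on D. q x) = 0}"

definition Linf :: "'a::euclidean_space set \<Rightarrow> ('a \<Rightarrow> 'b::euclidean_space) set" where
  "Linf D = {f. f \<in> borel_measurable (lebesgue_on D) \<and>
                (\<exists>M. AE x in lebesgue_on D. norm (f x) \<le> M)}"

section \<open>Test functions and weak gradients\<close>

definition partial_deriv :: "'n::finite \<Rightarrow> (real^'n \<Rightarrow> real) \<Rightarrow> real^'n \<Rightarrow> real" where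
  "partial_deriv j \<phi> x = frechet_derivative \<phi> (at x) (axis j 1)"

text \<open>\<open>C\<^sup>\<infinity>\<close>: all iterated partial derivatives exist and are (Fr\'echet) differentiable, hence
  continuous.\<close>
definition smooth :: "(real^'n \<Rightarrow> real) \<Rightarrow> bool" where
  "smooth \<phi> \<longleftrightarrow> (\<forall>js. (foldr partial_deriv js \<phi>) differentiable_on UNIV)"

definition test_functions :: "(real^'n) set \<Rightarrow> (real^'n \<Rightarrow> real) set" where
  "test_functions D = {\<phi>. smooth \<phi> \<and> (\<exists>K. compact K \<and> K \<subseteq> D \<and> (\<forall>x. x \<notin> K \<longrightarrow> \<phi> x = 0))}"

text \<open>The gradient of a vector field is its Jacobian: row \<open>i\<close> is the gradient of component \<open>i\<close>.
  The notion is only used for \<open>u\<close> and \<open>G\<close> in \<open>L2 D\<close> or in \<open>Linf D\<close> with \<open>D\<close> bounded, where all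
  integrals exist.\<close>
definition weak_gradient ::
  "(real^'n) set \<Rightarrow> (real^'n \<Rightarrow> real^'m) \<Rightarrow> (real^'n \<Rightarrow> real^'n^'m) \<Rightarrow> bool" where
  "weak_gradient D u G \<longleftrightarrow>
     (\<forall>\<phi> \<in> test_functions D. \<forall>i j.
        (LINT x|lebesgue_on D. (u x $ i) * partial_deriv j \<phi> x) =
        - (LINT x|lebesgue_on D. (G x $ i $ j) * \<phi> x))"

section \<open>Sobolev spaces\<close>

definition W1inf :: "(real^'n) set \<Rightarrow> (real^'n \<Rightarrow> real^'m) set" where
  "W1inf D = {u \<in> Linf D. \<exists>G \<in> Linf D. weak_gradient D u G}"

definition H1 :: "(real^'n) set \<Rightarrow> (real^'n \<Rightarrow> real^'m) set" where
  "H1 D = {u \<in> L2 D. \<exists>G \<in> L2 D. weak_gradient D u G}"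

definition grad :: "(real^'n) set \<Rightarrow> (real^'n \<Rightarrow> real^'m) \<Rightarrow> real^'n \<Rightarrow> real^'n^'m" where
  "grad D u = (SOME G. G \<in> L2 D \<and> weak_gradient D u G)"

definition sym_grad :: "(real^'n) set \<Rightarrow> (real^'n \<Rightarrow> real^'n) \<Rightarrow> real^'n \<Rightarrow> real^'n^'n" where
  "sym_grad D u x = (1/2) *\<^sub>R (grad D u x + transpose (grad D u x))"

definition divergence :: "(real^'n) set \<Rightarrow> (real^'n \<Rightarrow> real^'n) \<Rightarrow> real^'n \<Rightarrow> real" where
  "divergence D u x = trace (grad D u x)"

definition h1_inner ::
  "(real^'n) set \<Rightarrow> (real^'n \<Rightarrow> real^'m) \<Rightarrow> (real^'n \<Rightarrow> real^'m) \<Rightarrow> real" where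
  "h1_inner D u v = l2_inner D (grad D u) (grad D v) + l2_inner D u v"

definition h1_norm :: "(real^'n) set \<Rightarrow> (real^'n \<Rightarrow> real^'m) \<Rightarrow> real" where
  "h1_norm D u = sqrt (h1_inner D u u)"

definition h1_seminorm :: "(real^'n) set \<Rightarrow> (real^'n \<Rightarrow> real^'m) \<Rightarrow> real" where
  "h1_seminorm D u = l2_norm D (grad D u)"

definition H10 :: "(real^'n) set \<Rightarrow> (real^'n \<Rightarrow> real^'m) set" where
  "H10 D = {u \<in> H1 D. \<forall>\<epsilon>>0. \<exists>\<phi>. (\<forall>i. (\<lambda>x. \<phi> x $ i) \<in> test_functions D) \<and> h1_norm D (u - \<phi>) < \<epsilon>}"

text \<open>Bounded linear functionals on \<open>H1 D\<close>; their values off \<open>H1 D\<close> are irrelevant. In the dual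
  norm, the quotient is \<open>0\<close> for \<open>v\<close> of norm \<open>0\<close>.\<close>
definition H1_dual :: "(real^'n) set \<Rightarrow> ((real^'n \<Rightarrow> real^'m) \<Rightarrow> real) set" where
  "H1_dual D = {l. (\<forall>u \<in> H1 D. \<forall>v \<in> H1 D. l (\<lambda>x. u x + v x) = l u + l v) \<and>
                   (\<forall>u \<in> H1 D. \<forall>a. l (\<lambda>x. a *\<^sub>R u x) = a * l u) \<and>
                   (\<exists>M. \<forall>u \<in> H1 D. \<bar>l u\<bar> \<le> M * h1_norm D u)}"

definition h1_dual_norm :: "(real^'n) set \<Rightarrow> ((real^'n \<Rightarrow> real^'m) \<Rightarrow> real) \<Rightarrow> real" where
  "h1_dual_norm D l = (SUP v \<in> H1 D. l v / h1_norm D v)"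

section \<open>Domains and meshes\<close>

text \<open>Near each boundary point, and after a rotation taking \<open>e\<close> to the last coordinate direction,
  a Lipschitz domain is the strict epigraph of a Lipschitz function of the other coordinates.\<close>
definition lipschitz_domain :: "'a::euclidean_space set \<Rightarrow> bool" where
  "lipschitz_domain D \<longleftrightarrow>
     open D \<and> connected D \<and> D \<noteq> {} \<and>
     (\<forall>x \<in> frontier D. \<exists>r>0. \<exists>e. norm e = 1 \<and>
        (\<exists>L g. L-lipschitz_on {z. z \<bullet> e = 0} g \<and>
           D \<inter> ball x r = {y \<in> ball x r. g (y - (y \<bullet> e) *\<^sub>R e) < y \<bullet> e}))"

definition lipschitz_polytopal_domain :: "'a::euclidean_space set \<Rightarrow> bool" where
  "lipschitz_polytopal_domain D \<longleftrightarrow>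
     lipschitz_domain D \<and> bounded D \<and>
     (\<exists>\<P>. finite \<P> \<and> (\<forall>P \<in> \<P>. polytope P) \<and> closure D = \<Union>\<P>)"

definition simplicial_mesh :: "'a::euclidean_space set \<Rightarrow> 'a set set \<Rightarrow> bool" where
  "simplicial_mesh D T \<longleftrightarrow>
     triangulation T \<and> (\<forall>K \<in> T. int DIM('a) simplex K) \<and> \<Union>T = closure D"

definition inradius :: "'a::euclidean_space set \<Rightarrow> real" where
  "inradius K = Sup {r. r \<ge> 0 \<and> (\<exists>x. cball x r \<subseteq> K)}"

definition shape_regular :: "('i \<Rightarrow> 'a::euclidean_space set set) \<Rightarrow> bool" where
  "shape_regular T \<longleftrightarrow> (\<exists>\<sigma>. \<forall>i. \<forall>K \<in> T i. diameter K \<le> \<sigma> * inradius K)"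

section \<open>Finite element spaces\<close>

text \<open>Finite-dimensional spaces of functions which are polynomial on every element of the mesh.\<close>
definition fe_space ::
  "'a::euclidean_space set \<Rightarrow> 'a set set \<Rightarrow> ('a \<Rightarrow> 'b::euclidean_space) set \<Rightarrow> bool" where
  "fe_space D T V \<longleftrightarrow>
     (\<exists>B. finite B \<and>
          (\<forall>b \<in> B. \<forall>K \<in> T. \<exists>p. polynomial_function p \<and> (AE x in lebesgue_on K. b x = p x)) \<and>
          V = {v. \<exists>c. AE x in lebesgue_on D. v x = (\<Sum>b\<in>B. c b *\<^sub>R b x)})"

definition P1_space :: "(real^'n) set \<Rightarrow> (real^'n) set set \<Rightarrow> (real^'n \<Rightarrow> real^'m) set" where
  "P1_space D T = {Y \<in> H1 D. \<forall>K \<in> T. \<exists>A b. AE x in lebesgue_on K. Y x = A *v x + b}"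

definition stokes_stable ::
  "(real^'n) set \<Rightarrow> ('i \<Rightarrow> (real^'n \<Rightarrow> real^'n) set) \<Rightarrow> ('i \<Rightarrow> (real^'n \<Rightarrow> real) set) \<Rightarrow> bool" where
  "stokes_stable D V Q \<longleftrightarrow>
     (\<exists>\<beta>>0. \<forall>i. \<forall>q \<in> Q i.
        (SUP v \<in> V i. l2_inner D (divergence D v) q / h1_norm D v) \<ge> \<beta> * l2_norm D q)"

definition is_L2_projection ::
  "'a::euclidean_space set \<Rightarrow> ('a \<Rightarrow> 'b::euclidean_space) set \<Rightarrow> ('a \<Rightarrow> 'b) \<Rightarrow> ('a \<Rightarrow> 'b) \<Rightarrow> bool" where
  "is_L2_projection D S v w \<longleftrightarrow> w \<in> S \<and> (\<forall>Y \<in> S. l2_inner D w Y = l2_inner D v Y)"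

definition L2_projection_H1_stable ::
  "(real^'n) set \<Rightarrow> ('j \<Rightarrow> (real^'n \<Rightarrow> real^'n) set) \<Rightarrow> bool" where
  "L2_projection_H1_stable D S \<longleftrightarrow>
     (\<exists>c. \<forall>j. \<forall>v \<in> H1 D. \<forall>w. is_L2_projection D (S j) v w \<longrightarrow>
        h1_seminorm D w \<le> c * h1_seminorm D v)"

section \<open>The coupled problem\<close>

definition form_f ::
  "real \<Rightarrow> real \<Rightarrow> (real^'n) set \<Rightarrow> (real^'n \<Rightarrow> real^'n) \<Rightarrow> (real^'n \<Rightarrow> real^'n) \<Rightarrow> real" where
  "form_f \<alpha> \<nu> \<Omega> u v = \<alpha> * l2_inner \<Omega> u v + \<nu> * l2_inner \<Omega> (sym_grad \<Omega> u) (sym_grad \<Omega> v)"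

definition form_s ::
  "real \<Rightarrow> real \<Rightarrow> (real^'n) set \<Rightarrow> (real^'n \<Rightarrow> real^'n) \<Rightarrow> (real^'n \<Rightarrow> real^'n) \<Rightarrow> real" where
  "form_s \<beta> \<gamma> B X Y = \<beta> * l2_inner B X Y + \<gamma> * l2_inner B (grad B X) (grad B Y)"

text \<open>The saddle point problem posed on arbitrary trial and test spaces \<open>V\<close>, \<open>Q\<close>, \<open>S\<close>, \<open>\<Lambda>\<close>, so that
  it covers the continuous and the discrete problem; \<open>c\<close> is the coupling form.\<close>
definition fsi_solution ::
  "real \<Rightarrow> real \<Rightarrow> real \<Rightarrow> real \<Rightarrow> (real^'n) set \<Rightarrow> (real^'n) set \<Rightarrow> (real^'n \<Rightarrow> real^'n) \<Rightarrow>
   ('l \<Rightarrow> (real^'n \<Rightarrow> real^'n) \<Rightarrow> real) \<Rightarrow>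
   (real^'n \<Rightarrow> real^'n) set \<Rightarrow> (real^'n \<Rightarrow> real) set \<Rightarrow> (real^'n \<Rightarrow> real^'n) set \<Rightarrow> 'l set \<Rightarrow>
   (real^'n \<Rightarrow> real^'n) \<Rightarrow> (real^'n \<Rightarrow> real^'n) \<Rightarrow> (real^'n \<Rightarrow> real^'n) \<Rightarrow>
   (real^'n \<Rightarrow> real^'n) \<times> (real^'n \<Rightarrow> real) \<times> (real^'n \<Rightarrow> real^'n) \<times> 'l \<Rightarrow> bool" where
  "fsi_solution \<alpha> \<nu> \<beta> \<gamma> \<Omega> B Xbar c V Q S \<Lambda> f g d = (\<lambda>(u, p, X, l).
     u \<in> V \<and> p \<in> Q \<and> X \<in> S \<and> l \<in> \<Lambda> \<and>
     (\<forall>v \<in> V. form_f \<alpha> \<nu> \<Omega> u v - l2_inner \<Omega> (divergence \<Omega> v) p + c l (v \<circ> Xbar) = l2_inner \<Omega> f v) \<and>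
     (\<forall>q \<in> Q. l2_inner \<Omega> (divergence \<Omega> u) q = 0) \<and>
     (\<forall>Y \<in> S. form_s \<beta> \<gamma> B X Y - c l Y = l2_inner B g Y) \<and>
     (\<forall>m \<in> \<Lambda>. c m ((u \<circ> Xbar) - X) = c m d))"

text \<open>Choice of the multiplier space as the dual of \<open>H1 B\<close>: the coupling is the duality pairing, and
  finite element functions act through the \<open>L\<^sup>2\<close> scalar product.\<close>
definition duality_pairing :: "('v \<Rightarrow> real) \<Rightarrow> 'v \<Rightarrow> real" where
  "duality_pairing l Y = l Y"

definition L2_functional ::
  "'a::euclidean_space set \<Rightarrow> ('a \<Rightarrow> 'b::euclidean_space) \<Rightarrow> ('a \<Rightarrow> 'b) \<Rightarrow> real" where
  "L2_functional D m = (\<lambda>Y. l2_inner D m Y)"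

end

theory Submission
  imports Defs
begin

text \<open>Subtracting the discrete from the continuous equations and testing with the discrete errors gives an
  energy estimate for the velocity error and the gradient of the displacement error, since the velocity
  form is coercive on all of \<open>H10 \<Omega>\<close> by Korn's inequality. The pressure and multiplier errors follow from
  inf-sup conditions; the one for the multiplier is trivial for the \<open>H\<^sup>1\<close> coupling and follows by duality
  from the \<open>H\<^sup>1\<close>-stability of the \<open>L\<^sup>2\<close>-projection for the duality coupling. The \<open>L\<^sup>2\<close>-part of the
  displacement error is controlled by the velocity through the discrete constraint, which also covers
  \<open>\<beta> = 0\<close>. Composition with \<open>Xbar\<close> is bounded from \<open>H10 \<Omega>\<close> to \<open>H1 B\<close>: the Lipschitz inverse bounds the
  density of the push-forward measure, and the chain rule is proved with difference quotients for smooth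
  functions and extended by density.\<close>

section \<open>Smooth functions\<close>

text \<open>The constant has to serve all meshes at once, so everything mesh-dependent is confined
  to one locale whose numerical parameters are the coefficients, the composition bound
  \<open>K\<close>, the Stokes constant and a multiplier inf-sup constant; the final constant is
  built from these and the dimension. The energy estimate does not close by itself, since its
  right-hand side contains the pressure and multiplier errors. Bounding these linearly by t
  (velocity plus displacement gradient error) and the approximation error \<delta> leaves t^2 <= D
  \<delta> (t + \<delta>), which forces t <= (D + 1) \<delta>. The analytic obstacle is composition
  with \<open>Xbar\<close>, which is only weakly differentiable. Pointwise derivatives are avoided:
  by duality a bounded weak derivative bounds the difference quotients almost everywhere, and these
  converge weakly, which is enough for the chain rule because the outer function is smooth.
  Elementary cutoffs take the place of mollification: they give density in L1, hence the fundamental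
  lemma and the uniqueness of weak gradients.\<close>

definition flat_exp :: "nat \<Rightarrow> real \<Rightarrow> real" where
  "flat_exp m t = (if t \<le> 0 then 0 else exp (- inverse t) * inverse t ^ m)"

lemma flat_exp_tendsto_0: "((\<lambda>t. flat_exp m t) \<longlongrightarrow> 0) (at_right 0)"
proof -
  have "((\<lambda>t. (inverse t) ^ m / exp (inverse t)) \<longlongrightarrow> 0) (at_right (0::real))"
    using filterlim_compose[OF tendsto_power_div_exp_0 filterlim_inverse_at_top_right] .
  moreover have "\<forall>\<^sub>F t in at_right (0::real). (inverse t) ^ m / exp (inverse t) = flat_exp m t"
    using eventually_at_right_less[of 0]
    by eventually_elim (simp add: flat_exp_def exp_minus divide_inverse mult.commute)
  ultimately show ?thesis
    by (simp add: tendsto_cong)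
qed

text \<open>The power \<open>m\<close> is part of the family because differentiating exp(-1/t)
  t^(-m) only produces the members \<open>m + 1\<close> and \<open>m + 2\<close>. At 0 the right
  difference quotient is \<open>flat_exp (Suc m)\<close>, which tends to 0, so the formula holds
  there too and the family is closed under differentiation.\<close>

lemma flat_exp_has_derivative:
  "(flat_exp m has_real_derivative (flat_exp (m + 2) t - m * flat_exp (m + 1) t)) (at t)"
proof -
  consider "t < 0" | "t = 0" | "t > 0" by linarith
  then show ?thesis
  proof cases
    case 1
    have "((\<lambda>_. 0) has_real_derivative 0) (at t)" by simp
    then have "(flat_exp m has_real_derivative 0) (at t)"
      by (rule has_field_derivative_transform_within_open[where S = "{..<0}"])
        (use 1 in \<open>auto simp: flat_exp_def\<close>)
    with 1 show ?thesis by (simp add: flat_exp_def)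
  next
    case 2
    have "((\<lambda>h. (flat_exp m (0 + h) - flat_exp m 0) / h) \<longlongrightarrow> 0) (at_right 0)"
    proof (rule Lim_transform_eventually[OF flat_exp_tendsto_0[of "Suc m"]])
      show "\<forall>\<^sub>F t in at_right 0. flat_exp (Suc m) t = (flat_exp m (0 + t) - flat_exp m 0) / t"
        using eventually_at_right_less[of 0]
        by eventually_elim (simp add: flat_exp_def divide_inverse)
    qed
    moreover have "((\<lambda>h. (flat_exp m (0 + h) - flat_exp m 0) / h) \<longlongrightarrow> 0) (at_left 0)"
    proof (rule Lim_transform_eventually[OF tendsto_const])
      show "\<forall>\<^sub>F t in at_left 0. 0 = (flat_exp m (0 + t) - flat_exp m 0) / t"
        by (auto simp: eventually_at_filter flat_exp_def)
    qed
    ultimately have "((\<lambda>h. (flat_exp m (0 + h) - flat_exp m 0) / h) \<longlongrightarrow> 0) (at 0)"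
      by (rule filterlim_split_at[rotated])
    then show ?thesis
      using 2 by (simp add: DERIV_def flat_exp_def)
  next
    case 3
    have "((\<lambda>t. exp (- inverse t) * inverse t ^ m) has_real_derivative
        (exp (- inverse t) * (inverse t)\<^sup>2 * inverse t ^ m
          + m * inverse t ^ (m - 1) * (- (inverse t)\<^sup>2) * exp (- inverse t))) (at t)"
      using 3 by (auto intro!: derivative_eq_intros simp: power2_eq_square)
    moreover have "exp (- inverse t) * (inverse t)\<^sup>2 * inverse t ^ m
          + m * inverse t ^ (m - 1) * (- (inverse t)\<^sup>2) * exp (- inverse t)
        = flat_exp (m + 2) t - m * flat_exp (m + 1) t"
      using 3 by (cases m) (simp_all add: flat_exp_def algebra_simps power2_eq_square)
    ultimately have "((\<lambda>t. exp (- inverse t) * inverse t ^ m) has_real_derivative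
        (flat_exp (m + 2) t - m * flat_exp (m + 1) t)) (at t)"
      by simp
    then show ?thesis
      by (rule has_field_derivative_transform_within_open[where S = "{0<..}"])
        (use 3 in \<open>auto simp: flat_exp_def\<close>)
  qed
qed

lemma partial_derivI:
  "(\<phi> has_derivative \<phi>') (at x) \<Longrightarrow> partial_deriv j \<phi> x = \<phi>' (axis j 1)"
  unfolding partial_deriv_def using frechet_derivative_at by metis

text \<open>Large enough to contain the cutoffs of boxes, small enough that partial derivatives stay
  inside. Smoothness in the sense of \<open>smooth\<close> then follows by induction on the list of
  derivatives, without computing any of them.\<close>

inductive_set flat_exp_algebra :: "(real^'n \<Rightarrow> real) set" where
  const: "(\<lambda>x. c) \<in> flat_exp_algebra"
| kernel: "(\<lambda>x. flat_exp m (a * x $ i + b)) \<in> flat_exp_algebra"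
| add: "f \<in> flat_exp_algebra \<Longrightarrow> g \<in> flat_exp_algebra \<Longrightarrow> (\<lambda>x. f x + g x) \<in> flat_exp_algebra"
| mult: "f \<in> flat_exp_algebra \<Longrightarrow> g \<in> flat_exp_algebra \<Longrightarrow> (\<lambda>x. f x * g x) \<in> flat_exp_algebra"

lemma flat_exp_algebra_derivative:
  fixes f :: "real^'n \<Rightarrow> real"
  assumes "f \<in> flat_exp_algebra"
  shows "\<exists>d. (\<forall>x. (f has_derivative (\<lambda>h. \<Sum>j\<in>UNIV. d j x * h $ j)) (at x)) \<and>
    (\<forall>j. d j \<in> flat_exp_algebra)"
  using assms
proof induction
  case (const c)
  show ?case
    by (rule exI[of _ "\<lambda>j x. 0"]) (auto intro: flat_exp_algebra.const)
next
  case (kernel m a i b)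
  define k where "k x = flat_exp (m + 2) (a * x $ i + b) - m * flat_exp (m + 1) (a * x $ i + b)"
    for x :: "real^'n"
  have k: "k \<in> flat_exp_algebra"
    using flat_exp_algebra.add[OF flat_exp_algebra.kernel[of "m+2" a i b]
        flat_exp_algebra.mult[OF flat_exp_algebra.const[of "- real m"] flat_exp_algebra.kernel[of "m+1" a i b]]]
    by (simp add: k_def[abs_def])
  have D: "((\<lambda>x. flat_exp m (a * x $ i + b)) has_derivative (\<lambda>h. k x * (a * h $ i))) (at x)" for x
  proof -
    have "((\<lambda>x. a * x $ i + b) has_derivative (\<lambda>h. a * h $ i)) (at x)"
      by (auto intro!: derivative_eq_intros bounded_linear.has_derivative[OF bounded_linear_vec_nth])
    from has_derivative_compose[OF this flat_exp_has_derivative[of m, unfolded has_field_derivative_def]]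
    show ?thesis by (simp add: k_def mult.commute)
  qed
  have eq: "(\<lambda>h. k x * (a * h $ i)) = (\<lambda>h. \<Sum>j\<in>UNIV. (if j = i then k x * a else 0) * h $ j)" for x
    by (simp add: if_distrib[of "\<lambda>t. t * _"] mult.assoc cong: if_cong)
  have mem: "(\<lambda>x. if j = i then k x * a else 0) \<in> flat_exp_algebra" for j
    using flat_exp_algebra.mult[OF k flat_exp_algebra.const[of a]] flat_exp_algebra.const[of 0]
    by (cases "j = i") (simp_all only: if_True if_False simp_thms)
  let ?d = "\<lambda>j x. if j = i then k x * a else 0"
  have "\<forall>x. ((\<lambda>x. flat_exp m (a * x $ i + b)) has_derivative (\<lambda>h. \<Sum>j\<in>UNIV. ?d j x * h $ j)) (at x)"
    using D unfolding eq by blast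
  moreover have "\<forall>j. ?d j \<in> flat_exp_algebra" using mem by blast
  ultimately show ?case
    by (intro exI[of _ ?d] conjI)
next
  case (add f g)
  obtain d where d: "\<And>x. (f has_derivative (\<lambda>h. \<Sum>j\<in>UNIV. d j x * h $ j)) (at x)"
    "\<And>j. d j \<in> flat_exp_algebra"
    using add.IH(1) by blast
  obtain e where e: "\<And>x. (g has_derivative (\<lambda>h. \<Sum>j\<in>UNIV. e j x * h $ j)) (at x)"
    "\<And>j. e j \<in> flat_exp_algebra"
    using add.IH(2) by blast
  show ?case
    using has_derivative_add[OF d(1) e(1)]
    by (intro exI[of _ "\<lambda>j x. d j x + e j x"])
      (auto intro: flat_exp_algebra.add d e simp: sum.distrib ring_distribs)
next
  case (mult f g)
  obtain d where d: "\<And>x. (f has_derivative (\<lambda>h. \<Sum>j\<in>UNIV. d j x * h $ j)) (at x)"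
    "\<And>j. d j \<in> flat_exp_algebra"
    using mult.IH(1) by blast
  obtain e where e: "\<And>x. (g has_derivative (\<lambda>h. \<Sum>j\<in>UNIV. e j x * h $ j)) (at x)"
    "\<And>j. e j \<in> flat_exp_algebra"
    using mult.IH(2) by blast
  have eq: "f x * (\<Sum>j\<in>UNIV. e j x * h $ j) + (\<Sum>j\<in>UNIV. d j x * h $ j) * g x
     = (\<Sum>j\<in>UNIV. (f x * e j x + d j x * g x) * h $ j)" for x h
    by (simp add: sum_distrib_left sum_distrib_right sum.distrib[symmetric] algebra_simps)
  show ?case
    using has_derivative_mult[OF d(1) e(1)]
    by (intro exI[of _ "\<lambda>j x. f x * e j x + d j x * g x"])
      (auto intro!: flat_exp_algebra.add flat_exp_algebra.mult d e mult.hyps simp: eq)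
qed

lemma sum_axis_1 [simp]: "(\<Sum>j\<in>UNIV. c j * axis i 1 $ j) = (c i :: real)"
  by (simp add: axis_def if_distrib[of "\<lambda>t. _ * t"] cong: if_cong)

lemma smooth_flat_exp_algebra:
  assumes "f \<in> flat_exp_algebra"
  shows "smooth f"
  unfolding smooth_def
proof
  fix js
  have "foldr partial_deriv js f \<in> flat_exp_algebra"
  proof (induction js)
    case (Cons j js)
    obtain d where d: "\<And>x. (foldr partial_deriv js f has_derivative (\<lambda>h. \<Sum>j\<in>UNIV. d j x * h $ j)) (at x)"
      "\<And>j. d j \<in> flat_exp_algebra"
      using flat_exp_algebra_derivative[OF Cons.IH] by blast
    have "partial_deriv j (foldr partial_deriv js f) = d j"
      using partial_derivI[OF d(1)] by (intro ext) simp
    with d(2) show ?case by simp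
  qed (simp add: assms)
  then show "foldr partial_deriv js f differentiable_on UNIV"
    using flat_exp_algebra_derivative differentiable_def
    by (metis (no_types, lifting) differentiable_at_imp_differentiable_on)
qed

section \<open>Calculus with iterated partial derivatives\<close>

lemma smooth_iff: "smooth f \<longleftrightarrow> (\<forall>js x. foldr partial_deriv js f differentiable (at x))"
  by (simp add: smooth_def differentiable_on_def)

lemma smooth_differentiable: "smooth f \<Longrightarrow> f differentiable (at x)"
  unfolding smooth_iff by (metis foldr.simps(1) id_apply)

lemma smooth_partial_deriv: "smooth f \<Longrightarrow> smooth (partial_deriv j f)"
  unfolding smooth_def
proof
  fix js assume "\<forall>js. foldr partial_deriv js f differentiable_on UNIV"
  \<comment> \<open>\<open>foldr\<close> applies the last list element first, so the extra
    derivative is appended at the end.\<close>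
  then have "foldr partial_deriv (js @ [j]) f differentiable_on UNIV" by blast
  then show "foldr partial_deriv js (partial_deriv j f) differentiable_on UNIV" by simp
qed

lemma has_derivative_partial_deriv:
  assumes "f differentiable (at x)"
  shows "(f has_derivative (\<lambda>h. \<Sum>j\<in>UNIV. partial_deriv j f x * h $ j)) (at x)"
proof -
  obtain f' where f': "(f has_derivative f') (at x)"
    using assms differentiable_def by blast
  then have lin: "linear f'" by (rule has_derivative_linear)
  have "f' h = (\<Sum>j\<in>UNIV. partial_deriv j f x * h $ j)" for h
  proof -
    have "f' h = f' (\<Sum>j\<in>UNIV. h $ j *\<^sub>R axis j 1)"
      using basis_expansion[of h] by (simp add: scalar_mult_eq_scaleR)
    also have "\<dots> = (\<Sum>j\<in>UNIV. h $ j * f' (axis j 1))"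
      by (simp add: linear_sum[OF lin] linear_cmul[OF lin])
    finally show ?thesis by (simp add: partial_derivI[OF f'] mult.commute)
  qed
  then show ?thesis using f' by presburger
qed

lemmas smooth_has_derivative = has_derivative_partial_deriv[OF smooth_differentiable]

lemma smooth_continuous_on: "smooth f \<Longrightarrow> continuous_on S f"
  by (meson continuous_at_imp_continuous_on differentiable_imp_continuous_within smooth_differentiable)

lemma smooth_borel_measurable: "smooth f \<Longrightarrow> f \<in> borel_measurable borel"
  by (intro borel_measurable_continuous_onI smooth_continuous_on)

lemma partial_deriv_linear_combination:
  assumes "f differentiable (at x)" "g differentiable (at x)"
  shows "partial_deriv j (\<lambda>x. a * f x + b * g x) x = a * partial_deriv j f x + b * partial_deriv j g x"
proof -
  note D = has_derivative_partial_deriv[OF assms(1)] has_derivative_partial_deriv[OF assms(2)]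
  show ?thesis
    using partial_derivI[OF has_derivative_add[OF has_derivative_mult_right[OF D(1), of a]
      has_derivative_mult_right[OF D(2), of b]], of j] by simp
qed

lemma smooth_linear_combination:
  assumes "smooth f" "smooth g"
  shows "smooth (\<lambda>x. a * f x + b * g x)"
proof -
  have eq: "foldr partial_deriv js (\<lambda>x. a * f x + b * g x) =
     (\<lambda>x. a * foldr partial_deriv js f x + b * foldr partial_deriv js g x)" for js
  proof (induction js)
    case (Cons j js)
    have "foldr partial_deriv js f differentiable (at x)" "foldr partial_deriv js g differentiable (at x)" for x
      using assms unfolding smooth_iff by blast+
    then show ?case
      by (simp add: Cons.IH partial_deriv_linear_combination)
  qed simp
  show ?thesis
    using assms unfolding smooth_def eq by (auto intro!: derivative_intros)
qed

lemma partial_deriv_translation: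
  assumes "f differentiable (at (x - a))"
  shows "partial_deriv j (\<lambda>x. f (x - a)) x = partial_deriv j f (x - a)"
proof -
  have "((\<lambda>x. x - a) has_derivative (\<lambda>h. h)) (at x)" by (auto intro!: derivative_eq_intros)
  from partial_derivI[OF has_derivative_compose[OF this has_derivative_partial_deriv[OF assms]], of j]
  show ?thesis by simp
qed

lemma smooth_translation:
  assumes "smooth f"
  shows "smooth (\<lambda>x. f (x - a))"
proof -
  have eq: "foldr partial_deriv js (\<lambda>x. f (x - a)) = (\<lambda>x. foldr partial_deriv js f (x - a))" for js
  proof (induction js)
    case (Cons j js)
    have "foldr partial_deriv js f differentiable (at x)" for x
      using assms unfolding smooth_iff by blast
    then show ?case
      by (simp add: Cons.IH partial_deriv_translation)
  qed simp
  have "(\<lambda>x. foldr partial_deriv js f (x - a)) differentiable (at x)" for js x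
  proof -
    have "foldr partial_deriv js f differentiable (at (x - a))"
      using assms unfolding smooth_iff by blast
    moreover have "((\<lambda>x. x - a) has_derivative (\<lambda>h. h)) (at x)"
      by (auto intro!: derivative_eq_intros)
    ultimately show ?thesis
      unfolding differentiable_def using has_derivative_compose by blast
  qed
  then show ?thesis
    unfolding smooth_iff eq by blast
qed

section \<open>Test functions\<close>

lemma test_functionsE:
  assumes "\<phi> \<in> test_functions U"
  obtains K where "smooth \<phi>" "compact K" "K \<subseteq> U" "\<And>x. x \<notin> K \<Longrightarrow> \<phi> x = 0"
  using assms by (auto simp: test_functions_def)

lemma test_function_smooth: "\<phi> \<in> test_functions U \<Longrightarrow> smooth \<phi>"
  by (simp add: test_functions_def)

lemma test_function_outside: "\<phi> \<in> test_functions U \<Longrightarrow> x \<notin> U \<Longrightarrow> \<phi> x = 0"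
  by (auto simp: test_functions_def)

lemma test_functions_mono: "U \<subseteq> V \<Longrightarrow> test_functions U \<subseteq> test_functions V"
  by (auto simp: test_functions_def)

lemma test_function_borel_measurable [measurable]:
  "\<phi> \<in> test_functions U \<Longrightarrow> \<phi> \<in> borel_measurable borel"
  by (intro smooth_borel_measurable test_function_smooth)

lemma test_functions_linear_combination:
  assumes "\<phi> \<in> test_functions U" "\<psi> \<in> test_functions U"
  shows "(\<lambda>x. a * \<phi> x + b * \<psi> x) \<in> test_functions U"
proof -
  obtain K where K: "smooth \<phi>" "compact K" "K \<subseteq> U" "\<And>x. x \<notin> K \<Longrightarrow> \<phi> x = 0"
    using assms(1) by (blast elim!: test_functionsE)
  obtain L where L: "smooth \<psi>" "compact L" "L \<subseteq> U" "\<And>x. x \<notin> L \<Longrightarrow> \<psi> x = 0"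
    using assms(2) by (blast elim!: test_functionsE)
  have "compact (K \<union> L)" "K \<union> L \<subseteq> U" using K L by auto
  moreover have "\<forall>x. x \<notin> K \<union> L \<longrightarrow> a * \<phi> x + b * \<psi> x = 0" using K(4) L(4) by simp
  ultimately show ?thesis
    unfolding test_functions_def using smooth_linear_combination[OF K(1) L(1)] by blast
qed

lemma test_functions_zero: "(\<lambda>x. 0) \<in> test_functions U"
  unfolding test_functions_def
  using smooth_flat_exp_algebra[OF flat_exp_algebra.const[of 0]] compact_empty by blast

lemma test_functions_partial_deriv:
  assumes "\<phi> \<in> test_functions U"
  shows "partial_deriv j \<phi> \<in> test_functions U"
proof -
  obtain K where K: "smooth \<phi>" "compact K" "K \<subseteq> U" "\<And>x. x \<notin> K \<Longrightarrow> \<phi> x = 0"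
    using assms by (blast elim!: test_functionsE)
  have "partial_deriv j \<phi> x = 0" if "x \<notin> K" for x
  proof -
    have "((\<lambda>_. 0) has_derivative (\<lambda>_. 0)) (at x)" by simp
    then have "(\<phi> has_derivative (\<lambda>_. 0)) (at x)"
      by (rule has_derivative_transform_within_open[where s = "- K"])
        (use that K in \<open>auto simp: compact_imp_closed open_Compl\<close>)
    then show ?thesis by (rule partial_derivI)
  qed
  then show ?thesis
    unfolding test_functions_def using K smooth_partial_deriv by blast
qed

lemma test_function_bounded:
  assumes "\<phi> \<in> test_functions U"
  obtains M where "M > 0" "\<And>x. \<bar>\<phi> x\<bar> \<le> M"
proof -
  obtain K where K: "smooth \<phi>" "compact K" "K \<subseteq> U" "\<And>x. x \<notin> K \<Longrightarrow> \<phi> x = 0"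
    using assms by (blast elim!: test_functionsE)
  have "bounded (\<phi> ` K)"
    using K by (simp add: compact_continuous_image compact_imp_bounded smooth_continuous_on)
  then obtain M where "M > 0" "\<And>x. x \<in> K \<Longrightarrow> \<bar>\<phi> x\<bar> \<le> M"
    by (auto simp: bounded_pos)
  moreover from this have "\<bar>\<phi> x\<bar> \<le> M" for x
    using K(4)[of x] by (cases "x \<in> K") auto
  ultimately show ?thesis using that by blast
qed

lemma test_function_lipschitz:
  assumes "\<phi> \<in> test_functions U"
  obtains L where "L > 0" "\<And>x y. \<bar>\<phi> x - \<phi> y\<bar> \<le> L * norm (x - y)"
proof -
  have "\<forall>j. \<exists>M. \<forall>x. \<bar>partial_deriv j \<phi> x\<bar> \<le> M"
    using test_functions_partial_deriv[OF assms] test_function_bounded by metis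
  then obtain M where M: "\<And>j x. \<bar>partial_deriv j \<phi> x\<bar> \<le> M j" by metis
  \<comment> \<open>The summand 1 makes the constant positive even when all the bounds
    \<open>M j\<close> are 0.\<close>
  define L where "L = (\<Sum>j\<in>UNIV. M j) + 1"
  have M0: "0 \<le> M j" for j using M[of j 0] by simp
  have L: "L > 0" unfolding L_def using M0 by (simp add: add_nonneg_pos sum_nonneg)
  have "onorm (\<lambda>h. \<Sum>j\<in>UNIV. partial_deriv j \<phi> x * h $ j) \<le> L" for x
  proof (rule onorm_le)
    fix h :: "real^'a"
    have "norm (\<Sum>j\<in>UNIV. partial_deriv j \<phi> x * h $ j) \<le> (\<Sum>j\<in>UNIV. M j * norm h)"
      by (intro order_trans[OF norm_sum] sum_mono)
        (auto simp: abs_mult intro!: mult_mono M M0 component_le_norm_cart)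
    then show "norm (\<Sum>j\<in>UNIV. partial_deriv j \<phi> x * h $ j) \<le> L * norm h"
      using norm_ge_zero[of h] unfolding L_def sum_distrib_right[symmetric] distrib_right by linarith
  qed
  then have "norm (\<phi> x - \<phi> y) \<le> L * norm (x - y)" for x y
    using differentiable_bound[of UNIV \<phi> "\<lambda>x h. \<Sum>j\<in>UNIV. partial_deriv j \<phi> x * h $ j" L x y]
      smooth_has_derivative[OF test_function_smooth[OF assms]] by simp
  then show ?thesis using that L by simp
qed

text \<open>\<open>F\<close>, which is \<phi> minus its linear part at \<open>x\<close>, has at
  \<open>z\<close> the difference of the derivatives of \<phi> at \<open>z\<close> and
  \<open>x\<close>. This is at most a multiple of the length of the segment because the partial
  derivatives are Lipschitz, and the mean value inequality contributes the second factor.\<close>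

lemma test_function_taylor:
  assumes "\<phi> \<in> test_functions U"
  obtains L where "L > 0"
    "\<And>x y. \<bar>\<phi> y - \<phi> x - (\<Sum>j\<in>UNIV. partial_deriv j \<phi> x * (y - x) $ j)\<bar> \<le> L * (norm (y - x))\<^sup>2"
proof -
  have "\<forall>j. \<exists>L>0. \<forall>x y. \<bar>partial_deriv j \<phi> x - partial_deriv j \<phi> y\<bar> \<le> L * norm (x - y)"
    using test_functions_partial_deriv[OF assms] test_function_lipschitz by metis
  then obtain M where M0: "\<And>j. M j > 0"
    and M: "\<And>j x y. \<bar>partial_deriv j \<phi> x - partial_deriv j \<phi> y\<bar> \<le> M j * norm (x - y)" by metis
  define L where "L = (\<Sum>j\<in>UNIV. M j)"
  have L: "L > 0" unfolding L_def using M0 by (simp add: sum_pos)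
  have "\<bar>\<phi> y - \<phi> x - (\<Sum>j\<in>UNIV. partial_deriv j \<phi> x * (y - x) $ j)\<bar> \<le> L * (norm (y - x))\<^sup>2" for x y
  proof -
    define F where "F z = \<phi> z - (\<Sum>j\<in>UNIV. partial_deriv j \<phi> x * z $ j)" for z
    define F' where "F' z h = (\<Sum>j\<in>UNIV. partial_deriv j \<phi> z * h $ j) - (\<Sum>j\<in>UNIV. partial_deriv j \<phi> x * h $ j)"
      for z h :: "real^'a"
    have lin: "bounded_linear (\<lambda>h::real^'a. \<Sum>j\<in>UNIV. c j * h $ j)" for c
      by (intro bounded_linear_sum bounded_linear_mult_right[THEN bounded_linear_compose] bounded_linear_vec_nth)
    have D: "(F has_derivative F' z) (at z within S)" for z S
      unfolding F_def F'_def
      by (intro has_derivative_diff has_derivative_at_withinI[OF smooth_has_derivative]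
          test_function_smooth[OF assms] bounded_linear.has_derivative[OF lin] has_derivative_ident)
    have "onorm (F' z) \<le> L * norm (y - x)" if "z \<in> closed_segment x y" for z
    proof (rule onorm_le)
      fix h :: "real^'a"
      have "norm (F' z h) = norm (\<Sum>j\<in>UNIV. (partial_deriv j \<phi> z - partial_deriv j \<phi> x) * h $ j)"
        by (simp add: F'_def sum_subtractf left_diff_distrib)
      also have "\<dots> \<le> (\<Sum>j\<in>UNIV. M j * norm (y - x) * norm h)"
      proof (intro order_trans[OF norm_sum] sum_mono)
        fix j
        have "norm (z - x) \<le> norm (y - x)"
          using segment_bound[OF that] by (simp add: norm_minus_commute)
        then have "\<bar>partial_deriv j \<phi> z - partial_deriv j \<phi> x\<bar> \<le> M j * norm (y - x)"
          using M[of j z x] M0[of j] by (meson mult_left_mono less_imp_le order_trans)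
        then show "norm ((partial_deriv j \<phi> z - partial_deriv j \<phi> x) * h $ j) \<le> M j * norm (y - x) * norm h"
          unfolding real_norm_def abs_mult using component_le_norm_cart[of h j] M0[of j]
          by (intro mult_mono) simp_all
      qed
      also have "\<dots> = L * norm (y - x) * norm h"
        by (simp add: L_def sum_distrib_right)
      finally show "norm (F' z h) \<le> L * norm (y - x) * norm h" .
    qed
    then have "norm (F y - F x) \<le> (L * norm (y - x)) * norm (y - x)"
      by (intro differentiable_bound[of "closed_segment x y" F F']) (auto intro: D)
    then show ?thesis
      by (simp add: F_def power2_eq_square mult.assoc sum_subtractf right_diff_distrib algebra_simps)
  qed
  then show ?thesis using that L by blast
qed

lemma test_function_integrable:
  assumes "\<phi> \<in> test_functions U"
  shows "integrable lborel \<phi>"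
proof -
  obtain K where K: "smooth \<phi>" "compact K" "K \<subseteq> U" "\<And>x. x \<notin> K \<Longrightarrow> \<phi> x = 0"
    using assms by (blast elim!: test_functionsE)
  have "indicat_real K x *\<^sub>R \<phi> x = \<phi> x" for x
    using K(4)[of x] by (cases "x \<in> K") auto
  then show ?thesis
    using borel_integrable_compact[OF K(2) smooth_continuous_on[OF K(1)]] by (simp only:)
qed

section \<open>Density of test functions\<close>

text \<open>Approximation in L1 with respect to a general measure \<open>M\<close>: the fundamental
  lemma uses the weight |g|, and plain Lebesgue density is recovered from the measure restricted to
  a bounded set. Integrability is included so that the closure properties compose without side
  conditions.\<close>

definition test_approximable :: "(real^'n) measure \<Rightarrow> (real^'n) set \<Rightarrow> (real^'n \<Rightarrow> real) \<Rightarrow> bool" where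
  "test_approximable M U f \<longleftrightarrow>
     integrable M f \<and> (\<forall>\<epsilon>>0. \<exists>\<eta>\<in>test_functions U. (LINT x|M. \<bar>f x - \<eta> x\<bar>) < \<epsilon>)"

lemma test_function_integrable_finite:
  assumes "finite_measure M" "sets M = sets borel" "\<eta> \<in> test_functions U"
  shows "integrable M \<eta>"
proof -
  obtain C where "C > 0" "\<And>x. \<bar>\<eta> x\<bar> \<le> C"
    using test_function_bounded[OF assms(3)] by blast
  moreover have "\<eta> \<in> borel_measurable M"
    using test_function_borel_measurable[OF assms(3)] measurable_cong_sets[OF assms(2) refl] by blast
  ultimately show ?thesis
    by (intro finite_measure.integrable_const_bound[OF assms(1), where B = C] AE_I2) simp_all
qed

lemma test_approximable_linear_combination:
  assumes M: "finite_measure M" "sets M = sets borel"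
    and f: "test_approximable M U f" and g: "test_approximable M U g"
  shows "test_approximable M U (\<lambda>x. a * f x + b * g x)"
  unfolding test_approximable_def
proof (intro conjI allI impI)
  have [simp]: "integrable M f" "integrable M g"
    using f g by (auto simp: test_approximable_def)
  show "integrable M (\<lambda>x. a * f x + b * g x)" by simp
  fix \<epsilon> :: real assume "\<epsilon> > 0"
  define \<delta> where "\<delta> = \<epsilon> / (\<bar>a\<bar> + \<bar>b\<bar> + 1)"
  have \<delta>: "\<delta> > 0" "(\<bar>a\<bar> + \<bar>b\<bar>) * \<delta> < \<epsilon>"
    using \<open>\<epsilon> > 0\<close> by (auto simp: \<delta>_def field_simps)
  obtain \<phi> where \<phi>: "\<phi> \<in> test_functions U" "(LINT x|M. \<bar>f x - \<phi> x\<bar>) < \<delta>"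
    using f \<delta> by (auto simp: test_approximable_def)
  obtain \<psi> where \<psi>: "\<psi> \<in> test_functions U" "(LINT x|M. \<bar>g x - \<psi> x\<bar>) < \<delta>"
    using g \<delta> by (auto simp: test_approximable_def)
  note [simp] = test_function_integrable_finite[OF M \<phi>(1)] test_function_integrable_finite[OF M \<psi>(1)]
  have "(LINT x|M. \<bar>a * f x + b * g x - (a * \<phi> x + b * \<psi> x)\<bar>)
      \<le> (LINT x|M. \<bar>a\<bar> * \<bar>f x - \<phi> x\<bar> + \<bar>b\<bar> * \<bar>g x - \<psi> x\<bar>)"
  proof (intro integral_mono)
    fix x
    have "a * f x + b * g x - (a * \<phi> x + b * \<psi> x) = a * (f x - \<phi> x) + b * (g x - \<psi> x)"
      by (simp add: algebra_simps)
    then show "\<bar>a * f x + b * g x - (a * \<phi> x + b * \<psi> x)\<bar> \<le> \<bar>a\<bar> * \<bar>f x - \<phi> x\<bar> + \<bar>b\<bar> * \<bar>g x - \<psi> x\<bar>"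
      using abs_triangle_ineq[of "a * (f x - \<phi> x)" "b * (g x - \<psi> x)"] by (simp add: abs_mult)
  qed simp_all
  also have "\<dots> = \<bar>a\<bar> * (LINT x|M. \<bar>f x - \<phi> x\<bar>) + \<bar>b\<bar> * (LINT x|M. \<bar>g x - \<psi> x\<bar>)"
    by simp
  also have "\<dots> \<le> \<bar>a\<bar> * \<delta> + \<bar>b\<bar> * \<delta>"
    using \<phi>(2) \<psi>(2) by (intro add_mono mult_left_mono) auto
  also have "\<dots> < \<epsilon>" using \<delta>(2) by (simp add: distrib_right)
  finally show "\<exists>\<eta>\<in>test_functions U. (LINT x|M. \<bar>a * f x + b * g x - \<eta> x\<bar>) < \<epsilon>"
    using test_functions_linear_combination[OF \<phi>(1) \<psi>(1)]
    by (intro bexI[of _ "\<lambda>x. a * \<phi> x + b * \<psi> x"])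
qed

lemma test_approximable_limit:
  assumes M: "finite_measure M" "sets M = sets borel"
    and f: "\<And>n. test_approximable M U (f n)" and g: "integrable M g"
    and lim: "(\<lambda>n. LINT x|M. \<bar>g x - f n x\<bar>) \<longlonglongrightarrow> 0"
  shows "test_approximable M U g"
  unfolding test_approximable_def
proof (intro conjI allI impI g)
  fix \<epsilon> :: real assume "\<epsilon> > 0"
  have [simp]: "integrable M (f n)" for n
    using f by (auto simp: test_approximable_def)
  have "\<forall>\<^sub>F n in sequentially. (LINT x|M. \<bar>g x - f n x\<bar>) < \<epsilon> / 2"
    using lim \<open>\<epsilon> > 0\<close> by (intro order_tendstoD(2)) auto
  then obtain n where n: "(LINT x|M. \<bar>g x - f n x\<bar>) < \<epsilon> / 2"
    by (auto simp: eventually_sequentially)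
  obtain \<phi> where \<phi>: "\<phi> \<in> test_functions U" "(LINT x|M. \<bar>f n x - \<phi> x\<bar>) < \<epsilon> / 2"
    using f[of n] \<open>\<epsilon> > 0\<close> unfolding test_approximable_def by (meson half_gt_zero)
  note [simp] = test_function_integrable_finite[OF M \<phi>(1)] g
  have "(LINT x|M. \<bar>g x - \<phi> x\<bar>) \<le> (LINT x|M. \<bar>g x - f n x\<bar> + \<bar>f n x - \<phi> x\<bar>)"
    by (intro integral_mono) auto
  also have "\<dots> < \<epsilon>" using n \<phi>(2) by simp
  finally show "\<exists>\<eta>\<in>test_functions U. (LINT x|M. \<bar>g x - \<eta> x\<bar>) < \<epsilon>"
    using \<phi>(1) by blast
qed

lemma test_approximable_dominated:
  assumes M: "finite_measure M" "sets M = sets borel"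
    and f: "\<And>n. test_approximable M U (f n)" and g: "g \<in> borel_measurable borel"
    and lim: "\<And>x. (\<lambda>n. f n x) \<longlonglongrightarrow> g x"
    and w: "integrable M w" "\<And>n x. \<bar>f n x\<bar> \<le> w x"
  shows "test_approximable M U g"
proof (rule test_approximable_limit[OF M f])
  have fm: "f n \<in> borel_measurable M" for n
    using f by (auto simp: test_approximable_def)
  have gm: "g \<in> borel_measurable M"
    using g measurable_cong_sets[OF M(2) refl] by blast
  show g: "integrable M g"
    by (rule integrable_dominated_convergence[where s = f and w = w]) (use w lim fm gm in auto)
  have gw: "\<bar>g x\<bar> \<le> w x" for x
    using Lim_bounded[OF tendsto_rabs[OF lim[of x]], of 0 "w x"] w(2) by auto
  have "(\<lambda>n. LINT x|M. \<bar>g x - f n x\<bar>) \<longlonglongrightarrow> (LINT x|M. 0)"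
  proof (rule integral_dominated_convergence[where w = "\<lambda>x. 2 * w x"])
    show "AE x in M. (\<lambda>n. \<bar>g x - f n x\<bar>) \<longlonglongrightarrow> 0"
    proof (rule AE_I2)
      fix x
      have "(\<lambda>n. g x - f n x) \<longlonglongrightarrow> g x - g x"
        by (intro tendsto_intros lim)
      then show "(\<lambda>n. \<bar>g x - f n x\<bar>) \<longlonglongrightarrow> 0"
        using tendsto_rabs_zero by simp
    qed
    show "AE x in M. norm \<bar>g x - f n x\<bar> \<le> 2 * w x" for n
    proof (rule AE_I2)
      fix x show "norm \<bar>g x - f n x\<bar> \<le> 2 * w x"
        using gw[of x] w(2)[of n x] by simp
    qed
  qed (use fm gm w in auto)
  then show "(\<lambda>n. LINT x|M. \<bar>g x - f n x\<bar>) \<longlonglongrightarrow> 0" by simp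
qed

section \<open>Smooth cutoffs of boxes and the passage to Borel sets\<close>

lemma flat_exp_0_bounds: "0 \<le> flat_exp 0 t" "flat_exp 0 t \<le> 1"
  by (auto simp: flat_exp_def)

lemma flat_exp_0_limit:
  assumes "t > 0"
  shows "(\<lambda>k. flat_exp 0 (real k * t - 1)) \<longlonglongrightarrow> 1"
proof -
  have "(\<lambda>k. exp (- inverse (real k * t - 1))) \<longlonglongrightarrow> exp (- 0)"
  proof (intro tendsto_intros)
    have "filterlim (\<lambda>k. (- 1) + t * real k) at_top sequentially"
      using assms
      by (intro filterlim_tendsto_add_at_top[OF tendsto_const]
          filterlim_tendsto_pos_mult_at_top[OF tendsto_const _ filterlim_real_sequentially])
    then have "filterlim (\<lambda>k. real k * t - 1) at_top sequentially"
      by (simp add: algebra_simps)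
    then show "(\<lambda>k. inverse (real k * t - 1)) \<longlonglongrightarrow> 0"
      using filterlim_compose[OF tendsto_inverse_0_at_top[OF filterlim_ident]] by blast
  qed
  moreover have "\<forall>\<^sub>F k in sequentially. exp (- inverse (real k * t - 1)) = flat_exp 0 (real k * t - 1)"
  proof -
    obtain N where N: "1 / t < real N" using reals_Archimedean2 by blast
    have "exp (- inverse (real k * t - 1)) = flat_exp 0 (real k * t - 1)" if "k \<ge> N" for k
    proof -
      have "1 / t < real k" using that N by linarith
      then have "1 < real k * t" using assms by (simp add: field_simps)
      then show ?thesis by (simp add: flat_exp_def)
    qed
    then show ?thesis unfolding eventually_sequentially by blast
  qed
  ultimately show ?thesis by (simp add: tendsto_cong)
qed

text \<open>Each factor vanishes within distance 1/k of its face, so the support is a compact subset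
  of the open box; at a fixed interior point all arguments tend to infinity and the product tends to
  1. Hence a smooth pointwise approximation of the indicator with values in [0, 1].\<close>

definition box_cutoff :: "real^'n \<Rightarrow> real^'n \<Rightarrow> nat \<Rightarrow> real^'n \<Rightarrow> real" where
  "box_cutoff a b k x =
     (\<Prod>i\<in>UNIV. flat_exp 0 (real k * (x $ i - a $ i) - 1) * flat_exp 0 (real k * (b $ i - x $ i) - 1))"

lemma box_cutoff_test_function:
  assumes "box a b \<subseteq> U"
  shows "box_cutoff a b k \<in> test_functions U"
proof -
  have prod: "(\<lambda>x. \<Prod>i\<in>I. f i x) \<in> flat_exp_algebra"
    if "finite I" "\<And>i. f i \<in> flat_exp_algebra" for f :: "'a \<Rightarrow> real^'a \<Rightarrow> real" and I
    using that by (induction I) (auto intro: flat_exp_algebra.const flat_exp_algebra.mult)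
  have alg: "box_cutoff a b k \<in> flat_exp_algebra"
    unfolding box_cutoff_def[abs_def]
  proof (intro prod flat_exp_algebra.mult finite)
    fix i
    show "(\<lambda>x. flat_exp 0 (real k * (x $ i - a $ i) - 1)) \<in> flat_exp_algebra"
      using flat_exp_algebra.kernel[of 0 "real k" i "- real k * a $ i - 1"] by (simp add: algebra_simps)
    show "(\<lambda>x. flat_exp 0 (real k * (b $ i - x $ i) - 1)) \<in> flat_exp_algebra"
      using flat_exp_algebra.kernel[of 0 "- real k" i "real k * b $ i - 1"] by (simp add: algebra_simps)
  qed
  have out: "box_cutoff a b k x = 0"
    if "x \<notin> cbox (\<chi> i. a $ i + 1 / real k) (\<chi> i. b $ i - 1 / real k)" for x
  proof -
    have "\<exists>i. x $ i < a $ i + 1 / real k \<or> x $ i > b $ i - 1 / real k"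
      using that by (auto simp: mem_box_cart not_le)
    then obtain i where "x $ i < a $ i + 1 / real k \<or> x $ i > b $ i - 1 / real k"
      by blast
    then have "real k * (x $ i - a $ i) - 1 \<le> 0 \<or> real k * (b $ i - x $ i) - 1 \<le> 0"
      by (cases "k = 0") (auto simp: field_simps)
    then show ?thesis
      unfolding box_cutoff_def by (intro prod_zero) (auto simp: flat_exp_def)
  qed
  have sub: "cbox (\<chi> i. a $ i + 1 / real k) (\<chi> i. b $ i - 1 / real k) \<subseteq> box a b" if "k > 0"
  proof
    fix x assume x: "x \<in> cbox (\<chi> i. a $ i + 1 / real k) (\<chi> i. b $ i - 1 / real k)"
    have "0 < 1 / real k" using that by simp
    moreover have "a $ i + 1 / real k \<le> x $ i" "x $ i \<le> b $ i - 1 / real k" for i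
      using x by (auto simp: mem_box_cart)
    ultimately have "a $ i < x $ i" "x $ i < b $ i" for i
      by (meson less_add_same_cancel1 less_le_trans, meson diff_less_eq less_add_same_cancel1 le_less_trans)
    then show "x \<in> box a b" by (simp add: mem_box_cart)
  qed
  have "\<exists>K. compact K \<and> K \<subseteq> U \<and> (\<forall>x. x \<notin> K \<longrightarrow> box_cutoff a b k x = 0)"
  \<comment> \<open>Since \<open>1 / real 0 = 0\<close>, the shrunken closed box degenerates to
    \<open>cbox a b\<close>, which need not lie in \<open>U\<close>; the cutoff itself is then
    identically 0.\<close>
  proof (cases "k = 0")
    case True
    then have "box_cutoff a b k x = 0" for x
      by (auto simp: box_cutoff_def flat_exp_def)
    then show ?thesis using compact_empty by blast
  next
    case False
    then have "cbox (\<chi> i. a $ i + 1 / real k) (\<chi> i. b $ i - 1 / real k) \<subseteq> U"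
      using sub assms by simp
    then show ?thesis using out compact_cbox by blast
  qed
  then show ?thesis
    unfolding test_functions_def using smooth_flat_exp_algebra[OF alg] by blast
qed

lemma box_cutoff_bounds: "0 \<le> box_cutoff a b k x" "box_cutoff a b k x \<le> 1"
  unfolding box_cutoff_def
  by (intro prod_nonneg mult_nonneg_nonneg flat_exp_0_bounds ballI,
      intro prod_le_1 conjI mult_nonneg_nonneg mult_le_one flat_exp_0_bounds)

lemma box_cutoff_limit: "(\<lambda>k. box_cutoff a b k x) \<longlonglongrightarrow> indicator (box a b) x"
proof (cases "x \<in> box a b")
  case True
  then have "(\<lambda>k. box_cutoff a b k x) \<longlonglongrightarrow> (\<Prod>i::'a\<in>UNIV. 1 * 1)"
    unfolding box_cutoff_def
    by (intro tendsto_prod tendsto_mult flat_exp_0_limit) (auto simp: mem_box_cart)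
  with True show ?thesis by simp
next
  case False
  then obtain i where i: "x $ i \<le> a $ i \<or> x $ i \<ge> b $ i"
    by (auto simp: mem_box_cart not_less)
  have "box_cutoff a b k x = 0" for k
  proof -
    have "real k * (x $ i - a $ i) \<le> 0 \<or> real k * (b $ i - x $ i) \<le> 0"
      using i by (auto simp: mult_le_0_iff)
    then have "flat_exp 0 (real k * (x $ i - a $ i) - 1) * flat_exp 0 (real k * (b $ i - x $ i) - 1) = 0"
      by (auto simp: flat_exp_def)
    then show ?thesis
      unfolding box_cutoff_def by (intro prod_zero) auto
  qed
  with False show ?thesis by simp
qed

lemma test_approximable_box:
  assumes M: "finite_measure M" "sets M = sets borel" and "box a b \<subseteq> U"
  shows "test_approximable M U (indicator (box a b))"
proof (rule test_approximable_dominated[OF M, where w = "\<lambda>_. 1"])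
  show "test_approximable M U (box_cutoff a b n)" for n
    unfolding test_approximable_def
  proof (intro conjI allI impI)
    show "integrable M (box_cutoff a b n)"
      by (rule test_function_integrable_finite[OF M box_cutoff_test_function[OF assms(3)]])
    fix \<epsilon> :: real assume "\<epsilon> > 0"
    then show "\<exists>\<eta>\<in>test_functions U. (LINT x|M. \<bar>box_cutoff a b n x - \<eta> x\<bar>) < \<epsilon>"
      by (intro bexI[OF _ box_cutoff_test_function[OF assms(3), of n]]) simp
  qed
  show "(\<lambda>n. box_cutoff a b n x) \<longlonglongrightarrow> indicator (box a b) x" for x
    by (rule box_cutoff_limit)
  show "integrable M (\<lambda>_. 1::real)"
    using finite_measure.integrable_const[OF M(1)] by blast
  show "\<bar>box_cutoff a b n x\<bar> \<le> 1" for n x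
    using box_cutoff_bounds[of a b n x] by simp
qed simp

lemma test_approximable_zero: "test_approximable M U (\<lambda>x. 0)"
  unfolding test_approximable_def using test_functions_zero by (auto intro!: bexI)

text \<open>Dynkin argument: boxes are stable under intersection and generate the Borel sets.
  Intersecting with one fixed box keeps the approximants supported in \<open>U\<close> and turns
  complements into differences from the indicator of that box, which is already
  approximable.\<close>

lemma test_approximable_Int_box:
  fixes a b :: "real^'n"
  assumes M: "finite_measure M" "sets M = sets borel" and U: "box a b \<subseteq> U" and E: "E \<in> sets borel"
  shows "test_approximable M U (indicator (E \<inter> box a b))"
proof -
  let ?G = "range (\<lambda>(a, b). box a b :: (real^'n) set)"
  have one: "integrable M (\<lambda>_. 1::real)"
    using finite_measure.integrable_const[OF M(1)] by blast
  have sigma: "sets borel = sigma_sets UNIV ?G"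
    unfolding borel_eq_box by (simp add: sets_measure_of)
  have Int_box: "\<exists>p q. box c d \<inter> box c' d' = box p q" for c d c' d' :: "real^'n"
    unfolding box_Int_box by blast
  have "Int_stable ?G"
  proof (rule Int_stableI)
    fix A A' assume "A \<in> ?G" "A' \<in> ?G"
    then obtain c d c' d' where "A = box c d" "A' = box c' d'" by auto
    then obtain p q where "A \<inter> A' = box p q" using Int_box by blast
    then show "A \<inter> A' \<in> ?G" by auto
  qed
  moreover have "?G \<subseteq> Pow UNIV" by simp
  moreover have "E \<in> sigma_sets UNIV ?G" using E by (simp only: sigma)
  ultimately show ?thesis
  proof (induction rule: sigma_sets_induct_disjoint)
    case (basic A)
    then obtain c d where "A = box c d" by auto
    moreover obtain p q where "box c d \<inter> box a b = box p q" using Int_box by blast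
    ultimately show ?case
      using test_approximable_box[OF M, of p q U] U by auto
  next
    case empty
    show ?case
      using test_approximable_zero by (simp add: indicator_def)
  next
    case (compl A)
    have "indicator ((UNIV - A) \<inter> box a b) = (\<lambda>x. 1 * indicator (box a b) x + (- 1) * indicator (A \<inter> box a b) x :: real)"
      by (auto simp: indicator_def fun_eq_iff)
    then show ?case
      using test_approximable_linear_combination[OF M test_approximable_box[OF M U] compl(2), of 1 "-1"] by simp
  next
    case (union A)
    have fin: "test_approximable M U (indicator ((\<Union>i<n. A i) \<inter> box a b))" for n
    proof (induction n)
      case 0
      show ?case using test_approximable_zero by (simp add: indicator_def)
    next
      case (Suc n)
      have "A n \<inter> A i = {}" if "i < n" for i
        using disjoint_family_onD[OF union(1)] that by simp
      then have "A n \<inter> (\<Union>i<n. A i) = {}" by blast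
      then have "indicator ((\<Union>i<Suc n. A i) \<inter> box a b) =
        (\<lambda>x. 1 * indicator ((\<Union>i<n. A i) \<inter> box a b) x + 1 * indicator (A n \<inter> box a b) x :: real)"
        by (auto simp: indicator_def fun_eq_iff lessThan_Suc)
      then show ?case
        using test_approximable_linear_combination[OF M Suc union(3)[of n], of 1 1] by simp
    qed
    have meas: "A i \<in> sets borel" for i using union(2) sigma by blast
    show ?case
    proof (rule test_approximable_dominated[OF M fin, where w = "\<lambda>_. 1", OF _ _ one])
      show "(indicator ((\<Union>i. A i) \<inter> box a b) :: real^'n \<Rightarrow> real) \<in> borel_measurable borel"
        using meas by measurable
      show "(\<lambda>n. indicator ((\<Union>i<n. A i) \<inter> box a b) x :: real) \<longlonglongrightarrow> indicator ((\<Union>i. A i) \<inter> box a b) x" for x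
        using LIMSEQ_indicator_UN[of "\<lambda>i. A i \<inter> box a b" x]
        by (simp only: UN_simps)
    qed (auto simp: indicator_def)
  qed
qed

text \<open>The boxes exhausting \<open>U\<close> overlap, so finite unions are handled by removing
  the earlier boxes from the Borel set before intersecting it with the next one; the countable union
  follows by dominated convergence.\<close>

lemma test_approximable_Int_open:
  fixes U :: "(real^'n) set"
  assumes M: "finite_measure M" "sets M = sets borel" and U: "open U" and E: "E \<in> sets borel"
  shows "test_approximable M U (indicator (E \<inter> U))"
proof -
  have one: "integrable M (\<lambda>_. 1::real)"
    using finite_measure.integrable_const[OF M(1)] by blast
  obtain \<D> where D: "countable \<D>" "\<D> \<subseteq> Pow U" "\<And>X. X \<in> \<D> \<Longrightarrow> \<exists>a b. X = box a b" "\<Union>\<D> = U"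
    using open_countable_Union_open_box[OF U] by blast
  \<comment> \<open>For the empty family \<open>from_nat_into\<close> has no specified value, hence
    the explicit default.\<close>
  define Q where "Q n = (if \<D> = {} then {} else from_nat_into \<D> n)" for n
  have box: "\<exists>a b. Q n = box a b \<and> box a b \<subseteq> U" for n
  proof (cases "\<D> = {}")
    case True
    then show ?thesis by (intro exI[of _ 0]) (simp add: Q_def)
  next
    case False
    then have "Q n \<in> \<D>" by (simp add: Q_def from_nat_into)
    then obtain a b where "Q n = box a b" using D(3) by meson
    moreover have "Q n \<subseteq> U" using D(2) \<open>Q n \<in> \<D>\<close> by auto
    ultimately show ?thesis by auto
  qed
  have UQ: "(\<Union>n. Q n) = U"
    using D(1,4) range_from_nat_into[of \<D>] by (cases "\<D> = {}") (auto simp: Q_def)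
  have Qm: "Q n \<in> sets borel" for n using box[of n] by auto

  have fin: "test_approximable M U (indicator (E' \<inter> (\<Union>i<n. Q i)))" if "E' \<in> sets borel" for n E'
    using that
  proof (induction n)
    case 0
    show ?case using test_approximable_zero by (simp add: indicator_def)
  next
    case (Suc n)
    have "indicator (E' \<inter> (\<Union>i<Suc n. Q i)) =
        (\<lambda>x. 1 * indicator (E' \<inter> (\<Union>i<n. Q i)) x + 1 * indicator ((E' - (\<Union>i<n. Q i)) \<inter> Q n) x :: real)"
      by (auto simp: indicator_def fun_eq_iff lessThan_Suc)
    moreover have "test_approximable M U (indicator ((E' - (\<Union>i<n. Q i)) \<inter> Q n))"
      using box[of n] test_approximable_Int_box[OF M] Suc.prems Qm by auto
    ultimately show ?case
      using test_approximable_linear_combination[OF M Suc.IH[OF Suc.prems], of _ 1 1] by simp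
  qed
  show ?thesis
  proof (rule test_approximable_dominated[OF M fin[OF E], where w = "\<lambda>_. 1", OF _ _ one])
    show "(indicator (E \<inter> U) :: real^'n \<Rightarrow> real) \<in> borel_measurable borel"
      using E borel_open[OF U] by (intro borel_measurable_indicator sets.Int)
    show "(\<lambda>n. indicator (E \<inter> (\<Union>i<n. Q i)) x :: real) \<longlonglongrightarrow> indicator (E \<inter> U) x" for x
      using LIMSEQ_indicator_UN[of "\<lambda>i. E \<inter> Q i" x] unfolding UQ[symmetric]
      by (simp only: Int_UN_distrib)
  qed (auto simp: indicator_def)
qed

text \<open>The factor \<open>indicator U\<close> is there because all approximants vanish off
  \<open>U\<close>. The induction goes through indicators, sums and dominated limits of simple
  functions.\<close>

theorem test_functions_dense_L1:
  fixes U :: "(real^'n) set"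
  assumes M: "finite_measure M" "sets M = sets borel" and U: "open U" and f: "integrable M f"
  shows "test_approximable M U (\<lambda>x. indicator U x * f x)"
  using f
proof (induction rule: integrable_induct)
  case (base A c)
  have "A \<in> sets borel" using base M(2) by blast
  then have A: "test_approximable M U (indicator (A \<inter> U))"
    using test_approximable_Int_open[OF M U] by blast
  have "(\<lambda>x. indicator U x * (indicator A x *\<^sub>R c)) = (\<lambda>x. c * indicator (A \<inter> U) x + 0 * indicator (A \<inter> U) x)"
    by (auto simp: indicator_def fun_eq_iff)
  then show ?case
    using test_approximable_linear_combination[OF M A A, of c 0] by argo
next
  case (add f g)
  then show ?case
    using test_approximable_linear_combination[OF M add(3,4), of 1 1] by (simp add: distrib_left)
next
  case (lim f s)
  have Um: "U \<in> sets M" using U M(2) by simp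
  show ?case
  proof (rule test_approximable_limit[OF M lim(5)])
    show int: "integrable M (\<lambda>x. indicator U x * f x)"
      using integrable_mult_indicator[OF Um lim(4)] by simp
    have "(\<lambda>n. LINT x|M. \<bar>indicator U x * f x - indicator U x * s n x\<bar>) \<longlonglongrightarrow> (LINT x|M. 0)"
    \<comment> \<open>\<open>integrable_induct\<close> supplies simple functions with |s n x| <= 2
      |f x|, hence the factor 3.\<close>
    proof (rule integral_dominated_convergence[where w = "\<lambda>x. 3 * \<bar>f x\<bar>"])
      show "(\<lambda>x. \<bar>indicator U x * f x - indicator U x * s n x\<bar>) \<in> borel_measurable M" for n
        using lim(1,4) Um by measurable
      show "integrable M (\<lambda>x. 3 * \<bar>f x\<bar>)" using lim(4) by simp
      show "AE x in M. (\<lambda>n. \<bar>indicator U x * f x - indicator U x * s n x\<bar>) \<longlonglongrightarrow> 0"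
      proof (rule AE_I2)
        fix x assume "x \<in> space M"
        then have "(\<lambda>n. indicator U x * f x - indicator U x * s n x) \<longlonglongrightarrow> indicator U x * f x - indicator U x * f x"
          by (intro tendsto_intros lim(2))
        then show "(\<lambda>n. \<bar>indicator U x * f x - indicator U x * s n x\<bar>) \<longlonglongrightarrow> 0"
          using tendsto_rabs_zero by simp
      qed
      show "AE x in M. norm \<bar>indicator U x * f x - indicator U x * s n x\<bar> \<le> 3 * \<bar>f x\<bar>" for n
      proof (rule AE_I2)
        fix x assume "x \<in> space M"
        then have "\<bar>s n x\<bar> \<le> 2 * \<bar>f x\<bar>" using lim(3)[of x n] by simp
        then show "norm \<bar>indicator U x * f x - indicator U x * s n x\<bar> \<le> 3 * \<bar>f x\<bar>"
          by (auto simp: indicator_def)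
      qed
    qed simp
    then show "(\<lambda>n. LINT x|M. \<bar>indicator U x * f x - indicator U x * s n x\<bar>) \<longlonglongrightarrow> 0" by simp
  qed
qed

section \<open>Measurability and representatives\<close>

lemma borel_measurable_vec_iff:
  fixes f :: "'a \<Rightarrow> 'b::euclidean_space ^ 'n"
  shows "f \<in> borel_measurable M \<longleftrightarrow> (\<forall>i. (\<lambda>x. f x $ i) \<in> borel_measurable M)"
proof
  assume f: "f \<in> borel_measurable M"
  have "(\<lambda>v::'b^'n. v $ i) \<in> borel_measurable borel" for i
    by (rule borel_measurable_continuous_onI[OF linear_continuous_on[OF bounded_linear_vec_nth]])
  from measurable_compose[OF f this] show "\<forall>i. (\<lambda>x. f x $ i) \<in> borel_measurable M" by blast
next
  assume f: "\<forall>i. (\<lambda>x. f x $ i) \<in> borel_measurable M"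
  show "f \<in> borel_measurable M"
  proof (subst borel_measurable_euclidean_space, rule ballI)
    fix b :: "'b^'n" assume "b \<in> Basis"
    then obtain i c where "b = axis i c" unfolding Basis_vec_def by blast
    then have "(\<lambda>x. f x \<bullet> b) = (\<lambda>x. f x $ i \<bullet> c)" by (simp add: inner_axis)
    then show "(\<lambda>x. f x \<bullet> b) \<in> borel_measurable M"
      using f by (auto intro: borel_measurable_inner)
  qed
qed

lemma AE_lebesgue_on_iff:
  "U \<in> sets borel \<Longrightarrow> (AE x in lebesgue_on U. P x) \<longleftrightarrow> (AE x in lborel. x \<in> U \<longrightarrow> P x)"
  by (simp add: AE_restrict_space_iff AE_completion_iff)

text \<open>Translations and compositions are handled for Borel functions on the whole space,
  whereas elements of \<open>L2\<close> are measurable only for the completed measure on their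
  domain. This lemma and the next two move integrals back and forth.\<close>

lemma borel_representative:
  fixes f :: "'a::euclidean_space \<Rightarrow> real"
  assumes U: "U \<in> sets borel" and f: "f \<in> borel_measurable (lebesgue_on U)"
  obtains g where "g \<in> borel_measurable borel" "\<And>x. x \<notin> U \<Longrightarrow> g x = 0" "AE x in lebesgue_on U. f x = g x"
proof -
  have "(\<lambda>x. if x \<in> U then f x else 0) \<in> borel_measurable lebesgue"
    using U f by (intro borel_measurable_if_I) auto
  then obtain h where h: "h \<in> borel_measurable lborel" "AE x in lborel. (if x \<in> U then f x else 0) = h x"
    using completion_ex_borel_measurable_real by blast
  show ?thesis
  proof (rule that)
    show "(\<lambda>x. indicator U x * h x) \<in> borel_measurable borel"
      using h(1) U by (intro borel_measurable_times borel_measurable_indicator) simp_all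
    show "AE x in lebesgue_on U. f x = indicator U x * h x"
      unfolding AE_lebesgue_on_iff[OF U] using h(2) by eventually_elim (simp split: if_splits)
  qed simp
qed

lemma
  fixes f g :: "'a::euclidean_space \<Rightarrow> real"
  assumes U: "U \<in> sets borel" and f: "f \<in> borel_measurable (lebesgue_on U)"
    and g: "g \<in> borel_measurable borel" "\<And>x. x \<notin> U \<Longrightarrow> g x = 0" "AE x in lebesgue_on U. f x = g x"
  shows integrable_borel_representative: "integrable (lebesgue_on U) f \<longleftrightarrow> integrable lborel g" (is ?A)
    and integral_borel_representative: "(LINT x|lebesgue_on U. f x) = (LINT x|lborel. g x)" (is ?B)
proof -
  have Ul: "U \<in> sets lebesgue" using U by auto
  have m: "(\<lambda>x. if x \<in> U then f x else 0) \<in> borel_measurable lebesgue"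
    using Ul f by (intro borel_measurable_if_I) auto
  have gl: "g \<in> borel_measurable lebesgue" using g(1) by (intro measurable_completion) simp
  have ae: "AE x in lebesgue. (if x \<in> U then f x else 0) = g x"
    using g(3) unfolding AE_lebesgue_on_iff[OF U] AE_completion_iff
    by eventually_elim (use g(2) in auto)
  have g': "g \<in> borel_measurable lborel" using g(1) by simp
  show ?A
    using integrable_cong_AE[OF m gl ae] Lebesgue_Measure.integrable_restrict_UNIV[OF Ul, of f] integrable_completion[OF g'] by blast
  show ?B
    using integral_cong_AE[OF m gl ae] Lebesgue_Measure.integral_restrict_UNIV[OF Ul, of f] integral_completion[OF g'] by simp
qed

lemma borel_measurable_lebesgue_on:
  "f \<in> borel_measurable borel \<Longrightarrow> f \<in> borel_measurable (lebesgue_on U)"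
  by (intro measurable_restrict_space1 measurable_completion) simp

text \<open>Approximate sgn g by a test function \<eta> in L1 of the measure |g| dx. As the integral
  of g \<eta> vanishes, the integral of |g| equals that of g (sgn g - \<eta>), which is at most the
  approximation error in exactly this measure.\<close>

theorem fundamental_lemma_calculus_of_variations:
  fixes f :: "real^'n \<Rightarrow> real"
  assumes U: "open U" and f: "integrable (lebesgue_on U) f"
    and zero: "\<And>\<phi>. \<phi> \<in> test_functions U \<Longrightarrow> (LINT x|lebesgue_on U. f x * \<phi> x) = 0"
  shows "AE x in lebesgue_on U. f x = 0"
proof -
  have Ub: "U \<in> sets borel" using U by simp
  have fm: "f \<in> borel_measurable (lebesgue_on U)" using f by auto
  obtain g where g[measurable]: "g \<in> borel_measurable borel" and g0: "\<And>x. x \<notin> U \<Longrightarrow> g x = 0"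
    and fg: "AE x in lebesgue_on U. f x = g x"
    using borel_representative[OF Ub fm] by blast
  have gi: "integrable lborel g"
    using f integrable_borel_representative[OF Ub fm g g0 fg] by blast
  define M where "M = density lborel (\<lambda>x. ennreal \<bar>g x\<bar>)"
  have M: "finite_measure M" "sets M = sets borel"
  proof
    have "emeasure M (space M) = (\<integral>\<^sup>+x. ennreal \<bar>g x\<bar> \<partial>lborel)"
      unfolding M_def by (subst emeasure_density) (auto intro!: nn_integral_cong)
    then show "emeasure M (space M) \<noteq> \<infinity>"
      using gi by (simp add: integrable_iff_bounded)
  qed (simp add: M_def)
  have sgn: "integrable M (\<lambda>x. sgn (g x))"
    by (rule finite_measure.integrable_const_bound[OF M(1), where B = 1])
      (auto simp: sgn_real_def M_def)
  have sg: "(\<lambda>x. indicator U x * sgn (g x)) = (\<lambda>x. sgn (g x))"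
    using g0 by (fastforce simp: indicator_def)
  have "test_approximable M U (\<lambda>x. sgn (g x))"
    using test_functions_dense_L1[OF M U sgn] unfolding sg .
  have small: "(LINT x|lborel. \<bar>g x\<bar>) \<le> \<epsilon>" if eps: "\<epsilon> > 0" for \<epsilon>
  proof -
    obtain \<eta> where \<eta>: "\<eta> \<in> test_functions U" "(LINT x|M. \<bar>sgn (g x) - \<eta> x\<bar>) < \<epsilon>"
      using \<open>test_approximable M U (\<lambda>x. sgn (g x))\<close> eps unfolding test_approximable_def by blast
    have \<eta>m[measurable]: "\<eta> \<in> borel_measurable borel"
      by (rule test_function_borel_measurable[OF \<eta>(1)])
    obtain C where C: "C > 0" "\<And>x. \<bar>\<eta> x\<bar> \<le> C" using test_function_bounded[OF \<eta>(1)] by blast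
    have int: "integrable lborel (\<lambda>x. g x * \<eta> x)"
    proof (rule Bochner_Integration.integrable_bound[where f = "\<lambda>x. C * g x"])
      show "AE x in lborel. norm (g x * \<eta> x) \<le> norm (C * g x)"
        using C by (intro AE_I2) (auto simp: abs_mult mult.commute[of C] intro!: mult_left_mono)
    qed (use gi in auto)
    have "(LINT x|lebesgue_on U. f x * \<eta> x) = (LINT x|lborel. g x * \<eta> x)"
    proof (rule integral_borel_representative[OF Ub])
      show "(\<lambda>x. f x * \<eta> x) \<in> borel_measurable (lebesgue_on U)"
        using fm borel_measurable_lebesgue_on[OF \<eta>m] by (rule borel_measurable_times)
      show "AE x in lebesgue_on U. f x * \<eta> x = g x * \<eta> x" using fg by eventually_elim simp
    qed (use g0 in auto)
    then have z: "(LINT x|lborel. g x * \<eta> x) = 0" using zero[OF \<eta>(1)] by simp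
    have eq: "g x * sgn (g x) = \<bar>g x\<bar>" for x by (simp add: sgn_real_def)
    have "(LINT x|lborel. \<bar>g x\<bar>) = (LINT x|lborel. g x * (sgn (g x) - \<eta> x))"
      using gi int z by (simp add: right_diff_distrib eq)
    also have "\<dots> \<le> (LINT x|lborel. \<bar>g x\<bar> * \<bar>sgn (g x) - \<eta> x\<bar>)"
    proof (intro integral_mono)
      show *: "integrable lborel (\<lambda>x. g x * (sgn (g x) - \<eta> x))"
        using gi int by (simp add: right_diff_distrib eq)
      show "integrable lborel (\<lambda>x. \<bar>g x\<bar> * \<bar>sgn (g x) - \<eta> x\<bar>)"
        using integrable_abs[OF *] by (simp add: abs_mult)
      show "g x * (sgn (g x) - \<eta> x) \<le> \<bar>g x\<bar> * \<bar>sgn (g x) - \<eta> x\<bar>" for x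
        by (metis abs_ge_self abs_mult)
    qed
    also have "\<dots> = (LINT x|M. \<bar>sgn (g x) - \<eta> x\<bar>)"
      unfolding M_def by (subst integral_density) auto
    finally show ?thesis using \<eta>(2) by simp
  qed
  have "(LINT x|lborel. \<bar>g x\<bar>) \<le> 0" by (rule field_le_epsilon) (simp add: small)
  then have "(LINT x|lborel. \<bar>g x\<bar>) = 0" by (simp add: antisym)
  then have "AE x in lborel. \<bar>g x\<bar> = 0"
    using gi by (subst (asm) integral_nonneg_eq_0_iff_AE) auto
  then have "AE x in lebesgue_on U. g x = 0"
    unfolding AE_lebesgue_on_iff[OF Ub] by eventually_elim simp
  with fg show ?thesis by eventually_elim simp
qed

section \<open>Semi-inner products on function spaces\<close>

text \<open>Functions equal almost everywhere are not identified, so the forms are only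
  semidefinite, and they are linear only on the carrier \<open>S\<close>. The same facts then serve
  \<open>L2\<close> and \<open>H1\<close>.\<close>

locale semi_inner_space =
  fixes S :: "('a \<Rightarrow> 'b::real_vector) set" and ip :: "('a \<Rightarrow> 'b) \<Rightarrow> ('a \<Rightarrow> 'b) \<Rightarrow> real"
  assumes closed: "f \<in> S \<Longrightarrow> g \<in> S \<Longrightarrow> (\<lambda>x. a *\<^sub>R f x + b *\<^sub>R g x) \<in> S"
    and linear: "f \<in> S \<Longrightarrow> g \<in> S \<Longrightarrow> h \<in> S \<Longrightarrow> ip (\<lambda>x. a *\<^sub>R f x + b *\<^sub>R g x) h = a * ip f h + b * ip g h"
    and commute: "ip f g = ip g f"
    and nonneg: "f \<in> S \<Longrightarrow> 0 \<le> ip f f"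
begin

definition nm :: "('a \<Rightarrow> 'b) \<Rightarrow> real" where "nm f = sqrt (ip f f)"

lemma nm_nonneg: "f \<in> S \<Longrightarrow> 0 \<le> nm f"
  by (simp add: nm_def nonneg)

lemma nm_square: "f \<in> S \<Longrightarrow> (nm f)\<^sup>2 = ip f f"
  by (simp add: nm_def nonneg)

lemma linear_right:
  "f \<in> S \<Longrightarrow> g \<in> S \<Longrightarrow> h \<in> S \<Longrightarrow> ip h (\<lambda>x. a *\<^sub>R f x + b *\<^sub>R g x) = a * ip h f + b * ip h g"
  using linear[of f g h] by (simp add: commute)

lemma diff_eq: "f - g = (\<lambda>x. 1 *\<^sub>R f x + (- 1) *\<^sub>R (g x :: 'b))"
  by (auto simp: fun_diff_def)

lemma closed_diff: "f \<in> S \<Longrightarrow> g \<in> S \<Longrightarrow> f - g \<in> S"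
  unfolding diff_eq by (rule closed)

lemma diff_left: "f \<in> S \<Longrightarrow> g \<in> S \<Longrightarrow> h \<in> S \<Longrightarrow> ip (f - g) h = ip f h - ip g h"
  unfolding diff_eq by (simp only: linear)

lemma diff_right: "f \<in> S \<Longrightarrow> g \<in> S \<Longrightarrow> h \<in> S \<Longrightarrow> ip h (f - g) = ip h f - ip h g"
  using diff_left[of f g h] by (simp add: commute)

lemma ip_combination:
  assumes "f \<in> S" "g \<in> S"
  shows "ip (\<lambda>x. a *\<^sub>R f x + b *\<^sub>R g x) (\<lambda>x. a *\<^sub>R f x + b *\<^sub>R g x)
    = a\<^sup>2 * ip f f + 2 * a * b * ip f g + b\<^sup>2 * ip g g"
  using assms closed[OF assms, of a b]
  by (simp add: linear linear_right commute[of g f] power2_eq_square algebra_simps)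

lemma cauchy_schwarz:
  assumes "f \<in> S" "g \<in> S"
  shows "\<bar>ip f g\<bar> \<le> nm f * nm g"
proof -
  have quad: "0 \<le> a\<^sup>2 * ip f f + 2 * a * b * ip f g + b\<^sup>2 * ip g g" for a b
    using nonneg[OF closed[OF assms, of a b]] by (simp only: ip_combination[OF assms])
  have "(ip f g)\<^sup>2 \<le> ip f f * ip g g"
  \<comment> \<open>A null \<open>f\<close> need not be the zero function. If \<open>ip f g\<close>
    were nonzero, the coefficient chosen below would give the nonnegative quadratic the value
    -1.\<close>
  proof (cases "ip f f = 0")
    case True
    have "ip f g = 0"
    proof (rule ccontr)
      assume n: "ip f g \<noteq> 0"
      have "0 \<le> 2 * (- (ip g g + 1) / (2 * ip f g)) * ip f g + ip g g"
        using quad[of "- (ip g g + 1) / (2 * ip f g)" 1] True by simp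
      also have "\<dots> = - 1" using n by (simp add: field_simps)
      finally show False by simp
    qed
    then show ?thesis using True by simp
  next
    case False
    then have pos: "ip f f > 0" using nonneg[OF assms(1)] by simp
    have "0 \<le> ip f f * (ip f f * ip g g - (ip f g)\<^sup>2)"
      using quad[of "- ip f g" "ip f f"] by (simp add: power2_eq_square algebra_simps)
    then show ?thesis using pos by (simp add: zero_le_mult_iff)
  qed
  then have "sqrt ((ip f g)\<^sup>2) \<le> sqrt (ip f f * ip g g)" by (rule real_sqrt_le_mono)
  then show ?thesis by (simp add: nm_def real_sqrt_mult)
qed

lemma nm_combination:
  assumes "f \<in> S" "g \<in> S"
  shows "nm (\<lambda>x. a *\<^sub>R f x + b *\<^sub>R g x) \<le> \<bar>a\<bar> * nm f + \<bar>b\<bar> * nm g"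
proof (rule power2_le_imp_le)
  have "a * b * ip f g \<le> \<bar>a\<bar> * \<bar>b\<bar> * (nm f * nm g)"
    using mult_left_mono[OF cauchy_schwarz[OF assms] abs_ge_zero, of "a * b"] abs_ge_self[of "a * b * ip f g"]
    unfolding abs_mult by linarith
  then show "(nm (\<lambda>x. a *\<^sub>R f x + b *\<^sub>R g x))\<^sup>2 \<le> (\<bar>a\<bar> * nm f + \<bar>b\<bar> * nm g)\<^sup>2"
    unfolding nm_square[OF closed[OF assms]] ip_combination[OF assms] power2_sum power_mult_distrib
    by (simp add: nm_square assms algebra_simps)
  show "0 \<le> \<bar>a\<bar> * nm f + \<bar>b\<bar> * nm g" by (simp add: nm_nonneg assms)
qed

text \<open>The last term is oriented as \<open>h - g\<close> to match discrete errors such as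
  \<open>uh - v\<close>, the quantities that are estimated later.\<close>

lemma triangle:
  assumes "f \<in> S" "g \<in> S" "h \<in> S"
  shows "nm (f - h) \<le> nm (f - g) + nm (h - g)"
proof -
  have "f - h = (\<lambda>x. 1 *\<^sub>R (f - g) x + (- 1) *\<^sub>R (h - g) x)" by (auto simp: fun_diff_def)
  then show ?thesis
    using nm_combination[OF closed_diff[OF assms(1,2)] closed_diff[OF assms(3,2)], of 1 "- 1"] by simp
qed

lemma triangle_le:
  assumes "f \<in> S" "g \<in> S"
  shows "nm f \<le> nm g + nm (f - g)"
proof -
  have "f = (\<lambda>x. 1 *\<^sub>R g x + 1 *\<^sub>R (f - g) x)" by (auto simp: fun_diff_def)
  then show ?thesis
    using nm_combination[OF assms(2) closed_diff[OF assms], of 1 1] by simp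
qed

end

section \<open>Lebesgue spaces\<close>

lemma L2_measurable: "f \<in> L2 D \<Longrightarrow> f \<in> borel_measurable (lebesgue_on D)"
  by (simp add: L2_def)

lemma L2_square_integrable: "f \<in> L2 D \<Longrightarrow> integrable (lebesgue_on D) (\<lambda>x. (norm (f x))\<^sup>2)"
  by (simp add: L2_def)

lemma L2_bound:
  assumes "f \<in> borel_measurable (lebesgue_on D)" "integrable (lebesgue_on D) g"
    "AE x in lebesgue_on D. (norm (f x))\<^sup>2 \<le> g x"
  shows "f \<in> L2 D"
  unfolding L2_def
proof (intro CollectI conjI assms(1))
  show "integrable (lebesgue_on D) (\<lambda>x. (norm (f x))\<^sup>2)"
    by (rule Bochner_Integration.integrable_bound[OF assms(2)])
      (use assms(1,3) in \<open>auto elim!: eventually_mono\<close>)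
qed

lemma L2_inner_integrable:
  assumes "f \<in> L2 D" "g \<in> L2 D"
  shows "integrable (lebesgue_on D) (\<lambda>x. f x \<bullet> g x)"
proof (rule Bochner_Integration.integrable_bound)
  show "integrable (lebesgue_on D) (\<lambda>x. (norm (f x))\<^sup>2 + (norm (g x))\<^sup>2)"
    using assms by (intro Bochner_Integration.integrable_add L2_square_integrable)
  show "(\<lambda>x. f x \<bullet> g x) \<in> borel_measurable (lebesgue_on D)"
    using assms by (intro borel_measurable_inner L2_measurable)
  have "\<bar>f x \<bullet> g x\<bar> \<le> (norm (f x))\<^sup>2 + (norm (g x))\<^sup>2" for x
  proof -
    have "\<bar>f x \<bullet> g x\<bar> \<le> norm (f x) * norm (g x)" by (rule Cauchy_Schwarz_ineq2)
    also have "\<dots> \<le> (norm (f x))\<^sup>2 + (norm (g x))\<^sup>2"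
      using sum_squares_bound[of "norm (f x)" "norm (g x)"] mult_nonneg_nonneg[OF norm_ge_zero norm_ge_zero, of "f x" "g x"]
      by linarith
    finally show ?thesis .
  qed
  then show "AE x in lebesgue_on D. norm (f x \<bullet> g x) \<le> norm ((norm (f x))\<^sup>2 + (norm (g x))\<^sup>2)"
    by simp
qed

lemma L2_linear_combination:
  assumes "f \<in> L2 D" "g \<in> L2 D"
  shows "(\<lambda>x. a *\<^sub>R f x + b *\<^sub>R g x) \<in> L2 D"
proof (rule L2_bound)
  show "(\<lambda>x. a *\<^sub>R f x + b *\<^sub>R g x) \<in> borel_measurable (lebesgue_on D)"
    using assms by (intro borel_measurable_add borel_measurable_scaleR borel_measurable_const L2_measurable)
  show "integrable (lebesgue_on D) (\<lambda>x. 2 * a\<^sup>2 * (norm (f x))\<^sup>2 + 2 * b\<^sup>2 * (norm (g x))\<^sup>2)"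
    using assms by (intro Bochner_Integration.integrable_add integrable_mult_right L2_square_integrable)
  have "(norm (a *\<^sub>R f x + b *\<^sub>R g x))\<^sup>2 \<le> 2 * a\<^sup>2 * (norm (f x))\<^sup>2 + 2 * b\<^sup>2 * (norm (g x))\<^sup>2" for x
  proof -
    have "(norm (a *\<^sub>R f x + b *\<^sub>R g x))\<^sup>2 \<le> (\<bar>a\<bar> * norm (f x) + \<bar>b\<bar> * norm (g x))\<^sup>2"
      using norm_triangle_ineq[of "a *\<^sub>R f x" "b *\<^sub>R g x"] by (intro power_mono) simp_all
    also have "\<dots> \<le> 2 * (\<bar>a\<bar> * norm (f x))\<^sup>2 + 2 * (\<bar>b\<bar> * norm (g x))\<^sup>2"
      using sum_squares_bound[of "\<bar>a\<bar> * norm (f x)" "\<bar>b\<bar> * norm (g x)"] by (simp add: power2_sum)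
    finally show ?thesis by (simp add: power_mult_distrib)
  qed
  then show "AE x in lebesgue_on D. (norm (a *\<^sub>R f x + b *\<^sub>R g x))\<^sup>2
      \<le> 2 * a\<^sup>2 * (norm (f x))\<^sup>2 + 2 * b\<^sup>2 * (norm (g x))\<^sup>2"
    by simp
qed

lemma semi_inner_space_L2:
  "semi_inner_space (L2 D) (l2_inner D :: ('a::euclidean_space \<Rightarrow> 'b::euclidean_space) \<Rightarrow> _ \<Rightarrow> real)"
proof
  fix f g h :: "'a \<Rightarrow> 'b" and a b :: real
  assume fgh: "f \<in> L2 D" "g \<in> L2 D" "h \<in> L2 D"
  show "l2_inner D (\<lambda>x. a *\<^sub>R f x + b *\<^sub>R g x) h = a * l2_inner D f h + b * l2_inner D g h"
    unfolding l2_inner_def inner_add_left inner_scaleR_left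
    using L2_inner_integrable[OF fgh(1,3)] L2_inner_integrable[OF fgh(2,3)] by simp
next
  show "0 \<le> l2_inner D f f" for f :: "'a \<Rightarrow> 'b"
    unfolding l2_inner_def by (rule Bochner_Integration.integral_nonneg) simp
next
  show "l2_inner D f g = l2_inner D g f" for f g :: "'a \<Rightarrow> 'b"
    by (simp add: l2_inner_def inner_commute)
qed (rule L2_linear_combination)

interpretation L2: semi_inner_space "L2 D" "l2_inner D"
  rewrites "semi_inner_space.nm (l2_inner D) = l2_norm D"
  by (rule semi_inner_space_L2)
    (simp add: fun_eq_iff semi_inner_space.nm_def[OF semi_inner_space_L2] l2_norm_def)

lemma l2_norm_nonneg [simp]: "0 \<le> l2_norm D f"
  unfolding l2_norm_def l2_inner_def by (simp add: Bochner_Integration.integral_nonneg)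

lemma l2_inner_cong_AE:
  assumes "f \<in> L2 D" "g \<in> L2 D" "f' \<in> L2 D" "g' \<in> L2 D"
    and "AE x in lebesgue_on D. f x = f' x" "AE x in lebesgue_on D. g x = g' x"
  shows "l2_inner D f g = l2_inner D f' g'"
  unfolding l2_inner_def
proof (rule integral_cong_AE)
  show "AE x in lebesgue_on D. f x \<bullet> g x = f' x \<bullet> g' x"
    using assms(5,6) by eventually_elim simp
qed (intro borel_measurable_inner L2_measurable assms)+

lemma l2_norm_square: "(l2_norm D f)\<^sup>2 = (LINT x|lebesgue_on D. (norm (f x))\<^sup>2)"
  unfolding l2_norm_def l2_inner_def
  by (simp add: Bochner_Integration.integral_nonneg power2_norm_eq_inner)

lemma l2_norm_mono:
  assumes "g \<in> L2 D" "f \<in> L2 D" "0 \<le> c" "AE x in lebesgue_on D. norm (f x) \<le> c * norm (g x)"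
  shows "l2_norm D f \<le> c * l2_norm D g"
proof (rule power2_le_imp_le)
  have "(LINT x|lebesgue_on D. (norm (f x))\<^sup>2) \<le> (LINT x|lebesgue_on D. c\<^sup>2 * (norm (g x))\<^sup>2)"
  proof (rule integral_mono_AE)
    show "AE x in lebesgue_on D. (norm (f x))\<^sup>2 \<le> c\<^sup>2 * (norm (g x))\<^sup>2"
      using assms(4)
    proof eventually_elim
      fix x assume "norm (f x) \<le> c * norm (g x)"
      then show "(norm (f x))\<^sup>2 \<le> c\<^sup>2 * (norm (g x))\<^sup>2"
        using power_mono[of "norm (f x)" "c * norm (g x)" 2] by (simp add: power_mult_distrib)
    qed
  qed (use assms(1,2) in \<open>auto intro!: L2_square_integrable\<close>)
  then show "(l2_norm D f)\<^sup>2 \<le> (c * l2_norm D g)\<^sup>2"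
    by (simp add: l2_norm_square power_mult_distrib)
qed (simp add: assms(3))

lemma bounded_linear_L2:
  assumes L: "bounded_linear L" and f: "f \<in> L2 D"
  shows "(\<lambda>x. L (f x)) \<in> L2 D"
proof (rule L2_bound)
  have Lm: "L \<in> borel_measurable borel"
    using linear_continuous_on[OF L] by (rule borel_measurable_continuous_onI)
  show "(\<lambda>x. L (f x)) \<in> borel_measurable (lebesgue_on D)"
    using measurable_compose[OF L2_measurable[OF f] Lm] .
  show "integrable (lebesgue_on D) (\<lambda>x. (onorm L)\<^sup>2 * (norm (f x))\<^sup>2)"
    using L2_square_integrable[OF f] by simp
  have "(norm (L (f x)))\<^sup>2 \<le> (onorm L)\<^sup>2 * (norm (f x))\<^sup>2" for x
    using power_mono[OF onorm[OF L, of "f x"], of 2] by (simp add: power_mult_distrib)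
  then show "AE x in lebesgue_on D. (norm (L (f x)))\<^sup>2 \<le> (onorm L)\<^sup>2 * (norm (f x))\<^sup>2" by simp
qed

lemma finite_measure_lebesgue_on_bounded: "open D \<Longrightarrow> bounded D \<Longrightarrow> finite_measure (lebesgue_on D)"
  by (intro finite_measure_lebesgue_on lmeasurable_open)

lemma L2_integrable:
  fixes f :: "'a::euclidean_space \<Rightarrow> real"
  assumes D: "open D" "bounded D" and f: "f \<in> L2 D"
  shows "integrable (lebesgue_on D) f"
proof (rule Bochner_Integration.integrable_bound)
  show "integrable (lebesgue_on D) (\<lambda>x. 1 + (norm (f x))\<^sup>2)"
    using finite_measure.integrable_const[OF finite_measure_lebesgue_on_bounded[OF D]]
      L2_square_integrable[OF f] by (intro Bochner_Integration.integrable_add)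
  show "f \<in> borel_measurable (lebesgue_on D)" using f by (rule L2_measurable)
  have "norm (f x) \<le> norm (1 + (norm (f x))\<^sup>2)" for x
    using sum_squares_bound[of 1 "\<bar>f x\<bar>"] by (simp add: power2_eq_square)
  then show "AE x in lebesgue_on D. norm (f x) \<le> norm (1 + (norm (f x))\<^sup>2)" by simp
qed

lemma bounded_L2:
  assumes D: "open D" "bounded D" and f: "f \<in> borel_measurable (lebesgue_on D)"
    and M: "AE x in lebesgue_on D. norm (f x) \<le> M"
  shows "f \<in> L2 D"
proof (rule L2_bound[OF f])
  show "integrable (lebesgue_on D) (\<lambda>x. M\<^sup>2)"
    using finite_measure.integrable_const[OF finite_measure_lebesgue_on_bounded[OF D]] .
  show "AE x in lebesgue_on D. (norm (f x))\<^sup>2 \<le> M\<^sup>2"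
    using M by eventually_elim (simp add: power_mono)
qed

lemma test_function_L2:
  assumes D: "open D" "bounded D" and \<phi>: "\<phi> \<in> test_functions U"
  shows "\<phi> \<in> L2 D"
proof -
  obtain C where "C > 0" "\<And>x. \<bar>\<phi> x\<bar> \<le> C" using test_function_bounded[OF \<phi>] by blast
  then show ?thesis
    by (intro bounded_L2[OF D borel_measurable_lebesgue_on[OF test_function_borel_measurable[OF \<phi>]], of C]) simp
qed

lemma L2_vec_iff:
  fixes f :: "'a::euclidean_space \<Rightarrow> 'b::euclidean_space ^ 'n"
  shows "f \<in> L2 D \<longleftrightarrow> (\<forall>i. (\<lambda>x. f x $ i) \<in> L2 D)"
proof
  assume "f \<in> L2 D"
  then show "\<forall>i. (\<lambda>x. f x $ i) \<in> L2 D"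
    using bounded_linear_L2[OF bounded_linear_vec_nth] by blast
next
  assume f: "\<forall>i. (\<lambda>x. f x $ i) \<in> L2 D"
  show "f \<in> L2 D"
  proof (rule L2_bound)
    show "f \<in> borel_measurable (lebesgue_on D)"
      unfolding borel_measurable_vec_iff using f L2_measurable by blast
    show "integrable (lebesgue_on D) (\<lambda>x. \<Sum>i\<in>UNIV. (norm (f x $ i))\<^sup>2)"
      using f L2_square_integrable by (intro Bochner_Integration.integrable_sum) blast
    show "AE x in lebesgue_on D. (norm (f x))\<^sup>2 \<le> (\<Sum>i\<in>UNIV. (norm (f x $ i))\<^sup>2)"
      by (simp add: norm_vec_def L2_set_def sum_nonneg)
  qed
qed

lemma L2_test_integrable:
  fixes f :: "real^'n \<Rightarrow> real"
  assumes D: "open D" "bounded D" and f: "f \<in> L2 D" and \<phi>: "\<phi> \<in> test_functions U"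
  shows "integrable (lebesgue_on D) (\<lambda>x. f x * \<phi> x)"
  using L2_inner_integrable[OF f test_function_L2[OF D \<phi>]] by simp

section \<open>Weak gradients\<close>

lemma weak_gradient_linear_combination:
  assumes D: "open D" "bounded D" and "u \<in> L2 D" "v \<in> L2 D" "G \<in> L2 D" "H \<in> L2 D"
    and "weak_gradient D u G" "weak_gradient D v H"
  shows "weak_gradient D (\<lambda>x. a *\<^sub>R u x + b *\<^sub>R v x) (\<lambda>x. a *\<^sub>R G x + b *\<^sub>R H x)"
  unfolding weak_gradient_def
proof (intro ballI allI)
  fix \<phi> i j assume \<phi>: "\<phi> \<in> test_functions D"
  have d\<phi>: "partial_deriv j \<phi> \<in> test_functions D" by (rule test_functions_partial_deriv[OF \<phi>])
  have c: "(\<lambda>x. u x $ i) \<in> L2 D" "(\<lambda>x. v x $ i) \<in> L2 D" "(\<lambda>x. G x $ i $ j) \<in> L2 D" "(\<lambda>x. H x $ i $ j) \<in> L2 D"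
    using assms(3-6) by (auto simp: L2_vec_iff)
  note int = L2_test_integrable[OF D c(1) d\<phi>] L2_test_integrable[OF D c(2) d\<phi>]
    L2_test_integrable[OF D c(3) \<phi>] L2_test_integrable[OF D c(4) \<phi>]
  have "(LINT x|lebesgue_on D. (a *\<^sub>R u x + b *\<^sub>R v x) $ i * partial_deriv j \<phi> x)
     = (LINT x|lebesgue_on D. a * (u x $ i * partial_deriv j \<phi> x) + b * (v x $ i * partial_deriv j \<phi> x))"
    by (simp add: distrib_right mult.assoc)
  also have "\<dots> = a * (LINT x|lebesgue_on D. u x $ i * partial_deriv j \<phi> x) + b * (LINT x|lebesgue_on D. v x $ i * partial_deriv j \<phi> x)"
    using int by simp
  also have "\<dots> = - (a * (LINT x|lebesgue_on D. G x $ i $ j * \<phi> x) + b * (LINT x|lebesgue_on D. H x $ i $ j * \<phi> x))"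
    using assms(7,8) \<phi> by (simp add: weak_gradient_def)
  also have "\<dots> = - (LINT x|lebesgue_on D. a * (G x $ i $ j * \<phi> x) + b * (H x $ i $ j * \<phi> x))"
    using int by simp
  finally show "(LINT x|lebesgue_on D. (a *\<^sub>R u x + b *\<^sub>R v x) $ i * partial_deriv j \<phi> x)
     = - (LINT x|lebesgue_on D. (a *\<^sub>R G x + b *\<^sub>R H x) $ i $ j * \<phi> x)"
    by (simp add: distrib_right mult.assoc)
qed

text \<open>This is what makes the choice in \<open>grad\<close> harmless: all later identities for
  \<open>grad\<close> are equalities almost everywhere, carried through integrals.\<close>

lemma weak_gradient_unique:
  assumes D: "open D" "bounded D" and GH: "G \<in> L2 D" "H \<in> L2 D"
    and "weak_gradient D u G" "weak_gradient D u H"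
  shows "AE x in lebesgue_on D. G x = H x"
proof -
  have "AE x in lebesgue_on D. G x $ i $ j - H x $ i $ j = 0" for i j
  proof (rule fundamental_lemma_calculus_of_variations[OF D(1)])
    have c: "(\<lambda>x. G x $ i $ j) \<in> L2 D" "(\<lambda>x. H x $ i $ j) \<in> L2 D"
      using GH by (auto simp: L2_vec_iff)
    show "integrable (lebesgue_on D) (\<lambda>x. G x $ i $ j - H x $ i $ j)"
      using L2_integrable[OF D c(1)] L2_integrable[OF D c(2)] by simp
    fix \<phi> assume \<phi>: "\<phi> \<in> test_functions D"
    show "(LINT x|lebesgue_on D. (G x $ i $ j - H x $ i $ j) * \<phi> x) = 0"
      using assms(5,6) \<phi> L2_test_integrable[OF D c(1) \<phi>] L2_test_integrable[OF D c(2) \<phi>]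
      by (simp add: left_diff_distrib weak_gradient_def)
  qed
  then have "AE x in lebesgue_on D. \<forall>i\<in>UNIV. \<forall>j\<in>UNIV. G x $ i $ j - H x $ i $ j = 0"
    by (intro AE_finite_allI) auto
  then show ?thesis by eventually_elim (simp add: vec_eq_iff)
qed

lemma grad_H1:
  assumes "u \<in> H1 D"
  shows grad_L2: "grad D u \<in> L2 D" and weak_gradient_grad: "weak_gradient D u (grad D u)"
proof -
  have "\<exists>G. G \<in> L2 D \<and> weak_gradient D u G" using assms by (auto simp: H1_def)
  from someI_ex[OF this] show "grad D u \<in> L2 D" "weak_gradient D u (grad D u)"
    by (simp_all add: grad_def)
qed

lemma H1_L2: "u \<in> H1 D \<Longrightarrow> u \<in> L2 D"
  by (simp add: H1_def)

lemma H1I: "u \<in> L2 D \<Longrightarrow> G \<in> L2 D \<Longrightarrow> weak_gradient D u G \<Longrightarrow> u \<in> H1 D"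
  by (auto simp: H1_def)

lemma grad_eq_AE:
  assumes D: "open D" "bounded D" and "u \<in> L2 D" "G \<in> L2 D" "weak_gradient D u G"
  shows "AE x in lebesgue_on D. grad D u x = G x"
  using weak_gradient_unique[OF D] assms grad_H1[of u D] by (simp add: H1I)

lemma H1_linear_combination:
  assumes D: "open D" "bounded D" and "u \<in> H1 D" "v \<in> H1 D"
  shows "(\<lambda>x. a *\<^sub>R u x + b *\<^sub>R v x) \<in> H1 D"
    and "AE x in lebesgue_on D. grad D (\<lambda>x. a *\<^sub>R u x + b *\<^sub>R v x) x = a *\<^sub>R grad D u x + b *\<^sub>R grad D v x"
proof -
  note * = L2_linear_combination[OF H1_L2[OF assms(3)] H1_L2[OF assms(4)]]
    L2_linear_combination[OF grad_L2[OF assms(3)] grad_L2[OF assms(4)]]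
    weak_gradient_linear_combination[OF D H1_L2[OF assms(3)] H1_L2[OF assms(4)]
      grad_L2[OF assms(3)] grad_L2[OF assms(4)] weak_gradient_grad[OF assms(3)] weak_gradient_grad[OF assms(4)]]
  show "(\<lambda>x. a *\<^sub>R u x + b *\<^sub>R v x) \<in> H1 D" using * by (rule H1I)
  show "AE x in lebesgue_on D. grad D (\<lambda>x. a *\<^sub>R u x + b *\<^sub>R v x) x = a *\<^sub>R grad D u x + b *\<^sub>R grad D v x"
    using * by (rule grad_eq_AE[OF D])
qed

lemma l2_inner_grad_linear:
  assumes D: "open D" "bounded D" and "u \<in> H1 D" "v \<in> H1 D" "G \<in> L2 D"
  shows "l2_inner D (grad D (\<lambda>x. a *\<^sub>R u x + b *\<^sub>R v x)) G = a * l2_inner D (grad D u) G + b * l2_inner D (grad D v) G"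
proof -
  have "l2_inner D (grad D (\<lambda>x. a *\<^sub>R u x + b *\<^sub>R v x)) G = l2_inner D (\<lambda>x. a *\<^sub>R grad D u x + b *\<^sub>R grad D v x) G"
    using assms H1_linear_combination[OF D, of u v a b]
    by (intro l2_inner_cong_AE grad_L2 L2_linear_combination) auto
  also have "\<dots> = a * l2_inner D (grad D u) G + b * l2_inner D (grad D v) G"
    using assms by (intro L2.linear grad_L2)
  finally show ?thesis .
qed

lemma semi_inner_space_H1:
  fixes D :: "(real^'n) set"
  assumes D: "open D" "bounded D"
  shows "semi_inner_space (H1 D) (h1_inner D :: (real^'n \<Rightarrow> real^'m) \<Rightarrow> _ \<Rightarrow> real)"
proof
  fix f g h :: "real^'n \<Rightarrow> real^'m" and a b :: real
  assume fgh: "f \<in> H1 D" "g \<in> H1 D" "h \<in> H1 D"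
  show "h1_inner D (\<lambda>x. a *\<^sub>R f x + b *\<^sub>R g x) h = a * h1_inner D f h + b * h1_inner D g h"
    using fgh unfolding h1_inner_def
    by (simp add: l2_inner_grad_linear[OF D] grad_L2 L2.linear H1_L2 distrib_left)
next
  show "0 \<le> h1_inner D f f" if "f \<in> H1 D" for f :: "real^'n \<Rightarrow> real^'m"
    unfolding h1_inner_def by (intro add_nonneg_nonneg L2.nonneg grad_L2[OF that] H1_L2[OF that])
qed (use H1_linear_combination[OF D] in \<open>auto simp: h1_inner_def L2.commute\<close>)

lemma h1_norm_square: "(h1_norm D u)\<^sup>2 = (l2_norm D (grad D u))\<^sup>2 + (l2_norm D u)\<^sup>2"
  unfolding h1_norm_def h1_inner_def l2_norm_def l2_inner_def
  by (simp add: Bochner_Integration.integral_nonneg)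

lemma h1_norm_nonneg [simp]: "0 \<le> h1_norm D u"
  unfolding h1_norm_def h1_inner_def l2_inner_def
  by (simp add: Bochner_Integration.integral_nonneg)

lemma l2_norm_le_h1_norm: "l2_norm D u \<le> h1_norm D u"
  by (rule power2_le_imp_le) (simp_all add: h1_norm_square)

lemma l2_norm_grad_le_h1_norm: "l2_norm D (grad D u) \<le> h1_norm D u"
  by (rule power2_le_imp_le) (simp_all add: h1_norm_square)

lemma h1_norm_le: "h1_norm D u \<le> l2_norm D (grad D u) + l2_norm D u"
  by (rule power2_le_imp_le) (simp_all add: h1_norm_square power2_sum)

section \<open>Integration by parts\<close>

lemma
  fixes f :: "'a::euclidean_space \<Rightarrow> real"
  assumes "f \<in> borel_measurable borel"
  shows lborel_integrable_translation: "integrable lborel (\<lambda>x. f (a + x)) \<longleftrightarrow> integrable lborel f"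
    and lborel_integral_translation: "(LINT x|lborel. f (a + x)) = (LINT x|lborel. f x)"
proof -
  have f: "f \<in> borel_measurable (borel :: 'a measure)" using assms .
  have "(+) a \<in> lborel \<rightarrow>\<^sub>M borel" by simp
  from integrable_distr_eq[OF this f] integral_distr[OF this f]
  show "integrable lborel (\<lambda>x. f (a + x)) \<longleftrightarrow> integrable lborel f"
    "(LINT x|lborel. f (a + x)) = (LINT x|lborel. f x)"
    by (simp_all add: lborel_distr_plus)
qed

lemma bounded_times_integrable:
  fixes f g :: "'a \<Rightarrow> real"
  assumes g: "g \<in> borel_measurable M" "\<And>x. \<bar>g x\<bar> \<le> C" and f: "integrable M f"
  shows "integrable M (\<lambda>x. g x * f x)"
proof (rule Bochner_Integration.integrable_bound)
  show "integrable M (\<lambda>x. C * f x)" using f by simp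
  show "(\<lambda>x. g x * f x) \<in> borel_measurable M" using g(1) f by auto
  have "norm (g x * f x) \<le> norm (C * f x)" for x
    using mult_right_mono[OF order_trans[OF g(2)[of x] abs_ge_self], of "\<bar>f x\<bar>"] by (simp add: abs_mult)
  then show "AE x in M. norm (g x * f x) \<le> norm (C * f x)" by simp
qed

lemma test_function_translation:
  assumes "\<phi> \<in> test_functions U"
  shows "(\<lambda>x. \<phi> (x - a)) \<in> test_functions ((+) a ` U)"
proof -
  obtain K where K: "smooth \<phi>" "compact K" "K \<subseteq> U" "\<And>x. x \<notin> K \<Longrightarrow> \<phi> x = 0"
    using assms by (blast elim!: test_functionsE)
  have "\<phi> (x - a) = 0" if "x \<notin> (+) a ` K" for x
  proof (rule K(4))
    show "x - a \<notin> K" using that by (metis add_diff_cancel_left' diff_add_cancel add.commute image_eqI)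
  qed
  moreover have "compact ((+) a ` K)" using compact_translation[OF K(2)] .
  moreover have "(+) a ` K \<subseteq> (+) a ` U" using K(3) by (rule image_mono)
  ultimately show ?thesis
    unfolding test_functions_def using smooth_translation[OF K(1)] by blast
qed

text \<open>Dominated convergence: the Lipschitz constant of \<phi> bounds the quotients, and all
  shifted supports lie in one ball, enlarged by a bound \<open>H\<close> for the steps. The weight
  \<open>g\<close> may be any bounded Borel function.\<close>

lemma difference_quotient_limit:
  fixes \<phi> :: "real^'n \<Rightarrow> real"
  assumes \<phi>: "\<phi> \<in> test_functions U" and g: "g \<in> borel_measurable borel" "\<And>x. \<bar>g x\<bar> \<le> M"
    and h: "h \<longlonglongrightarrow> 0" "\<And>n. h n \<noteq> 0"
  shows "(\<lambda>n. LINT x|lborel. g x * ((\<phi> (x + h n *\<^sub>R axis j 1) - \<phi> x) / h n)) \<longlonglongrightarrow> (LINT x|lborel. g x * partial_deriv j \<phi> x)"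
proof -
  obtain K where K: "smooth \<phi>" "compact K" "\<And>x. x \<notin> K \<Longrightarrow> \<phi> x = 0"
    using \<phi> by (blast elim!: test_functionsE)
  obtain R where R: "\<And>x. x \<in> K \<Longrightarrow> norm x \<le> R"
    using compact_imp_bounded[OF K(2)] unfolding bounded_iff by blast
  obtain L where L: "L > 0" "\<And>x y. \<bar>\<phi> x - \<phi> y\<bar> \<le> L * norm (x - y)"
    using test_function_lipschitz[OF \<phi>] by blast
  obtain H where H: "\<And>n. \<bar>h n\<bar> \<le> H"
    using convergent_imp_Bseq[OF convergentI[OF h(1)]] unfolding Bseq_def by auto
  note \<phi>m[measurable] = test_function_borel_measurable[OF \<phi>] and g(1)[measurable]
  have d\<phi>m[measurable]: "partial_deriv j \<phi> \<in> borel_measurable borel"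
    by (rule test_function_borel_measurable[OF test_functions_partial_deriv[OF \<phi>]])
  have M: "0 \<le> M" using g(2)[of 0] by linarith
  show ?thesis
  proof (rule integral_dominated_convergence[where w = "\<lambda>x. M * L * indicator (cball 0 (R + H)) x"])
    show "(\<lambda>x. g x * ((\<phi> (x + h n *\<^sub>R axis j 1) - \<phi> x) / h n)) \<in> borel_measurable lborel" for n
      by simp
    show "(\<lambda>x. g x * partial_deriv j \<phi> x) \<in> borel_measurable lborel" by simp
    show "integrable lborel (\<lambda>x::real^'n. M * L * indicator (cball 0 (R + H)) x)"
      using emeasure_bounded_finite[of "cball (0::real^'n) (R + H)"]
      by (intro integrable_mult_right integrable_real_indicator) (auto simp: less_top)
    have "(\<lambda>n. (\<phi> (x + h n *\<^sub>R axis j 1) - \<phi> x) / h n) \<longlonglongrightarrow> partial_deriv j \<phi> x" for x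
    proof -
      have "((\<lambda>t. x + t *\<^sub>R axis j 1) has_derivative (\<lambda>t. t *\<^sub>R axis j 1)) (at 0)"
        by (auto intro!: derivative_eq_intros)
      moreover have "(\<phi> has_derivative (\<lambda>k. \<Sum>i\<in>UNIV. partial_deriv i \<phi> x * k $ i)) (at (x + 0 *\<^sub>R axis j 1))"
        using smooth_has_derivative[OF K(1)] by simp
      ultimately have "((\<lambda>t. \<phi> (x + t *\<^sub>R axis j 1)) has_derivative
          (\<lambda>t. \<Sum>i\<in>UNIV. partial_deriv i \<phi> x * (t *\<^sub>R axis j 1) $ i)) (at 0)"
        by (rule has_derivative_compose)
      moreover have "(\<Sum>i\<in>UNIV. partial_deriv i \<phi> x * (t *\<^sub>R axis j 1) $ i) = partial_deriv j \<phi> x * t" for t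
        using sum_axis_1[of "\<lambda>i. partial_deriv i \<phi> x * t" j] by (simp add: mult.assoc)
      ultimately have "((\<lambda>t. \<phi> (x + t *\<^sub>R axis j 1)) has_real_derivative partial_deriv j \<phi> x) (at 0)"
        by (simp add: has_field_derivative_def)
      then have "((\<lambda>t. (\<phi> (x + t *\<^sub>R axis j 1) - \<phi> x) / t) \<longlongrightarrow> partial_deriv j \<phi> x) (at 0)"
        by (simp add: DERIV_def)
      moreover have "filterlim h (at 0) sequentially"
        using h by (simp add: filterlim_at)
      ultimately show ?thesis by (rule filterlim_compose)
    qed
    then show "AE x in lborel. (\<lambda>n. g x * ((\<phi> (x + h n *\<^sub>R axis j 1) - \<phi> x) / h n)) \<longlonglongrightarrow> g x * partial_deriv j \<phi> x"
      by (intro AE_I2 tendsto_mult tendsto_const)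
    have "norm (g x * ((\<phi> (x + h n *\<^sub>R axis j 1) - \<phi> x) / h n)) \<le> M * L * indicator (cball 0 (R + H)) x" for n x
    proof (cases "x \<in> cball 0 (R + H)")
      case True
      have "\<bar>\<phi> (x + h n *\<^sub>R axis j 1) - \<phi> x\<bar> \<le> L * \<bar>h n\<bar>"
        using L(2)[of "x + h n *\<^sub>R axis j 1" x] by (simp add: norm_axis_1)
      then have "\<bar>(\<phi> (x + h n *\<^sub>R axis j 1) - \<phi> x) / h n\<bar> \<le> L"
        using h(2)[of n] by (simp add: field_simps)
      then have "\<bar>g x\<bar> * \<bar>(\<phi> (x + h n *\<^sub>R axis j 1) - \<phi> x) / h n\<bar> \<le> M * L"
        using g(2)[of x] M by (intro mult_mono) auto
      with True show ?thesis by (simp add: abs_mult)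
    next
      case False
      have "x \<notin> K" using R[of x] False H[of n] by auto
      moreover have "x + h n *\<^sub>R axis j 1 \<notin> K"
      proof
        assume "x + h n *\<^sub>R axis j 1 \<in> K"
        then have "norm (x + h n *\<^sub>R axis j 1) \<le> R" by (rule R)
        moreover have "norm x \<le> norm (x + h n *\<^sub>R axis j 1) + \<bar>h n\<bar>"
          using norm_triangle_ineq4[of "x + h n *\<^sub>R axis j 1" "h n *\<^sub>R axis j 1"] by (simp add: norm_axis_1)
        ultimately show False using False H[of n] by simp
      qed
      ultimately show ?thesis using K(3) False by simp
    qed
    then show "AE x in lborel. norm (g x * ((\<phi> (x + h n *\<^sub>R axis j 1) - \<phi> x) / h n)) \<le> M * L * indicator (cball 0 (R + H)) x" for n
      by simp
  qed
qed

text \<open>Summation by parts, from translation invariance. It asks so little of \<open>g\<close>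
  that it also serves for weakly differentiable functions.\<close>

lemma integral_shift:
  fixes \<phi> :: "real^'n \<Rightarrow> real"
  assumes \<phi>: "integrable lborel \<phi>" and g: "g \<in> borel_measurable borel" "\<And>x. \<bar>g x\<bar> \<le> M"
  shows "(LINT x|lborel. g x * (\<phi> (x + a) - \<phi> x)) = (LINT x|lborel. (g (x - a) - g x) * \<phi> x)"
proof -
  have \<phi>m[measurable]: "\<phi> \<in> borel_measurable borel" using \<phi> by auto
  note g(1)[measurable]
  have i: "integrable lborel (\<lambda>x. \<phi> (a + x))" using \<phi> by (subst lborel_integrable_translation) auto
  have gm: "g \<in> borel_measurable lborel" using g(1) by simp
  have i1: "integrable lborel (\<lambda>x. g x * \<phi> (a + x))" by (rule bounded_times_integrable[OF gm g(2) i])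
  have i2: "integrable lborel (\<lambda>x. g x * \<phi> x)" by (rule bounded_times_integrable[OF gm g(2) \<phi>])
  have i3: "integrable lborel (\<lambda>x. g (x - a) * \<phi> x)"
    by (rule bounded_times_integrable[OF _ g(2) \<phi>]) simp
  have "(LINT x|lborel. g x * \<phi> (a + x)) = (LINT x|lborel. g (a + x - a) * \<phi> (a + x))"
    by simp
  also have "\<dots> = (LINT x|lborel. g (x - a) * \<phi> x)"
    by (rule lborel_integral_translation) simp
  finally show ?thesis
    using i1 i2 i3 by (simp add: right_diff_distrib left_diff_distrib add.commute)
qed

lemma reciprocal_sequence: "(\<lambda>n. 1 / (real n + 1)) \<longlonglongrightarrow> 0" "1 / (real n + 1) \<noteq> 0"
  using LIMSEQ_inverse_real_of_nat by (auto simp: inverse_eq_divide add.commute)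

text \<open>The discrete identity with step \<open>h\<close> on one side and \<open>- h\<close> on
  the other, followed by uniqueness of limits; neither Fubini nor one-dimensional integrals
  enter.\<close>

theorem integration_by_parts:
  fixes \<phi> \<psi> :: "real^'n \<Rightarrow> real"
  assumes \<phi>: "\<phi> \<in> test_functions U" and \<psi>: "\<psi> \<in> test_functions V"
  shows "(LINT x|lborel. \<phi> x * partial_deriv j \<psi> x) = - (LINT x|lborel. partial_deriv j \<phi> x * \<psi> x)"
proof -
  define h where "h n = 1 / (real n + 1)" for n
  have h: "h \<longlonglongrightarrow> 0" "h n \<noteq> 0" "(\<lambda>n. - h n) \<longlonglongrightarrow> 0" "- h n \<noteq> 0" for n
    using reciprocal_sequence tendsto_minus[OF reciprocal_sequence(1)] by (auto simp: h_def[abs_def])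
  obtain C where C: "\<And>x. \<bar>\<phi> x\<bar> \<le> C" using test_function_bounded[OF \<phi>] by blast
  obtain C' where C': "\<And>x. \<bar>\<psi> x\<bar> \<le> C'" using test_function_bounded[OF \<psi>] by blast
  note \<phi>m = test_function_borel_measurable[OF \<phi>] and \<psi>m = test_function_borel_measurable[OF \<psi>]
  have eq: "(LINT x|lborel. \<phi> x * ((\<psi> (x + h n *\<^sub>R axis j 1) - \<psi> x) / h n))
      = - (LINT x|lborel. \<psi> x * ((\<phi> (x + (- h n) *\<^sub>R axis j 1) - \<phi> x) / (- h n)))" for n
    using integral_shift[OF test_function_integrable[OF \<psi>] \<phi>m C, of "h n *\<^sub>R axis j 1"]
    by (simp add: mult.commute)
  have "(\<lambda>n. - (LINT x|lborel. \<psi> x * ((\<phi> (x + (- h n) *\<^sub>R axis j 1) - \<phi> x) / (- h n))))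
      \<longlonglongrightarrow> (LINT x|lborel. \<phi> x * partial_deriv j \<psi> x)"
    using difference_quotient_limit[OF \<psi> \<phi>m C h(1,2), of j] unfolding eq .
  moreover have "(\<lambda>n. - (LINT x|lborel. \<psi> x * ((\<phi> (x + (- h n) *\<^sub>R axis j 1) - \<phi> x) / (- h n))))
      \<longlonglongrightarrow> - (LINT x|lborel. \<psi> x * partial_deriv j \<phi> x)"
    by (intro tendsto_minus difference_quotient_limit[OF \<phi> \<psi>m C' h(3,4)])
  ultimately show ?thesis using LIMSEQ_unique by (fastforce simp: mult.commute)
qed

text \<open>Commuting \<open>\<partial>\<^sub>i\<close> with a difference quotient in direction \<open>j\<close> makes equality of the mixed
  second derivatives unnecessary.\<close>
lemma integral_partial_deriv_swap:
  fixes \<phi> \<psi> :: "real^'n \<Rightarrow> real"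
  assumes \<phi>: "\<phi> \<in> test_functions U" and \<psi>: "\<psi> \<in> test_functions V"
  shows "(LINT x|lborel. partial_deriv i \<phi> x * partial_deriv j \<psi> x)
    = (LINT x|lborel. partial_deriv j \<phi> x * partial_deriv i \<psi> x)"
proof -
  define h where "h n = 1 / (real n + 1)" for n
  have h: "h \<longlonglongrightarrow> 0" "h n \<noteq> 0" for n
    using reciprocal_sequence by (auto simp: h_def[abs_def])
  define Q where "Q f n x = (f (x + h n *\<^sub>R axis j 1) - f x) / h n" for f :: "real^'n \<Rightarrow> real" and n x
  have Q: "Q f n = (\<lambda>x. (1 / h n) * f (x - (- (h n *\<^sub>R axis j 1))) + (- 1 / h n) * f x)" for f n
    by (auto simp: Q_def diff_divide_distrib)
  have test: "Q \<psi> n \<in> test_functions UNIV" for n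
    unfolding Q
    by (intro test_functions_linear_combination)
      (use test_function_translation[OF \<psi>] \<psi> test_functions_mono[of _ UNIV] in blast)+
  have dQ: "partial_deriv i (Q \<psi> n) = Q (partial_deriv i \<psi>) n" for n
  proof
    fix x
    have d: "\<psi> differentiable (at y)" for y
      by (rule smooth_differentiable[OF test_function_smooth[OF \<psi>]])
    have "(\<lambda>x. \<psi> (x - (- (h n *\<^sub>R axis j 1)))) differentiable (at x)"
      by (rule smooth_differentiable[OF smooth_translation[OF test_function_smooth[OF \<psi>]]])
    then show "partial_deriv i (Q \<psi> n) x = Q (partial_deriv i \<psi>) n x"
      unfolding Q by (simp only: partial_deriv_linear_combination[OF _ d] partial_deriv_translation[OF d])
  qed
  obtain C where C: "\<And>x. \<bar>partial_deriv i \<phi> x\<bar> \<le> C"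
    using test_function_bounded[OF test_functions_partial_deriv[OF \<phi>]] by blast
  obtain C' where C': "\<And>x. \<bar>\<phi> x\<bar> \<le> C'" using test_function_bounded[OF \<phi>] by blast
  have "(LINT x|lborel. partial_deriv i \<phi> x * Q \<psi> n x) = - (LINT x|lborel. \<phi> x * Q (partial_deriv i \<psi>) n x)" for n
    using integration_by_parts[OF \<phi> test, of i n] by (simp add: dQ)
  moreover have "(\<lambda>n. LINT x|lborel. partial_deriv i \<phi> x * Q \<psi> n x)
      \<longlonglongrightarrow> (LINT x|lborel. partial_deriv i \<phi> x * partial_deriv j \<psi> x)"
    unfolding Q_def
    by (rule difference_quotient_limit[OF \<psi> _ C h])
      (rule test_function_borel_measurable[OF test_functions_partial_deriv[OF \<phi>]])
  moreover have "(\<lambda>n. - (LINT x|lborel. \<phi> x * Q (partial_deriv i \<psi>) n x))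
      \<longlonglongrightarrow> - (LINT x|lborel. \<phi> x * partial_deriv j (partial_deriv i \<psi>) x)"
    unfolding Q_def
    by (intro tendsto_minus difference_quotient_limit[OF test_functions_partial_deriv[OF \<psi>]
          test_function_borel_measurable[OF \<phi>] C' h])
  ultimately have "(LINT x|lborel. partial_deriv i \<phi> x * partial_deriv j \<psi> x)
      = - (LINT x|lborel. \<phi> x * partial_deriv j (partial_deriv i \<psi>) x)"
    using LIMSEQ_unique by fastforce
  then show ?thesis
    using integration_by_parts[OF \<phi> test_functions_partial_deriv[OF \<psi>], of j i] by simp
qed

section \<open>Smooth vector fields with compact support\<close>

lemma integral_lebesgue_on_borel:
  fixes f :: "'a::euclidean_space \<Rightarrow> real"
  assumes "U \<in> sets borel" "f \<in> borel_measurable borel" "\<And>x. x \<notin> U \<Longrightarrow> f x = 0"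
  shows "(LINT x|lebesgue_on U. f x) = (LINT x|lborel. f x)"
  using assms borel_measurable_lebesgue_on[OF assms(2)]
  by (intro integral_borel_representative) auto

definition jacobian :: "(real^'n \<Rightarrow> real^'m) \<Rightarrow> real^'n \<Rightarrow> real^'n^'m" where
  "jacobian \<phi> x = (\<chi> i j. partial_deriv j (\<lambda>y. \<phi> y $ i) x)"

text \<open>In \<open>weak_gradient_jacobian\<close> the support of the test function in
  \<open>D\<close> lets both integrals be extended to the whole space, where
  \<open>integration_by_parts\<close> applies. The a.e. equality links the chosen
  \<open>grad\<close> with the classical Jacobian.\<close>

lemma
  assumes D: "open D" "bounded D" and \<phi>: "\<And>i. (\<lambda>x. \<phi> x $ i) \<in> test_functions U"
  shows test_field_L2: "\<phi> \<in> L2 D" and jacobian_L2: "jacobian \<phi> \<in> L2 D"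
    and weak_gradient_jacobian: "weak_gradient D \<phi> (jacobian \<phi>)"
    and test_field_H1: "\<phi> \<in> H1 D"
    and grad_test_field: "AE x in lebesgue_on D. grad D \<phi> x = jacobian \<phi> x"
proof -
  show 1: "\<phi> \<in> L2 D" using test_function_L2[OF D \<phi>] by (simp add: L2_vec_iff)
  show 2: "jacobian \<phi> \<in> L2 D"
    using test_function_L2[OF D test_functions_partial_deriv[OF \<phi>]]
    by (simp add: L2_vec_iff jacobian_def)
  show 3: "weak_gradient D \<phi> (jacobian \<phi>)"
    unfolding weak_gradient_def
  proof (intro ballI allI)
    fix \<psi> i j assume \<psi>: "\<psi> \<in> test_functions D"
    note [measurable] = test_function_borel_measurable[OF \<psi>] test_function_borel_measurable[OF \<phi>, of i]
      test_function_borel_measurable[OF test_functions_partial_deriv[OF \<psi>], of j]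
      test_function_borel_measurable[OF test_functions_partial_deriv[OF \<phi>], of j i]
    have "(LINT x|lebesgue_on D. \<phi> x $ i * partial_deriv j \<psi> x) = (LINT x|lborel. \<phi> x $ i * partial_deriv j \<psi> x)"
      using D test_function_outside[OF test_functions_partial_deriv[OF \<psi>]]
      by (intro integral_lebesgue_on_borel) auto
    also have "\<dots> = - (LINT x|lborel. partial_deriv j (\<lambda>y. \<phi> y $ i) x * \<psi> x)"
      by (rule integration_by_parts[OF \<phi> \<psi>])
    also have "(LINT x|lborel. partial_deriv j (\<lambda>y. \<phi> y $ i) x * \<psi> x)
        = (LINT x|lebesgue_on D. partial_deriv j (\<lambda>y. \<phi> y $ i) x * \<psi> x)"
      using D test_function_outside[OF \<psi>]
      by (intro integral_lebesgue_on_borel[symmetric]) auto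
    finally show "(LINT x|lebesgue_on D. \<phi> x $ i * partial_deriv j \<psi> x)
        = - (LINT x|lebesgue_on D. jacobian \<phi> x $ i $ j * \<psi> x)"
      by (simp add: jacobian_def)
  qed
  show "\<phi> \<in> H1 D" using 1 2 3 by (rule H1I)
  show "AE x in lebesgue_on D. grad D \<phi> x = jacobian \<phi> x" using grad_eq_AE[OF D 1 2 3] .
qed

lemma h1_nm:
  fixes D :: "(real^'n) set"
  assumes D: "open D" "bounded D"
  shows "semi_inner_space.nm (h1_inner D :: (real^'n \<Rightarrow> real^'m) \<Rightarrow> _ \<Rightarrow> real) = h1_norm D"
  by (simp add: fun_eq_iff semi_inner_space.nm_def[OF semi_inner_space_H1[OF D]] h1_norm_def)

lemma
  assumes D: "open D" "bounded D" and uv: "u \<in> H1 D" "v \<in> H1 D"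
  shows H1_diff: "u - v \<in> H1 D"
    and grad_diff: "AE x in lebesgue_on D. grad D (u - v) x = (grad D u - grad D v) x"
proof -
  interpret semi_inner_space "H1 D" "h1_inner D" by (rule semi_inner_space_H1[OF D])
  show "u - v \<in> H1 D" using uv by (rule closed_diff)
  show "AE x in lebesgue_on D. grad D (u - v) x = (grad D u - grad D v) x"
    using H1_linear_combination(2)[OF D uv, of 1 "- 1"] unfolding diff_eq by eventually_elim simp
qed

lemma l2_norm_cong_AE:
  "f \<in> L2 D \<Longrightarrow> g \<in> L2 D \<Longrightarrow> AE x in lebesgue_on D. f x = g x \<Longrightarrow> l2_norm D f = l2_norm D g"
  unfolding l2_norm_def using l2_inner_cong_AE[of f D f g g] by presburger

lemma l2_norm_grad_diff:
  assumes D: "open D" "bounded D" and uv: "u \<in> H1 D" "v \<in> H1 D"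
  shows "l2_norm D (grad D u - grad D v) = l2_norm D (grad D (u - v))"
  by (rule l2_norm_cong_AE[OF grad_L2[OF H1_diff[OF assms]]
        L2.closed_diff[OF grad_L2[OF uv(1)] grad_L2[OF uv(2)]] grad_diff[OF assms], symmetric])

section \<open>Korn's inequality\<close>

definition sym_part :: "real^'n^'n \<Rightarrow> real^'n^'n" where
  "sym_part A = (1/2) *\<^sub>R (A + transpose A)"

lemma sym_grad_eq: "sym_grad D u = (\<lambda>x. sym_part (grad D u x))"
  by (auto simp: sym_grad_def sym_part_def)

lemma matrix_norm_square: "(norm (A :: real^'n^'m))\<^sup>2 = (\<Sum>i\<in>UNIV. \<Sum>j\<in>UNIV. (A $ i $ j)\<^sup>2)"
  by (simp add: norm_vec_def L2_set_def sum_nonneg)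

text \<open>The mixed sum is the trace of A A, the term that becomes the square of the divergence
  after integration by parts.\<close>

lemma sym_part_norm_square:
  "2 * (norm (sym_part A))\<^sup>2 = (norm A)\<^sup>2 + (\<Sum>i\<in>UNIV. \<Sum>j\<in>UNIV. A $ i $ j * A $ j $ i)"
proof -
  have entry: "2 * (sym_part A $ i $ j)\<^sup>2 = (1/2) * (A $ i $ j)\<^sup>2 + (1/2) * (A $ j $ i)\<^sup>2 + A $ i $ j * A $ j $ i" for i j
    by (simp add: sym_part_def transpose_def power2_eq_square field_simps)
  have "2 * (norm (sym_part A))\<^sup>2
      = (\<Sum>i\<in>UNIV. \<Sum>j\<in>UNIV. (1/2) * (A $ i $ j)\<^sup>2 + (1/2) * (A $ j $ i)\<^sup>2 + A $ i $ j * A $ j $ i)"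
    unfolding matrix_norm_square sum_distrib_left entry ..
  also have "\<dots> = (1/2) * (norm A)\<^sup>2 + (1/2) * (\<Sum>i\<in>UNIV. \<Sum>j\<in>UNIV. (A $ j $ i)\<^sup>2)
      + (\<Sum>i\<in>UNIV. \<Sum>j\<in>UNIV. A $ i $ j * A $ j $ i)"
    unfolding matrix_norm_square sum.distrib sum_distrib_left ..
  also have "(\<Sum>i\<in>UNIV. \<Sum>j\<in>UNIV. (A $ j $ i)\<^sup>2) = (norm A)\<^sup>2"
    unfolding matrix_norm_square by (rule sum.swap)
  finally show ?thesis by simp
qed

lemma norm_transpose: "norm (transpose A) = norm (A :: real^'n^'m)"
proof -
  have "(norm (transpose A))\<^sup>2 = (norm A)\<^sup>2"
    unfolding matrix_norm_square transpose_def vec_lambda_beta by (rule sum.swap)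
  then show ?thesis by simp
qed

lemma sym_part_norm_le: "norm (sym_part A) \<le> norm A"
  using norm_triangle_ineq[of A "transpose A"] by (simp add: sym_part_def norm_transpose)

lemma bounded_linear_sym_part: "bounded_linear sym_part"
  by (rule bounded_linear_intro[where K = 1])
    (simp_all add: sym_part_norm_le, simp_all add: sym_part_def transpose_def vec_eq_iff algebra_simps)

lemma sym_part_diff: "sym_part (A - B) = sym_part A - sym_part B"
  using bounded_linear_sym_part by (rule linear_diff[OF bounded_linear.linear])

text \<open>After exchanging the two derivatives the mixed term integrates to the integral of the
  squared divergence, which is nonnegative. Dropping it from the pointwise identity leaves the
  factor 2, whose root is Korn's constant.\<close>

lemma korn_test_field:
  assumes D: "open D" "bounded D" and \<phi>: "\<And>i. (\<lambda>x. \<phi> x $ i) \<in> test_functions (D :: (real^'n) set)"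
  shows "l2_norm D (jacobian \<phi>) \<le> sqrt 2 * l2_norm D (\<lambda>x. sym_part (jacobian \<phi> x))"
proof -
  let ?J = "jacobian \<phi>"
  define d where "d j i = partial_deriv j (\<lambda>y. \<phi> y $ i)" for j i
  have dt: "d j i \<in> test_functions D" for i j
    unfolding d_def by (rule test_functions_partial_deriv[OF \<phi>])
  have J: "?J x $ i $ j = d j i x" for x i j by (simp add: jacobian_def d_def)
  have int: "integrable (lebesgue_on D) (\<lambda>x. d j i x * d l k x)" for i j k l
    using L2_inner_integrable[OF test_function_L2[OF D dt] test_function_L2[OF D dt]] by simp
  have swap: "(LINT x|lebesgue_on D. d j i x * d i j x) = (LINT x|lebesgue_on D. d i i x * d j j x)" for i j
  proof -
    note [measurable] = test_function_borel_measurable[OF dt]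
    have "(LINT x|lebesgue_on D. d j i x * d i j x) = (LINT x|lborel. d j i x * d i j x)"
      using D test_function_outside[OF dt] by (intro integral_lebesgue_on_borel) auto
    also have "\<dots> = (LINT x|lborel. d i i x * d j j x)"
      unfolding d_def by (rule integral_partial_deriv_swap[OF \<phi> \<phi>])
    also have "\<dots> = (LINT x|lebesgue_on D. d i i x * d j j x)"
      using D test_function_outside[OF dt] by (intro integral_lebesgue_on_borel[symmetric]) auto
    finally show ?thesis .
  qed
  have "(LINT x|lebesgue_on D. (\<Sum>i\<in>UNIV. \<Sum>j\<in>UNIV. ?J x $ i $ j * ?J x $ j $ i))
      = (\<Sum>i\<in>UNIV. \<Sum>j\<in>UNIV. LINT x|lebesgue_on D. d j i x * d i j x)"
    unfolding J using int
    by (simp add: Bochner_Integration.integral_sum Bochner_Integration.integrable_sum)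
  also have "\<dots> = (\<Sum>i\<in>UNIV. \<Sum>j\<in>UNIV. LINT x|lebesgue_on D. d i i x * d j j x)"
    unfolding swap ..
  also have "\<dots> = (LINT x|lebesgue_on D. (\<Sum>i\<in>UNIV. \<Sum>j\<in>UNIV. d i i x * d j j x))"
    using int by (simp add: Bochner_Integration.integral_sum Bochner_Integration.integrable_sum)
  also have "\<dots> = (LINT x|lebesgue_on D. (\<Sum>i\<in>UNIV. d i i x)\<^sup>2)"
    by (simp add: power2_eq_square sum_product)
  also have "\<dots> \<ge> 0" by (rule Bochner_Integration.integral_nonneg) simp
  finally have pos: "0 \<le> (LINT x|lebesgue_on D. (\<Sum>i\<in>UNIV. \<Sum>j\<in>UNIV. ?J x $ i $ j * ?J x $ j $ i))" .
  have JL: "?J \<in> L2 D" by (rule jacobian_L2[OF D \<phi>])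
  have intsum: "integrable (lebesgue_on D) (\<lambda>x. \<Sum>i\<in>UNIV. \<Sum>j\<in>UNIV. ?J x $ i $ j * ?J x $ j $ i)"
    unfolding J using int by (intro Bochner_Integration.integrable_sum)
  have "2 * (l2_norm D (\<lambda>x. sym_part (?J x)))\<^sup>2 = (LINT x|lebesgue_on D. 2 * (norm (sym_part (?J x)))\<^sup>2)"
    by (simp add: l2_norm_square)
  also have "\<dots> = (l2_norm D ?J)\<^sup>2 + (LINT x|lebesgue_on D. (\<Sum>i\<in>UNIV. \<Sum>j\<in>UNIV. ?J x $ i $ j * ?J x $ j $ i))"
    unfolding sym_part_norm_square l2_norm_square
    by (rule Bochner_Integration.integral_add[OF L2_square_integrable[OF JL] intsum])
  finally have "(l2_norm D ?J)\<^sup>2 \<le> (sqrt 2 * l2_norm D (\<lambda>x. sym_part (?J x)))\<^sup>2"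
    using pos by (simp add: power_mult_distrib)
  then show ?thesis by (rule power2_le_imp_le) simp
qed

theorem korn_H10:
  assumes D: "open D" "bounded D" and u: "u \<in> H10 D"
  shows "l2_norm D (grad D u) \<le> sqrt 2 * l2_norm D (sym_grad D u)"
proof (rule field_le_epsilon)
  fix \<epsilon> :: real assume "\<epsilon> > 0"
  \<comment> \<open>Passing to a test field costs \<delta> in the full gradient and
    \<open>sqrt 2 * \<delta>\<close> in the symmetric part.\<close>
  define \<delta> where "\<delta> = \<epsilon> / (1 + sqrt 2)"
  have s: "0 < 1 + sqrt 2" by (simp add: add_pos_nonneg)
  have \<delta>: "\<delta> > 0" "(1 + sqrt 2) * \<delta> = \<epsilon>" using \<open>\<epsilon> > 0\<close> s by (simp_all add: \<delta>_def)
  have uH: "u \<in> H1 D" using u by (simp add: H10_def)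
  obtain \<phi> where \<phi>: "\<And>i. (\<lambda>x. \<phi> x $ i) \<in> test_functions D" "h1_norm D (u - \<phi>) < \<delta>"
    using u \<delta>(1) unfolding H10_def by blast
  have \<phi>H: "\<phi> \<in> H1 D" by (rule test_field_H1[OF D \<phi>(1)])
  have L: "grad D u \<in> L2 D" "jacobian \<phi> \<in> L2 D"
    by (rule grad_L2[OF uH], rule jacobian_L2[OF D \<phi>(1)])
  \<comment> \<open>\<open>grad D \<phi>\<close> is a chosen weak gradient and agrees with the
    Jacobian only almost everywhere, so the norms are compared through an a.e. equality.\<close>
  have small: "l2_norm D (grad D u - jacobian \<phi>) \<le> \<delta>"
  proof -
    have "l2_norm D (grad D u - jacobian \<phi>) = l2_norm D (grad D u - grad D \<phi>)"
    proof (rule l2_norm_cong_AE[OF L2.closed_diff[OF L] L2.closed_diff[OF L(1) grad_L2[OF \<phi>H]]])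
      show "AE x in lebesgue_on D. (grad D u - jacobian \<phi>) x = (grad D u - grad D \<phi>) x"
        using grad_test_field[OF D \<phi>(1)] by eventually_elim simp
    qed
    also have "\<dots> = l2_norm D (grad D (u - \<phi>))" by (rule l2_norm_grad_diff[OF D uH \<phi>H])
    also have "\<dots> \<le> h1_norm D (u - \<phi>)" by (rule l2_norm_grad_le_h1_norm)
    finally show ?thesis using \<phi>(2) by simp
  qed
  have SL: "(\<lambda>x. sym_part (grad D u x)) \<in> L2 D" "(\<lambda>x. sym_part (jacobian \<phi> x)) \<in> L2 D"
    using L by (auto intro: bounded_linear_L2[OF bounded_linear_sym_part])
  have "l2_norm D (\<lambda>x. sym_part (jacobian \<phi> x))
      \<le> l2_norm D (sym_grad D u) + l2_norm D ((\<lambda>x. sym_part (jacobian \<phi> x)) - (\<lambda>x. sym_part (grad D u x)))"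
    unfolding sym_grad_eq by (rule L2.triangle_le[OF SL(2,1)])
  also have "l2_norm D ((\<lambda>x. sym_part (jacobian \<phi> x)) - (\<lambda>x. sym_part (grad D u x)))
      \<le> 1 * l2_norm D (grad D u - jacobian \<phi>)"
  proof (rule l2_norm_mono)
    show "AE x in lebesgue_on D. norm (((\<lambda>x. sym_part (jacobian \<phi> x)) - (\<lambda>x. sym_part (grad D u x))) x)
        \<le> 1 * norm ((grad D u - jacobian \<phi>) x)"
    proof (rule AE_I2)
      fix x
      show "norm (((\<lambda>x. sym_part (jacobian \<phi> x)) - (\<lambda>x. sym_part (grad D u x))) x)
        \<le> 1 * norm ((grad D u - jacobian \<phi>) x)"
        using sym_part_norm_le[of "jacobian \<phi> x - grad D u x"]
        by (simp add: sym_part_diff norm_minus_commute)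
    qed
  qed (use L SL in \<open>auto intro: L2.closed_diff\<close>)
  finally have 1: "l2_norm D (\<lambda>x. sym_part (jacobian \<phi> x)) \<le> l2_norm D (sym_grad D u) + \<delta>"
    using small by simp
  have "l2_norm D (grad D u) \<le> l2_norm D (jacobian \<phi>) + l2_norm D (grad D u - jacobian \<phi>)"
    by (rule L2.triangle_le[OF L])
  also have "\<dots> \<le> sqrt 2 * l2_norm D (\<lambda>x. sym_part (jacobian \<phi> x)) + \<delta>"
    using korn_test_field[OF D \<phi>(1)] small by simp
  also have "\<dots> \<le> sqrt 2 * (l2_norm D (sym_grad D u) + \<delta>) + \<delta>"
    using 1 by simp
  also have "\<dots> = sqrt 2 * l2_norm D (sym_grad D u) + \<epsilon>"
    using \<delta>(2) by (simp add: algebra_simps)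
  finally show "l2_norm D (grad D u) \<le> sqrt 2 * l2_norm D (sym_grad D u) + \<epsilon>" .
qed

section \<open>Change of variables under a Lipschitz inverse\<close>

text \<open>Non-overlapping dyadic cubes inside \<open>V\<close> cover \<open>A\<close>, each with a
  tag in \<open>A\<close>, since the Lipschitz bound is available only there. The part of
  \<open>A\<close> in a cube of side s is mapped into a cube of side 2 L DIM s around the image of
  the tag, which gives the volume ratio. The bound is put on a superset \<open>W\<close> because the
  image itself is not known to be measurable.\<close>

lemma lipschitz_image_outer_measure:
  fixes f :: "'a::euclidean_space \<Rightarrow> 'a"
  assumes A: "bounded A" "A \<subseteq> V" and V: "open V" "V \<in> lmeasurable" and L: "L > 0"
    and lip: "\<And>y z. y \<in> A \<Longrightarrow> z \<in> A \<Longrightarrow> norm (f y - f z) \<le> L * norm (y - z)"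
  shows "\<exists>W\<in>lmeasurable. f ` A \<subseteq> W \<and> measure lebesgue W \<le> (2 * L * DIM('a)) ^ DIM('a) * measure lebesgue V"
proof -
  \<comment> \<open>A gauge needs a radius at every point; off \<open>A\<close> any positive value
    will do.\<close>
  have "\<exists>r>0. x \<in> A \<longrightarrow> ball x r \<subseteq> V" for x
    using A(2) V(1) by (cases "x \<in> A") (auto simp: open_contains_ball intro: exI[of _ 1])
  then obtain R where R: "\<And>x. R x > 0" "\<And>x. x \<in> A \<Longrightarrow> ball x (R x) \<subseteq> V" by metis
  then have gauge: "gauge (\<lambda>x. ball x (R x))" by (simp add: gauge_def)
  \<comment> \<open>The enclosing box is a cube, so every dyadic cell has one common side
    length.\<close>
  obtain c where c: "A \<subseteq> cbox (- c *\<^sub>R One) (c *\<^sub>R One)" "box (- c *\<^sub>R One :: 'a) (c *\<^sub>R One) \<noteq> {}"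
  proof -
    obtain b where b: "\<And>x. x \<in> A \<Longrightarrow> norm x \<le> b" using A(1) bounded_iff by blast
    show ?thesis
    proof (rule that[of "\<bar>b\<bar> + 1"])
      show "A \<subseteq> cbox (- (\<bar>b\<bar> + 1) *\<^sub>R One) ((\<bar>b\<bar> + 1) *\<^sub>R One)"
        using norm_bound_Basis_le Basis_le_norm
        by (fastforce simp: mem_box dest!: b intro: order_trans)
      show "box (- (\<bar>b\<bar> + 1) *\<^sub>R One :: 'a) ((\<bar>b\<bar> + 1) *\<^sub>R One) \<noteq> {}"
        by (simp add: box_eq_empty(1))
    qed
  qed
  obtain \<D> where D: "countable \<D>" "\<And>K. K \<in> \<D> \<Longrightarrow> interior K \<noteq> {} \<and> (\<exists>c d. K = cbox c d)"
    and pw: "pairwise (\<lambda>A B. interior A \<inter> interior B = {}) \<D>"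
    and Ksub: "\<And>K. K \<in> \<D> \<Longrightarrow> \<exists>x \<in> A \<inter> K. K \<subseteq> ball x (R x)"
    and exN: "\<And>u v. cbox u v \<in> \<D> \<Longrightarrow> \<exists>n. \<forall>i \<in> Basis. v \<bullet> i - u \<bullet> i = (c *\<^sub>R One \<bullet> i - (- c *\<^sub>R One) \<bullet> i) / 2^n"
    and cover: "A \<subseteq> \<Union>\<D>"
    using covering_lemma[OF c gauge] by metis
  define P where "P K u v z s \<longleftrightarrow>
      K = cbox u v \<and> s > 0 \<and> z \<in> A \<and> z \<in> K \<and> K \<subseteq> V \<and> (\<forall>i\<in>Basis. v \<bullet> i - u \<bullet> i = s)"
    for K :: "'a set" and u v z s
  have "\<exists>u v z s. P K u v z s" if KD: "K \<in> \<D>" for K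
  proof -
    obtain u v where uv: "K = cbox u v" "box u v \<noteq> {}" using D(2)[OF KD] by (metis interior_cbox)
    obtain n where "\<forall>i \<in> Basis. v \<bullet> i - u \<bullet> i = (c *\<^sub>R One \<bullet> i - (- c *\<^sub>R One) \<bullet> i) / 2^n"
      using exN KD uv(1) by blast
    then have n: "v \<bullet> i - u \<bullet> i = (2 * c) / 2^n" if "i \<in> Basis" for i
      using that by simp
    obtain b :: 'a where b: "b \<in> Basis" using nonempty_Basis by blast
    have "u \<bullet> b < v \<bullet> b" using uv(2) b by (simp add: box_ne_empty)
    then have "0 < (2 * c) / 2^n" using n[OF b] by simp
    moreover obtain z where "z \<in> A" "z \<in> K" "K \<subseteq> ball z (R z)" using Ksub[OF KD] by blast
    ultimately have "P K u v z (2 * c / 2 ^ n)" using uv n R(2)[of z] unfolding P_def by blast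
    then show ?thesis by blast
  qed
  then have "\<forall>K\<in>\<D>. \<exists>u v z s. P K u v z s" by blast
  from bchoice[OF this] obtain u where "\<forall>K\<in>\<D>. \<exists>v z s. P K (u K) v z s" by blast
  from bchoice[OF this] obtain v where "\<forall>K\<in>\<D>. \<exists>z s. P K (u K) (v K) z s" by blast
  from bchoice[OF this] obtain z where "\<forall>K\<in>\<D>. \<exists>s. P K (u K) (v K) (z K) s" by blast
  from bchoice[OF this] obtain s where P: "\<forall>K\<in>\<D>. P K (u K) (v K) (z K) (s K)" by blast
  have K: "\<And>K. K \<in> \<D> \<Longrightarrow> K = cbox (u K) (v K)" "\<And>K. K \<in> \<D> \<Longrightarrow> s K > 0"
    "\<And>K. K \<in> \<D> \<Longrightarrow> z K \<in> A" "\<And>K. K \<in> \<D> \<Longrightarrow> z K \<in> K" "\<And>K. K \<in> \<D> \<Longrightarrow> K \<subseteq> V"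
    "\<And>K i. K \<in> \<D> \<Longrightarrow> i \<in> Basis \<Longrightarrow> v K \<bullet> i - u K \<bullet> i = s K"
    using P unfolding P_def by simp_all
  \<comment> \<open>A cube of side \<open>s K\<close> has l1-diameter at most
    \<open>DIM('a) * s K\<close>, so \<rho> bounds the distance of image points from the image of
    the tag.\<close>
  define \<rho> where "\<rho> K = L * DIM('a) * s K" for K
  define Q where "Q K = cbox (f (z K) - \<rho> K *\<^sub>R One) (f (z K) + \<rho> K *\<^sub>R One)" for K
  have \<rho>: "\<rho> K \<ge> 0" if "K \<in> \<D>" for K using K(2)[OF that] L by (simp add: \<rho>_def)
  have cQ: "measure lebesgue (Q K) = (2 * L * DIM('a)) ^ DIM('a) * measure lebesgue K" if "K \<in> \<D>" for K
  proof -
    have "measure lebesgue (Q K) = (2 * \<rho> K) ^ DIM('a)"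
      using \<rho>[OF that] by (simp add: Q_def content_cbox_cases inner_diff_left inner_add_left)
    moreover have "measure lebesgue K = s K ^ DIM('a)"
    proof -
      have "measure lebesgue (cbox (u K) (v K)) = (\<Prod>i\<in>Basis. v K \<bullet> i - u K \<bullet> i)"
        using K(6)[OF that] K(2)[OF that] by (simp add: content_cbox_cases) (metis diff_ge_0_iff_ge less_imp_le)
      then show ?thesis using K(6)[OF that] K(1)[OF that] by simp
    qed
    ultimately show ?thesis by (simp add: \<rho>_def power_mult_distrib mult.assoc mult.left_commute)
  qed
  have Qm: "Q K \<in> lmeasurable" for K by (simp add: Q_def)
  \<comment> \<open>A bound uniform over finite subfamilies suffices:
    \<open>fmeasurable_UN_bound\<close> and \<open>measure_UN_bound\<close> carry it to the
    countable union.\<close>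
  have fin: "measure lebesgue (\<Union>K\<in>I. Q K) \<le> (2 * L * DIM('a)) ^ DIM('a) * measure lebesgue V"
    if I: "I \<subseteq> \<D>" "finite I" for I
  proof -
    have "measure lebesgue (\<Union>K\<in>I. Q K) \<le> (\<Sum>K\<in>I. measure lebesgue (Q K))"
      using I Qm by (intro measure_UNION_le) auto
    also have "\<dots> = (2 * L * DIM('a)) ^ DIM('a) * (\<Sum>K\<in>I. measure lebesgue K)"
      using I cQ by (simp add: sum_distrib_left subset_iff)
    also have "(\<Sum>K\<in>I. measure lebesgue K) \<le> measure lebesgue V"
    proof -
      have "{} \<notin> I" using D(2) I(1) interior_empty by blast
      then have div: "I division_of \<Union>I"
        using pairwise_subset[OF pw I(1)] I D(2) unfolding pairwise_def division_of_def by fast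
      have "(\<Sum>K\<in>I. measure lebesgue K) = measure lebesgue (\<Union>I)"
        using content_division[OF div] by simp
      also have "\<dots> \<le> measure lebesgue V"
        using div K(5) I by (intro measure_mono_fmeasurable V) (auto dest: lmeasurable_division)
      finally show ?thesis .
    qed
    finally show ?thesis using L by (simp add: mult_left_mono)
  qed
  have "f ` A \<subseteq> (\<Union>K\<in>\<D>. Q K)"
  proof
    fix w assume "w \<in> f ` A"
    then obtain y where y: "y \<in> A" "w = f y" by blast
    then obtain K where KD: "K \<in> \<D>" "y \<in> K" using cover by blast
    have yin: "y \<in> cbox (u K) (v K)" and zin: "z K \<in> cbox (u K) (v K)"
      using K(1,4)[OF KD(1)] KD(2) by auto
    have "norm (y - z K) \<le> (\<Sum>i\<in>Basis. \<bar>(y - z K) \<bullet> i\<bar>)" by (rule norm_le_l1)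
    also have "\<dots> \<le> real DIM('a) * s K"
    proof (rule sum_bounded_above)
      fix i :: 'a assume i: "i \<in> Basis"
      show "\<bar>(y - z K) \<bullet> i\<bar> \<le> s K"
        using yin zin i K(6)[OF KD(1) i] unfolding mem_box inner_diff_left by (smt (verit))
    qed
    finally have "norm (f y - f (z K)) \<le> L * (real DIM('a) * s K)"
      using lip[OF y(1) K(3)[OF KD(1)]] L by (meson mult_left_mono less_imp_le order_trans)
    then have "\<bar>(f y - f (z K)) \<bullet> i\<bar> \<le> \<rho> K" if "i \<in> Basis" for i
      using Basis_le_norm[OF that, of "f y - f (z K)"] by (simp add: \<rho>_def mult.assoc)
    then have "f y \<in> Q K"
      unfolding Q_def mem_box inner_diff_left inner_add_left inner_scaleR_left
      by (simp, smt (verit))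
    then show "w \<in> (\<Union>K\<in>\<D>. Q K)" using y KD by blast
  qed
  moreover have "(\<Union>K\<in>\<D>. Q K) \<in> lmeasurable"
    by (rule fmeasurable_UN_bound[OF D(1) Qm fin])
  moreover have "measure lebesgue (\<Union>K\<in>\<D>. Q K) \<le> (2 * L * DIM('a)) ^ DIM('a) * measure lebesgue V"
    by (rule measure_UN_bound[OF D(1) Qm fin])
  ultimately show ?thesis by blast
qed

lemma preimage_emeasure_le:
  fixes X :: "'a::euclidean_space \<Rightarrow> 'a"
  assumes X: "X \<in> borel_measurable (lebesgue_on B)" "inj_on X B" "bounded (X ` B)" and B: "B \<in> sets lebesgue"
    and lip: "L-lipschitz_on (X ` B) (inv_into B X)"
  obtains C where "C \<ge> 0" "\<And>E. E \<in> sets borel \<Longrightarrow> emeasure lebesgue {x \<in> B. X x \<in> E} \<le> ennreal C * emeasure lborel E"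
proof
  \<comment> \<open>\<open>L + 1\<close> because the covering estimate asks for a strictly positive
    Lipschitz constant.\<close>
  define C where "C = (2 * (L + 1) * DIM('a)) ^ DIM('a)"
  have L: "L \<ge> 0" using lip by (rule lipschitz_on_nonneg)
  show C: "C \<ge> 0" using L by (simp add: C_def)
  fix E :: "'a set" assume E: "E \<in> sets borel"
  obtain R where R: "X ` B \<subseteq> ball 0 R" using bounded_subset_ballD[OF X(3)] by blast
  define A where "A = E \<inter> X ` B"
  \<comment> \<open>\<open>E\<close> may have infinite measure; cutting with a ball that contains
    the range of \<open>X\<close> makes it finite and loses no point of \<open>A\<close>.\<close>
  define E' where "E' = E \<inter> ball 0 R"
  have E': "E' \<in> sets borel" "emeasure lborel E' \<le> emeasure lborel E" "A \<subseteq> E'"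
    using E R by (auto simp: E'_def A_def intro!: emeasure_mono)
  have finE': "emeasure lborel E' < \<infinity>"
    using emeasure_mono[of E' "ball 0 R" lborel] emeasure_bounded_finite[of "ball 0 R :: 'a set"]
    by (auto simp: E'_def less_top top_unique)
  have E'l: "E' \<in> lmeasurable" using E'(1) finE' by (intro fmeasurableI) auto
  have A: "bounded A" using X(3) by (rule bounded_subset) (simp add: A_def)
  have img: "inv_into B X ` A = {x \<in> B. X x \<in> E}"
  proof (intro equalityI subsetI)
    fix x assume "x \<in> inv_into B X ` A"
    then obtain b where "b \<in> B" "X b \<in> E" "x = inv_into B X (X b)" by (auto simp: A_def)
    then show "x \<in> {x \<in> B. X x \<in> E}" using inv_into_f_f[OF X(2)] by simp
  next
    fix x assume "x \<in> {x \<in> B. X x \<in> E}"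
    then show "x \<in> inv_into B X ` A"
      using inv_into_f_f[OF X(2), of x] by (intro image_eqI[of _ _ "X x"]) (auto simp: A_def)
  qed
  have "{x \<in> B. X x \<in> E} = X -` E \<inter> space (lebesgue_on B)" by auto
  then have "{x \<in> B. X x \<in> E} \<in> sets (lebesgue_on B)" using measurable_sets[OF X(1) E] by simp
  then have meas: "{x \<in> B. X x \<in> E} \<in> sets lebesgue"
    using B by (simp add: sets_restrict_space_iff)
  have lipA: "norm (inv_into B X y - inv_into B X z) \<le> (L + 1) * norm (y - z)" if "y \<in> A" "z \<in> A" for y z
  proof -
    have "norm (inv_into B X y - inv_into B X z) \<le> L * norm (y - z)"
      using lipschitz_onD[OF lip, of y z] that by (simp add: A_def dist_norm)
    then show ?thesis using norm_ge_zero[of "y - z"] unfolding distrib_right by linarith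
  qed
  have bound: "emeasure lebesgue {x \<in> B. X x \<in> E} \<le> ennreal (C * (measure lebesgue E' + e))" if e: "e > 0" for e
  proof -
    obtain V where V: "open V" "E' \<subseteq> V" "emeasure lborel (V - E') < ennreal e"
      using outer_regular_lborel[OF E'(1) e] by blast
    have Vd: "V - E' \<in> lmeasurable"
      using V(1,3) E'(1) by (intro fmeasurableI) (auto simp: less_top[symmetric] intro: less_trans)
    have "V = E' \<union> (V - E')" using V(2) by auto
    then have Vl: "V \<in> lmeasurable" using fmeasurable.Un[OF E'l Vd] by simp
    have mV: "measure lebesgue V = measure lebesgue E' + measure lebesgue (V - E')"
      using measurable_measure_Diff[OF Vl _ V(2)] E'l by (simp add: fmeasurableD)
    have "emeasure lebesgue (V - E') < ennreal e" using V(1,3) E'(1) by simp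
    then have "measure lebesgue (V - E') \<le> e"
      using e Vd by (simp add: emeasure_eq_measure2 less_imp_le ennreal_less_iff)
    with mV have mV': "measure lebesgue V \<le> measure lebesgue E' + e" by simp
    obtain W where W: "W \<in> lmeasurable" "inv_into B X ` A \<subseteq> W" "measure lebesgue W \<le> C * measure lebesgue V"
      using lipschitz_image_outer_measure[OF A order_trans[OF E'(3) V(2)] V(1) Vl, of "L + 1" "inv_into B X"] lipA L
      unfolding C_def by auto
    have "emeasure lebesgue {x \<in> B. X x \<in> E} \<le> emeasure lebesgue W"
      using W(1,2) unfolding img by (intro emeasure_mono) auto
    also have "\<dots> = ennreal (measure lebesgue W)" using W(1) by (rule emeasure_eq_measure2)
    also have "\<dots> \<le> ennreal (C * (measure lebesgue E' + e))"
      using W(3) mult_left_mono[OF mV' C] by (intro ennreal_leI) linarith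
    finally show ?thesis .
  qed
  have "emeasure lebesgue {x \<in> B. X x \<in> E} \<le> ennreal (C * measure lebesgue E')"
  proof (rule ennreal_le_epsilon)
    fix e :: real assume e: "e > 0"
    have "C * (e / (C + 1)) \<le> e" using C e by (simp add: field_simps)
    then have "C * (measure lebesgue E' + e / (C + 1)) \<le> C * measure lebesgue E' + e"
      by (simp add: distrib_left)
    then have "ennreal (C * (measure lebesgue E' + e / (C + 1))) \<le> ennreal (C * measure lebesgue E') + ennreal e"
      using C e by (simp add: ennreal_plus[symmetric] del: ennreal_plus)
    then show "emeasure lebesgue {x \<in> B. X x \<in> E} \<le> ennreal (C * measure lebesgue E') + ennreal e"
      using bound[of "e / (C + 1)"] C e by (auto intro: order_trans)
  qed
  also have "\<dots> = ennreal C * emeasure lborel E'"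
    using C E'(1) emeasure_eq_measure2[OF E'l] by (simp add: ennreal_mult)
  also have "\<dots> \<le> ennreal C * emeasure lborel E" using E'(2) by (rule mult_left_mono) simp
  finally show "emeasure lebesgue {x \<in> B. X x \<in> E} \<le> ennreal C * emeasure lborel E" .
qed

text \<open>Completeness of Lebesgue measure. A composite of Lebesgue measurable functions need not
  be measurable, so for \<open>w (X x)\<close> measurability is transferred from a Borel
  representative of \<open>w\<close>.\<close>

lemma borel_measurable_lebesgue_on_AE:
  fixes f g :: "'a::euclidean_space \<Rightarrow> real"
  assumes D: "D \<in> sets borel" and f: "f \<in> borel_measurable (lebesgue_on D)" and ae: "AE x in lebesgue_on D. f x = g x"
  shows "g \<in> borel_measurable (lebesgue_on D)"
proof -
  have Dl: "D \<in> sets lebesgue" using D by auto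
  have fm: "(\<lambda>x. if x \<in> D then f x else 0) \<in> borel_measurable lebesgue"
    using Dl f by (intro borel_measurable_if_I) auto
  have ae': "AE x in lborel. (if x \<in> D then f x else 0) = (if x \<in> D then g x else 0)"
    using ae unfolding AE_lebesgue_on_iff[OF D] by eventually_elim simp
  obtain N where N: "N \<in> null_sets lborel"
    "{x. (if x \<in> D then f x else 0) \<noteq> (if x \<in> D then g x else 0)} \<subseteq> N"
    using ae' unfolding eventually_ae_filter by auto
  have N: "N \<in> null_sets lebesgue"
    "{x. (if x \<in> D then f x else 0) \<noteq> (if x \<in> D then g x else 0)} \<subseteq> N"
    using null_sets_completionI[OF N(1)] N(2) .
  have "(\<lambda>x. if x \<in> D then g x else 0) \<in> borel_measurable lebesgue"
  proof (rule borel_measurableI)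
    fix S :: "real set" assume S: "open S"
    let ?f = "\<lambda>x. if x \<in> D then f x else 0" and ?g = "\<lambda>x. if x \<in> D then g x else 0"
    have 1: "?f -` S \<inter> space lebesgue \<in> sets lebesgue"
      using measurable_sets[OF fm] S by simp
    have 2: "?g -` S \<inter> N \<in> sets lebesgue"
      by (rule null_setsD2, rule null_sets_completion_subset[OF _ N(1)]) simp
    have "?g -` S \<inter> space lebesgue = (?f -` S \<inter> space lebesgue - N) \<union> (?g -` S \<inter> N)"
    proof (rule set_eqI)
      fix x
      show "x \<in> ?g -` S \<inter> space lebesgue \<longleftrightarrow> x \<in> (?f -` S \<inter> space lebesgue - N) \<union> (?g -` S \<inter> N)"
      proof (cases "x \<in> N")
        case False
        then have "x \<notin> {x. ?f x \<noteq> ?g x}" by (rule contra_subsetD[OF N(2)])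
        then have "?g x = ?f x" by (simp only: mem_Collect_eq not_not)
        with False show ?thesis by simp
      qed simp
    qed
    moreover have "?f -` S \<inter> space lebesgue - N \<in> sets lebesgue"
      using 1 N(1) by (intro sets.Diff) auto
    ultimately show "?g -` S \<inter> space lebesgue \<in> sets lebesgue"
      using 2 by (simp only: sets.Un)
  qed
  then show ?thesis by (rule borel_measurable_if_D)
qed

text \<open>The constant \<open>C\<close> bounds the density of the push-forward of Lebesgue measure under \<open>X\<close>.\<close>
locale pushforward_bound =
  fixes B \<Omega> :: "(real^'n) set" and X :: "real^'n \<Rightarrow> real^'n" and C :: real
  assumes B: "open B" "bounded B" and \<Omega>: "open \<Omega>" "bounded \<Omega>"
    and X: "X \<in> borel_measurable (lebesgue_on B)" and XB: "X ` B \<subseteq> \<Omega>" and C: "C \<ge> 0"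
    and preimage: "\<And>E. E \<in> sets borel \<Longrightarrow> emeasure lebesgue {x \<in> B. X x \<in> E} \<le> ennreal C * emeasure lborel E"
begin

lemma Bb [simp]: "B \<in> sets borel" "\<Omega> \<in> sets borel" "B \<in> sets lebesgue"
  using B \<Omega> by auto

text \<open>The bound on preimages says that the image measure of \<open>X\<close> lies below a
  multiple of Lebesgue measure; integrals are monotone in the measure.\<close>

lemma nn_integral_pushforward:
  assumes h: "h \<in> borel_measurable borel"
  shows "(\<integral>\<^sup>+x. h (X x) \<partial>lebesgue_on B) \<le> ennreal C * (\<integral>\<^sup>+x. h x \<partial>lborel)"
proof -
  let ?N = "distr (lebesgue_on B) borel X"
  have "?N \<le> scale_measure (ennreal C) lborel"
  proof (subst le_measure)
    show "\<forall>E\<in>sets ?N. emeasure ?N E \<le> emeasure (scale_measure (ennreal C) lborel) E"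
    proof
      fix E assume "E \<in> sets ?N"
      then have E: "E \<in> sets borel" by simp
      have "emeasure ?N E = emeasure (lebesgue_on B) (X -` E \<inter> space (lebesgue_on B))"
        using X E by (rule emeasure_distr)
      also have "X -` E \<inter> space (lebesgue_on B) = {x \<in> B. X x \<in> E}" by auto
      also have "emeasure (lebesgue_on B) {x \<in> B. X x \<in> E} = emeasure lebesgue {x \<in> B. X x \<in> E}"
        by (rule emeasure_restrict_space) auto
      finally show "emeasure ?N E \<le> emeasure (scale_measure (ennreal C) lborel) E"
        using preimage[OF E] E by simp
    qed
  qed simp
  then have "nn_integral ?N h \<le> nn_integral (scale_measure (ennreal C) lborel) h"
    by (intro nn_integral_mono_measure) simp_all
  then show ?thesis
    using h by (simp add: nn_integral_distr[OF X] nn_integral_scale_measure)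
qed

text \<open>The preimage of a null set is null. Hence composition with \<open>X\<close> respects
  equality almost everywhere.\<close>

lemma AE_pushforward:
  assumes "AE x in lebesgue_on \<Omega>. P x"
  shows "AE x in lebesgue_on B. P (X x)"
proof -
  obtain N where N: "N \<in> null_sets lborel" "\<And>x. x \<in> \<Omega> \<Longrightarrow> \<not> P x \<Longrightarrow> x \<in> N"
    using assms unfolding AE_lebesgue_on_iff[OF Bb(2)] by (auto simp: eventually_ae_filter)
  have Nb: "N \<in> sets borel" "emeasure lborel N = 0" using N(1) by auto
  let ?A = "{x \<in> B. X x \<in> N}"
  have "?A = X -` N \<inter> space (lebesgue_on B)" by auto
  then have "?A \<in> sets (lebesgue_on B)" using measurable_sets[OF X Nb(1)] by simp
  then have "?A \<in> null_sets (lebesgue_on B)"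
    using preimage[OF Nb(1)] Nb(2) by (auto simp: null_sets_def emeasure_restrict_space)
  then show ?thesis
  proof (rule AE_I')
    show "{x \<in> space (lebesgue_on B). \<not> P (X x)} \<subseteq> ?A" using N(2) XB by auto
  qed
qed

lemma
  fixes w :: "real^'n \<Rightarrow> real"
  assumes w: "w \<in> L2 \<Omega>"
  shows L2_pushforward_real: "(\<lambda>x. w (X x)) \<in> L2 B"
    and l2_norm_pushforward_real: "(l2_norm B (\<lambda>x. w (X x)))\<^sup>2 \<le> C * (l2_norm \<Omega> w)\<^sup>2"
proof -
  obtain v where v: "v \<in> borel_measurable borel" "\<And>x. x \<notin> \<Omega> \<Longrightarrow> v x = 0" "AE x in lebesgue_on \<Omega>. w x = v x"
    using borel_representative[OF Bb(2) L2_measurable[OF w]] by blast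
  have vX: "(\<lambda>x. v (X x)) \<in> borel_measurable (lebesgue_on B)"
    using measurable_compose[OF X v(1)] .
  have ae: "AE x in lebesgue_on B. w (X x) = v (X x)" by (rule AE_pushforward[OF v(3)])
  then have wX: "(\<lambda>x. w (X x)) \<in> borel_measurable (lebesgue_on B)"
    by (intro borel_measurable_lebesgue_on_AE[OF Bb(1) vX]) (auto simp: eq_commute)
  have w2m: "(\<lambda>x. (w x)\<^sup>2) \<in> borel_measurable (lebesgue_on \<Omega>)"
    using L2_measurable[OF w] by (rule borel_measurable_power)
  have v2m: "(\<lambda>x. (v x)\<^sup>2) \<in> borel_measurable borel" using v(1) by (rule borel_measurable_power)
  have ae2: "AE x in lebesgue_on \<Omega>. (w x)\<^sup>2 = (v x)\<^sup>2" using v(3) by eventually_elim simp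
  have int: "integrable lborel (\<lambda>x. (v x)\<^sup>2)"
    using L2_square_integrable[OF w] integrable_borel_representative[OF Bb(2) w2m v2m _ ae2] v(2) by simp
  have eq: "(LINT x|lebesgue_on \<Omega>. (w x)\<^sup>2) = (LINT x|lborel. (v x)\<^sup>2)"
    using integral_borel_representative[OF Bb(2) w2m v2m _ ae2] v(2) by simp
  have "(\<integral>\<^sup>+x. ennreal ((w (X x))\<^sup>2) \<partial>lebesgue_on B) = (\<integral>\<^sup>+x. ennreal ((v (X x))\<^sup>2) \<partial>lebesgue_on B)"
    using ae by (intro nn_integral_cong_AE) (auto elim!: eventually_mono)
  also have "\<dots> \<le> ennreal C * (\<integral>\<^sup>+x. ennreal ((v x)\<^sup>2) \<partial>lborel)"
    using nn_integral_pushforward[of "\<lambda>x. ennreal ((v x)\<^sup>2)"] v2m by simp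
  also have "(\<integral>\<^sup>+x. ennreal ((v x)\<^sup>2) \<partial>lborel) = ennreal (LINT x|lborel. (v x)\<^sup>2)"
    by (rule nn_integral_eq_integral[OF int]) simp
  finally have le: "(\<integral>\<^sup>+x. ennreal ((w (X x))\<^sup>2) \<partial>lebesgue_on B) \<le> ennreal (C * (LINT x|lborel. (v x)\<^sup>2))"
    using C by (simp add: ennreal_mult Bochner_Integration.integral_nonneg)
  have i: "integrable (lebesgue_on B) (\<lambda>x. (w (X x))\<^sup>2)"
    using wX le by (intro integrableI_bounded) (auto intro: order_le_less_trans)
  show "(\<lambda>x. w (X x)) \<in> L2 B" unfolding L2_def using wX i by simp
  have "ennreal (LINT x|lebesgue_on B. (w (X x))\<^sup>2) \<le> ennreal (C * (LINT x|lborel. (v x)\<^sup>2))"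
    using le nn_integral_eq_integral[OF i] by simp
  then show "(l2_norm B (\<lambda>x. w (X x)))\<^sup>2 \<le> C * (l2_norm \<Omega> w)\<^sup>2"
    using C by (simp add: l2_norm_square eq ennreal_le_iff Bochner_Integration.integral_nonneg)
qed

end

section \<open>Difference quotients of bounded weakly differentiable functions\<close>

text \<open>Replacing values larger than \<open>M\<close> in modulus by 0 alters the representative
  only on a null set of \<open>U\<close> and makes the bound hold at every point, as
  \<open>bounded_weak_derivative\<close> demands.\<close>

lemma bounded_borel_representative:
  fixes f :: "'a::euclidean_space \<Rightarrow> real"
  assumes U: "U \<in> sets borel" and f: "f \<in> borel_measurable (lebesgue_on U)"
    and M: "AE x in lebesgue_on U. \<bar>f x\<bar> \<le> M" "0 \<le> M"
  obtains g where "g \<in> borel_measurable borel" "\<And>x. x \<notin> U \<Longrightarrow> g x = 0" "AE x in lebesgue_on U. f x = g x"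
    "\<And>x. \<bar>g x\<bar> \<le> M"
proof -
  obtain h where h[measurable]: "h \<in> borel_measurable borel" and h0: "\<And>x. x \<notin> U \<Longrightarrow> h x = 0"
    and ae: "AE x in lebesgue_on U. f x = h x"
    using borel_representative[OF U f] by blast
  show ?thesis
  proof (rule that)
    show "(\<lambda>x. if \<bar>h x\<bar> \<le> M then h x else 0) \<in> borel_measurable borel" by measurable
    show "AE x in lebesgue_on U. f x = (if \<bar>h x\<bar> \<le> M then h x else 0)"
      using ae M(1) by eventually_elim simp
  qed (use h0 M(2) in auto)
qed

text \<open>Lebesgue measure weighted by the indicator of the bounded set \<open>U\<close> is
  finite, which is what the general density theorem requires.\<close>

lemma test_functions_dense_lborel:
  fixes f :: "real^'n \<Rightarrow> real"
  assumes U: "open U" "bounded U" and f: "f \<in> borel_measurable borel" "\<And>x. \<bar>f x\<bar> \<le> K" "\<And>x. x \<notin> U \<Longrightarrow> f x = 0"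
    and "\<epsilon> > 0"
  shows "\<exists>\<eta>\<in>test_functions U. (LINT x|lborel. \<bar>f x - \<eta> x\<bar>) < \<epsilon>"
proof -
  have Ub[measurable]: "U \<in> sets borel" using U by simp
  note f(1)[measurable]
  define M where "M = density lborel (\<lambda>x. ennreal (indicator U x))"
  have Msets: "sets M = sets borel" by (simp add: M_def)
  have "emeasure M (space M) = emeasure lborel U"
    unfolding M_def by (subst emeasure_density) (auto simp: ennreal_indicator)
  then have Mfin: "finite_measure M"
    using emeasure_bounded_finite[OF U(2)] by (intro finite_measureI) simp
  have fM: "f \<in> borel_measurable M" by (simp add: M_def)
  have "integrable M f"
    using f(2) by (intro finite_measure.integrable_const_bound[OF Mfin, of _ K] fM) simp
  then have "test_approximable M U (\<lambda>x. indicator U x * f x)"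
    by (rule test_functions_dense_L1[OF Mfin Msets U(1)])
  moreover have "(\<lambda>x. indicator U x * f x) = f"
    using f(3) by (fastforce simp: indicator_def)
  ultimately have "test_approximable M U f" by (simp only:)
  then obtain \<eta> where \<eta>: "\<eta> \<in> test_functions U" "(LINT x|M. \<bar>f x - \<eta> x\<bar>) < \<epsilon>"
    using \<open>\<epsilon> > 0\<close> unfolding test_approximable_def by blast
  note test_function_borel_measurable[OF \<eta>(1), measurable]
  have "(LINT x|M. \<bar>f x - \<eta> x\<bar>) = (LINT x|lborel. indicator U x *\<^sub>R \<bar>f x - \<eta> x\<bar>)"
    unfolding M_def by (rule integral_density) simp_all
  also have "\<dots> = (LINT x|lborel. \<bar>f x - \<eta> x\<bar>)"
  proof (rule Bochner_Integration.integral_cong[OF refl])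
    fix x show "indicator U x *\<^sub>R \<bar>f x - \<eta> x\<bar> = \<bar>f x - \<eta> x\<bar>"
      using f(3)[of x] test_function_outside[OF \<eta>(1), of x] by (cases "x \<in> U") simp_all
  qed
  finally show ?thesis using \<eta> by auto
qed

lemma bounded_support_integrable:
  fixes f :: "'a::euclidean_space \<Rightarrow> real"
  assumes "open U" "bounded U" "f \<in> borel_measurable borel" "\<And>x. \<bar>f x\<bar> \<le> K" "\<And>x. x \<notin> U \<Longrightarrow> f x = 0"
  shows "integrable lborel f"
proof (rule Bochner_Integration.integrable_bound)
  show "integrable lborel (\<lambda>x. K * indicator U x)"
    using emeasure_bounded_finite[OF assms(2)] assms(1)
    by (intro integrable_mult_right integrable_real_indicator) auto
  have "norm (f x) \<le> norm (K * indicator U x)" for x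
    using assms(4)[of x] assms(5)[of x] by (cases "x \<in> U") auto
  then show "AE x in lborel. norm (f x) \<le> norm (K * indicator U x)" by simp
qed (use assms(3) in simp)

text \<open>Duality between \<open>L\<^sup>1\<close> and \<open>L\<^sup>\<infinity>\<close>, tested with smooth functions only.\<close>
lemma AE_bound_by_duality:
  fixes D :: "real^'n \<Rightarrow> real"
  assumes U: "open U" "bounded U" and D: "D \<in> borel_measurable borel" "\<And>x. \<bar>D x\<bar> \<le> K" and c: "0 \<le> c"
    and bound: "\<And>\<eta>. \<eta> \<in> test_functions U \<Longrightarrow> (LINT x|lborel. D x * \<eta> x) \<le> c * (LINT x|lborel. \<bar>\<eta> x\<bar>)"
  shows "AE x in lborel. x \<in> U \<longrightarrow> D x \<le> c"
proof -
  have Ub[measurable]: "U \<in> sets borel" using U by simp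
  note D(1)[measurable]
  \<comment> \<open>The indicator of the exceptional set. As (D - c) f is nonnegative, a nonpositive
    integral makes that set null.\<close>
  define f where "f x = (if x \<in> U \<and> D x > c then 1 else 0 :: real)" for x
  have fm[measurable]: "f \<in> borel_measurable borel" unfolding f_def[abs_def] by measurable
  have fb: "\<bar>f x\<bar> \<le> 1" "x \<notin> U \<Longrightarrow> f x = 0" "0 \<le> f x" for x by (auto simp: f_def)
  have fi: "integrable lborel f" by (rule bounded_support_integrable[OF U fm fb(1,2)])
  have Dm: "D \<in> borel_measurable lborel" by simp
  have K: "0 \<le> K" using D(2)[of 0] by linarith
  have Dfi: "integrable lborel (\<lambda>x. D x * f x)" by (rule bounded_times_integrable[OF Dm D(2) fi])
  have le: "(LINT x|lborel. (D x - c) * f x) \<le> 0 + \<epsilon>" if \<epsilon>: "\<epsilon> > 0" for \<epsilon>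
  proof -
    \<comment> \<open>Replacing \<open>f\<close> by \<eta> costs \<open>K\<close> times the L1 error
      in the integral of D f and \<open>c\<close> times the error in the norm of \<eta>; the 1 keeps
      the denominator positive.\<close>
    have "\<epsilon> / (K + c + 1) > 0" using \<epsilon> K c by simp
    from test_functions_dense_lborel[OF U fm fb(1,2) this]
    obtain \<eta> where \<eta>: "\<eta> \<in> test_functions U" "(LINT x|lborel. \<bar>f x - \<eta> x\<bar>) < \<epsilon> / (K + c + 1)"
      by blast
    have \<eta>i: "integrable lborel \<eta>" by (rule test_function_integrable[OF \<eta>(1)])
    have di: "integrable lborel (\<lambda>x. \<bar>f x - \<eta> x\<bar>)" using fi \<eta>i by simp
    have Ddi: "integrable lborel (\<lambda>x. D x * (f x - \<eta> x))"
      using bounded_times_integrable[OF Dm D(2)] fi \<eta>i by simp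
    have D\<eta>i: "integrable lborel (\<lambda>x. D x * \<eta> x)" by (rule bounded_times_integrable[OF Dm D(2) \<eta>i])
    have "(LINT x|lborel. D x * f x) = (LINT x|lborel. D x * \<eta> x) + (LINT x|lborel. D x * (f x - \<eta> x))"
      using D\<eta>i Ddi Dfi by (simp add: right_diff_distrib)
    also have "(LINT x|lborel. D x * (f x - \<eta> x)) \<le> (LINT x|lborel. K * \<bar>f x - \<eta> x\<bar>)"
    proof (rule integral_mono[OF Ddi])
      show "D x * (f x - \<eta> x) \<le> K * \<bar>f x - \<eta> x\<bar>" for x
        using mult_right_mono[OF D(2)[of x], of "\<bar>f x - \<eta> x\<bar>"] abs_ge_self[of "D x * (f x - \<eta> x)"]
        by (simp add: abs_mult)
    qed (use di in simp)
    also have "(LINT x|lborel. D x * \<eta> x) \<le> c * (LINT x|lborel. \<bar>\<eta> x\<bar>)" by (rule bound[OF \<eta>(1)])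
    also have "(LINT x|lborel. \<bar>\<eta> x\<bar>) \<le> (LINT x|lborel. f x + \<bar>f x - \<eta> x\<bar>)"
    proof (rule integral_mono)
      fix x show "\<bar>\<eta> x\<bar> \<le> f x + \<bar>f x - \<eta> x\<bar>" using fb(3)[of x] by linarith
    qed (use fi \<eta>i di in simp_all)
    also have "\<dots> = (LINT x|lborel. f x) + (LINT x|lborel. \<bar>f x - \<eta> x\<bar>)" using fi di by simp
    finally have *: "(LINT x|lborel. D x * f x) \<le> c * ((LINT x|lborel. f x) + (LINT x|lborel. \<bar>f x - \<eta> x\<bar>))
        + (LINT x|lborel. K * \<bar>f x - \<eta> x\<bar>)"
      using c by (simp add: mult_left_mono)
    have "(LINT x|lborel. (D x - c) * f x) = (LINT x|lborel. D x * f x) - c * (LINT x|lborel. f x)"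
      using Dfi fi by (simp add: left_diff_distrib)
    also have "\<dots> \<le> (K + c) * (LINT x|lborel. \<bar>f x - \<eta> x\<bar>)"
      using * by (simp add: algebra_simps)
    also have "\<dots> \<le> (K + c) * (\<epsilon> / (K + c + 1))" using \<eta>(2) K c by (intro mult_left_mono) auto
    also have "\<dots> \<le> \<epsilon>" using \<epsilon> K c by (simp add: field_simps)
    finally show ?thesis by simp
  qed
  have nn: "0 \<le> (D x - c) * f x" for x by (simp add: f_def)
  have i: "integrable lborel (\<lambda>x. (D x - c) * f x)" using Dfi fi by (simp add: left_diff_distrib)
  have "(LINT x|lborel. (D x - c) * f x) \<le> 0" by (rule field_le_epsilon[OF le])
  then have "(LINT x|lborel. (D x - c) * f x) = 0"
    using Bochner_Integration.integral_nonneg[of lborel "\<lambda>x. (D x - c) * f x"] nn by (simp add: antisym)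
  then have "AE x in lborel. (D x - c) * f x = 0"
    using integral_nonneg_eq_0_iff_AE[OF i] nn by simp
  then show ?thesis by eventually_elim (auto simp: f_def split: if_splits)
qed

text \<open>\<gamma> is the weak derivative of \<open>g\<close> in the direction \<open>j\<close> on
  \<open>B\<close>. Shifts by at most \<open>r\<close> along that axis keep \<open>U\<close> inside
  \<open>B\<close>, so a test function on \<open>U\<close> can be moved along the axis and remains
  admissible in \<open>weak\<close>.\<close>

locale bounded_weak_derivative =
  fixes B U :: "(real^'n) set" and j :: 'n and r M N :: real and g \<gamma> :: "real^'n \<Rightarrow> real"
  assumes U: "open U" "bounded U" and r: "r > 0"
    and UB: "\<And>t. \<bar>t\<bar> \<le> r \<Longrightarrow> (+) (t *\<^sub>R axis j 1) ` U \<subseteq> B"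
    and g: "g \<in> borel_measurable borel" "\<And>x. \<bar>g x\<bar> \<le> M"
    and \<gamma>: "\<gamma> \<in> borel_measurable borel" "\<And>x. \<bar>\<gamma> x\<bar> \<le> N"
    and weak: "\<And>\<phi>. \<phi> \<in> test_functions B \<Longrightarrow>
      (LINT x|lborel. g x * partial_deriv j \<phi> x) = - (LINT x|lborel. \<gamma> x * \<phi> x)"
begin

abbreviation e :: "real^'n" where "e \<equiv> axis j 1"

lemma N: "0 \<le> N" using \<gamma>(2)[of 0] by linarith

lemma M: "0 \<le> M" using g(2)[of 0] by linarith

lemma U_subset_B: "U \<subseteq> B"
  using UB[of 0] r by simp

text \<open>The integral of \<open>g\<close> against \<psi> shifted by \<open>t\<close> is
  differentiable in \<open>t\<close>: applied to the shifted test function, the weak identity gives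
  as derivative the integral of \<gamma> against it, at most \<open>N\<close> times the L1 norm of
  \<psi>. The mean value inequality between 0 and \<open>h\<close> and a shift of variables
  finish.\<close>

lemma difference_integral_bound:
  assumes \<psi>: "\<psi> \<in> test_functions U" and h: "\<bar>h\<bar> \<le> r"
  shows "\<bar>LINT x|lborel. (g (x + h *\<^sub>R e) - g x) * \<psi> x\<bar> \<le> N * (LINT x|lborel. \<bar>\<psi> x\<bar>) * \<bar>h\<bar>"
proof -
  define \<psi>' where "\<psi>' t x = \<psi> (x - t *\<^sub>R e)" for t x
  define F where "F t = (LINT y|lborel. g y * \<psi>' t y)" for t
  have \<psi>m: "\<psi> \<in> borel_measurable borel" by (rule test_function_borel_measurable[OF \<psi>])
  have test: "\<psi>' t \<in> test_functions B" if "\<bar>t\<bar> \<le> r" for t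
    using test_functions_mono[OF UB[OF that]] test_function_translation[OF \<psi>, of "t *\<^sub>R e"]
    unfolding \<psi>'_def by blast
  have gm: "g \<in> borel_measurable lborel" using g(1) by simp
  have int: "integrable lborel (\<psi>' t)" for t
    unfolding \<psi>'_def using test_function_integrable[OF test_function_translation[OF \<psi>]] .
  have gint: "integrable lborel (\<lambda>y. g y * \<psi>' t y)" for t
    by (rule bounded_times_integrable[OF gm g(2) int])
  have absint: "(LINT x|lborel. \<bar>\<psi>' t x\<bar>) = (LINT x|lborel. \<bar>\<psi> x\<bar>)" for t
    using lborel_integral_translation[of "\<lambda>x. \<bar>\<psi> x\<bar>" "- (t *\<^sub>R e)"] \<psi>m by (simp add: \<psi>'_def)
  have D: "(F has_real_derivative (LINT x|lborel. \<gamma> x * \<psi>' t x)) (at t)" if t: "\<bar>t\<bar> \<le> r" for t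
    unfolding DERIV_def tendsto_at_iff_sequentially comp_def
  proof (intro allI impI)
    fix s :: "nat \<Rightarrow> real" assume s: "\<forall>i. s i \<in> UNIV - {0}" "s \<longlonglongrightarrow> 0"
    have s': "(\<lambda>n. - s n) \<longlonglongrightarrow> 0" "\<And>n. - s n \<noteq> 0" using s tendsto_minus[OF s(2)] by auto
    have eq: "(F (t + s n) - F t) / s n
        = - (LINT y|lborel. g y * ((\<psi>' t (y + (- s n) *\<^sub>R e) - \<psi>' t y) / (- s n)))" for n
    proof -
      have 1: "\<psi>' (t + s n) y = \<psi>' t (y + (- s n) *\<^sub>R e)" for y
        by (simp add: \<psi>'_def algebra_simps)
      have "F (t + s n) - F t = (LINT y|lborel. g y * (\<psi>' t (y + (- s n) *\<^sub>R e) - \<psi>' t y))"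
        using gint[of "t + s n"] gint[of t] unfolding F_def 1 right_diff_distrib by simp
      then show ?thesis by simp
    qed
    have "(\<lambda>n. - (LINT y|lborel. g y * ((\<psi>' t (y + (- s n) *\<^sub>R e) - \<psi>' t y) / (- s n))))
        \<longlonglongrightarrow> - (LINT y|lborel. g y * partial_deriv j (\<psi>' t) y)"
      by (intro tendsto_minus difference_quotient_limit[OF test[OF t] g s'])
    then show "(\<lambda>n. (F (t + s n) - F t) / s n) \<longlonglongrightarrow> (LINT x|lborel. \<gamma> x * \<psi>' t x)"
      unfolding eq weak[OF test[OF t]] by simp
  qed
  have bound: "norm (LINT x|lborel. \<gamma> x * \<psi>' t x) \<le> N * (LINT x|lborel. \<bar>\<psi> x\<bar>)" for t
  proof -
    have \<gamma>i: "integrable lborel (\<lambda>x. \<gamma> x * \<psi>' t x)"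
      using \<gamma>(1) by (intro bounded_times_integrable[OF _ \<gamma>(2) int]) simp
    have "norm (LINT x|lborel. \<gamma> x * \<psi>' t x) \<le> (LINT x|lborel. norm (\<gamma> x * \<psi>' t x))"
      by (rule integral_norm_bound)
    also have "\<dots> \<le> (LINT x|lborel. N * \<bar>\<psi>' t x\<bar>)"
    proof (rule integral_mono)
      show "integrable lborel (\<lambda>x. norm (\<gamma> x * \<psi>' t x))" using \<gamma>i by (rule integrable_norm)
      show "integrable lborel (\<lambda>x. N * \<bar>\<psi>' t x\<bar>)" using int by simp
      show "norm (\<gamma> x * \<psi>' t x) \<le> N * \<bar>\<psi>' t x\<bar>" for x
        using mult_right_mono[OF \<gamma>(2)[of x] abs_ge_zero, of "\<psi>' t x"] by (simp add: abs_mult)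
    qed
    also have "\<dots> = N * (LINT x|lborel. \<bar>\<psi> x\<bar>)" by (simp add: absint)
    finally show ?thesis .
  qed
  have "norm (F h - F 0) \<le> N * (LINT x|lborel. \<bar>\<psi> x\<bar>) * norm (h - 0)"
  proof (rule field_differentiable_bound[of "{- r..r}"])
    fix t assume "t \<in> {- r..r}"
    then have t: "\<bar>t\<bar> \<le> r" by (simp add: abs_le_iff)
    show "(F has_real_derivative (LINT x|lborel. \<gamma> x * \<psi>' t x)) (at t within {- r..r})"
      by (rule has_field_derivative_at_within[OF D[OF t]])
    show "norm (LINT x|lborel. \<gamma> x * \<psi>' t x) \<le> N * (LINT x|lborel. \<bar>\<psi> x\<bar>)" by (rule bound)
  next
    show "h \<in> {- r..r}" "0 \<in> {- r..r}" using h r by (simp_all add: abs_le_iff)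
  qed simp
  moreover have "F h - F 0 = (LINT x|lborel. (g (x + h *\<^sub>R e) - g x) * \<psi> x)"
  proof -
    have "F h - F 0 = (LINT y|lborel. g y * (\<psi> (y + (- h) *\<^sub>R e) - \<psi> y))"
      using gint[of h] gint[of 0] unfolding F_def right_diff_distrib by (simp add: \<psi>'_def)
    also have "\<dots> = (LINT x|lborel. (g (x - (- h) *\<^sub>R e) - g x) * \<psi> x)"
      by (rule integral_shift[OF test_function_integrable[OF \<psi>] g])
    finally show ?thesis by simp
  qed
  ultimately show ?thesis by simp
qed

text \<open>Duality applied to the difference and to its negative. This stands in for a Lipschitz
  representative; the exceptional null set may depend on \<open>h\<close>, and each use concerns one
  fixed \<open>h\<close>.\<close>

lemma difference_bound:
  assumes h: "\<bar>h\<bar> \<le> r"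
  shows "AE x in lborel. x \<in> U \<longrightarrow> \<bar>g (x + h *\<^sub>R e) - g x\<bar> \<le> N * \<bar>h\<bar>"
proof -
  let ?D = "\<lambda>x. g (x + h *\<^sub>R e) - g x"
  have Dm: "?D \<in> borel_measurable borel" using g(1) by measurable
  have Db: "\<bar>?D x\<bar> \<le> 2 * M" "\<bar>- ?D x\<bar> \<le> 2 * M" for x
    using g(2)[of x] g(2)[of "x + h *\<^sub>R e"] by linarith+
  have Nh: "0 \<le> N * \<bar>h\<bar>" using N by simp
  have "AE x in lborel. x \<in> U \<longrightarrow> ?D x \<le> N * \<bar>h\<bar>"
    by (rule AE_bound_by_duality[OF U Dm Db(1) Nh])
      (use difference_integral_bound[OF _ h] in \<open>fastforce simp: mult_ac\<close>)
  moreover have "AE x in lborel. x \<in> U \<longrightarrow> - ?D x \<le> N * \<bar>h\<bar>"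
  proof (rule AE_bound_by_duality[OF U _ Db(2) Nh])
    show "(\<lambda>x. - ?D x) \<in> borel_measurable borel" using Dm by (rule borel_measurable_uminus)
    fix \<eta> assume "\<eta> \<in> test_functions U"
    then have "\<bar>LINT x|lborel. ?D x * \<eta> x\<bar> \<le> N * \<bar>h\<bar> * (LINT x|lborel. \<bar>\<eta> x\<bar>)"
      using difference_integral_bound[OF _ h] by (fastforce simp: mult_ac)
    moreover have "(LINT x|lborel. - ?D x * \<eta> x) = - (LINT x|lborel. ?D x * \<eta> x)"
      by (simp only: mult_minus_left Bochner_Integration.integral_minus)
    ultimately show "(LINT x|lborel. - ?D x * \<eta> x) \<le> N * \<bar>h\<bar> * (LINT x|lborel. \<bar>\<eta> x\<bar>)" by linarith
  qed
  ultimately show ?thesis by eventually_elim auto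
qed

text \<open>Against a test function the quotient is shifted onto that function and the weak identity
  applies. As the quotients are bounded by \<open>N\<close> on \<open>U\<close>, L1 approximation
  extends the limit to bounded Borel weights \<open>f\<close>, which the chain rule needs.\<close>

lemma difference_quotient_weak_limit:
  assumes f: "f \<in> borel_measurable borel" "\<And>x. \<bar>f x\<bar> \<le> K" "\<And>x. x \<notin> U \<Longrightarrow> f x = 0"
    and h: "h \<longlonglongrightarrow> 0" "\<And>n. h n \<noteq> 0" "\<And>n. \<bar>h n\<bar> \<le> r"
  shows "(\<lambda>n. LINT x|lborel. f x * ((g (x + h n *\<^sub>R e) - g x) / h n)) \<longlonglongrightarrow> (LINT x|lborel. f x * \<gamma> x)"
proof (rule LIMSEQ_I)
  fix \<epsilon> :: real assume \<epsilon>: "\<epsilon> > 0"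
  define q where "q n x = (g (x + h n *\<^sub>R e) - g x) / h n" for n x
  note g(1)[measurable] \<gamma>(1)[measurable] f(1)[measurable]
  have qm[measurable]: "q n \<in> borel_measurable borel" for n unfolding q_def[abs_def] by measurable
  have qb: "\<bar>q n x\<bar> \<le> 2 * M / \<bar>h n\<bar>" for n x
    unfolding q_def abs_divide using g(2)[of x] g(2)[of "x + h n *\<^sub>R e"] by (intro divide_right_mono) linarith+
  have qN: "AE x in lborel. x \<in> U \<longrightarrow> \<bar>q n x\<bar> \<le> N" for n
  proof -
    have hn: "\<bar>h n\<bar> > 0" using h(2)[of n] by simp
    show ?thesis
      using difference_bound[OF h(3)[of n]]
      by eventually_elim (simp add: q_def abs_divide pos_divide_le_eq[OF hn])
  qed
  have fi: "integrable lborel f" by (rule bounded_support_integrable[OF U f])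
  \<comment> \<open>The quotient and its limit each contribute an error of at most
    \<open>N * \<delta>\<close>, and the two together stay below half of \<epsilon>.\<close>
  define \<delta> where "\<delta> = \<epsilon> / (2 * N + 1) / 2"
  have \<delta>: "\<delta> > 0" using \<epsilon> N by (simp add: \<delta>_def)
  obtain \<eta> where \<eta>: "\<eta> \<in> test_functions U" "(LINT x|lborel. \<bar>f x - \<eta> x\<bar>) < \<delta>"
    using test_functions_dense_lborel[OF U f \<delta>] by blast
  note test_function_borel_measurable[OF \<eta>(1), measurable]
  have \<eta>i: "integrable lborel \<eta>" by (rule test_function_integrable[OF \<eta>(1)])
  have di: "integrable lborel (\<lambda>x. f x - \<eta> x)" using fi \<eta>i by simp
  have qi: "integrable lborel (\<lambda>x. q n x * k x)" if "integrable lborel k" for n k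
    by (rule bounded_times_integrable[OF _ qb that]) simp
  have \<gamma>i: "integrable lborel (\<lambda>x. \<gamma> x * k x)" if "integrable lborel k" for k
    by (rule bounded_times_integrable[OF _ \<gamma>(2) that]) simp
  have test: "\<eta> \<in> test_functions B" using test_functions_mono[OF U_subset_B] \<eta>(1) by blast
  have "(\<lambda>n. - (LINT x|lborel. g x * ((\<eta> (x + (- h n) *\<^sub>R e) - \<eta> x) / (- h n))))
      \<longlonglongrightarrow> - (LINT x|lborel. g x * partial_deriv j \<eta> x)"
    using h(2) tendsto_minus[OF h(1)]
    by (intro tendsto_minus difference_quotient_limit[OF \<eta>(1) g]) simp_all
  moreover have "- (LINT x|lborel. g x * ((\<eta> (x + (- h n) *\<^sub>R e) - \<eta> x) / (- h n)))
      = (LINT x|lborel. q n x * \<eta> x)" for n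
    using integral_shift[OF \<eta>i g, of "(- h n) *\<^sub>R e"] by (simp add: q_def)
  ultimately have lim: "(\<lambda>n. LINT x|lborel. q n x * \<eta> x) \<longlonglongrightarrow> (LINT x|lborel. \<gamma> x * \<eta> x)"
    using weak[OF test] by simp
  have "\<epsilon> / 2 > 0" using \<epsilon> by simp
  from LIMSEQ_D[OF lim this] obtain n0 where n0: "\<And>n. n \<ge> n0 \<Longrightarrow> norm ((LINT x|lborel. q n x * \<eta> x) - (LINT x|lborel. \<gamma> x * \<eta> x)) < \<epsilon> / 2"
    by blast
  have small: "\<bar>LINT x|lborel. k x * (f x - \<eta> x)\<bar> \<le> N * \<delta>"
    if k: "k \<in> borel_measurable borel" "\<And>x. \<bar>k x\<bar> \<le> K'" "AE x in lborel. x \<in> U \<longrightarrow> \<bar>k x\<bar> \<le> N" for k K'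
  proof -
    have ki: "integrable lborel (\<lambda>x. k x * (f x - \<eta> x))"
      using k(1) by (intro bounded_times_integrable[OF _ k(2) di]) simp
    have "\<bar>LINT x|lborel. k x * (f x - \<eta> x)\<bar> \<le> (LINT x|lborel. \<bar>k x * (f x - \<eta> x)\<bar>)"
      using integral_norm_bound[of lborel "\<lambda>x. k x * (f x - \<eta> x)"] by simp
    also have "\<dots> \<le> (LINT x|lborel. N * \<bar>f x - \<eta> x\<bar>)"
    proof (rule integral_mono_AE)
      show "AE x in lborel. \<bar>k x * (f x - \<eta> x)\<bar> \<le> N * \<bar>f x - \<eta> x\<bar>"
        using k(3)
      proof eventually_elim
        fix x assume "x \<in> U \<longrightarrow> \<bar>k x\<bar> \<le> N"
        then show "\<bar>k x * (f x - \<eta> x)\<bar> \<le> N * \<bar>f x - \<eta> x\<bar>"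
          using f(3)[of x] test_function_outside[OF \<eta>(1), of x]
          by (cases "x \<in> U") (simp_all add: abs_mult mult_right_mono)
      qed
    qed (use ki di in simp_all)
    also have "\<dots> \<le> N * \<delta>" using \<eta>(2) N by (simp add: mult_left_mono)
    finally show ?thesis .
  qed
  have "norm ((LINT x|lborel. f x * q n x) - (LINT x|lborel. f x * \<gamma> x)) < \<epsilon>" if n: "n \<ge> n0" for n
  proof -
    have 1: "(LINT x|lborel. f x * q n x) = (LINT x|lborel. q n x * \<eta> x) + (LINT x|lborel. q n x * (f x - \<eta> x))"
      using qi[OF fi, of n] qi[OF \<eta>i, of n] by (simp add: right_diff_distrib mult.commute)
    have 2: "(LINT x|lborel. f x * \<gamma> x) = (LINT x|lborel. \<gamma> x * \<eta> x) + (LINT x|lborel. \<gamma> x * (f x - \<eta> x))"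
      using \<gamma>i[OF fi] \<gamma>i[OF \<eta>i] by (simp add: right_diff_distrib mult.commute)
    have 3: "\<bar>LINT x|lborel. q n x * (f x - \<eta> x)\<bar> \<le> N * \<delta>" by (rule small[OF qm qb qN])
    have 4: "\<bar>LINT x|lborel. \<gamma> x * (f x - \<eta> x)\<bar> \<le> N * \<delta>" by (rule small[OF \<gamma>(1,2)]) (simp add: \<gamma>(2))
    have "2 * (N * \<delta>) < \<epsilon> / 2" using \<epsilon> N by (simp add: \<delta>_def field_simps)
    then show ?thesis using n0[OF n] 3 4 unfolding 1 2 real_norm_def by linarith
  qed
  then show "\<exists>no. \<forall>n\<ge>no. norm ((LINT x|lborel. f x * ((g (x + h n *\<^sub>R e) - g x) / h n)) - (LINT x|lborel. f x * \<gamma> x)) < \<epsilon>"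
    unfolding q_def by blast
qed

end

section \<open>The chain rule for composition with a bounded weakly differentiable map\<close>

text \<open>Expand the difference quotient of the composite to first order in the increments of X.
  These are at most \<open>N * h\<close> almost everywhere, so the quadratic Taylor remainder
  divided by \<open>h\<close> is of order \<open>h\<close>; the linear part converges weakly; the
  quotient on the left is shifted onto \<psi>.\<close>

lemma weak_chain_rule:
  fixes X G :: "'n \<Rightarrow> real^'n \<Rightarrow> real" and B :: "(real^'n) set"
  assumes B: "open B" "bounded B"
    and X: "\<And>k. X k \<in> borel_measurable borel" "\<And>k x. \<bar>X k x\<bar> \<le> M"
    and G: "\<And>k. G k \<in> borel_measurable borel" "\<And>k x. \<bar>G k x\<bar> \<le> N"
    and weak: "\<And>k \<phi>. \<phi> \<in> test_functions B \<Longrightarrow>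
      (LINT x|lborel. X k x * partial_deriv j \<phi> x) = - (LINT x|lborel. G k x * \<phi> x)"
    and \<phi>: "\<phi> \<in> test_functions V" and \<psi>: "\<psi> \<in> test_functions B"
  shows "(LINT x|lborel. \<phi> (\<chi> k. X k x) * partial_deriv j \<psi> x)
    = - (LINT x|lborel. (\<Sum>k\<in>UNIV. partial_deriv k \<phi> (\<chi> k. X k x) * G k x) * \<psi> x)"
proof -
  obtain K where K: "smooth \<psi>" "compact K" "K \<subseteq> B" "\<And>x. x \<notin> K \<Longrightarrow> \<psi> x = 0"
    using \<psi> by (blast elim!: test_functionsE)
  obtain \<epsilon> where \<epsilon>: "\<epsilon> > 0" "(\<Union>x\<in>K. ball x \<epsilon>) \<subseteq> B"
    using compact_subset_open_imp_ball_epsilon_subset[OF K(2) B(1) K(3)] by blast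
  \<comment> \<open>Half the distance margin is used for the neighbourhood and a quarter for the
    shifts, so the shifted neighbourhood remains inside \<open>B\<close>.\<close>
  define U where "U = (\<Union>x\<in>K. ball x (\<epsilon> / 2))"
  define r where "r = \<epsilon> / 4"
  have U: "open U" unfolding U_def by blast
  have UB: "(+) (t *\<^sub>R axis j 1) ` U \<subseteq> B" if t: "\<bar>t\<bar> \<le> r" for t
  proof
    fix y assume "y \<in> (+) (t *\<^sub>R axis j 1) ` U"
    then obtain x z where xz: "x \<in> K" "dist x z < \<epsilon> / 2" "y = t *\<^sub>R axis j 1 + z" by (auto simp: U_def)
    have "dist x y \<le> dist x z + dist z y" by (rule dist_triangle)
    also have "dist z y = \<bar>t\<bar>" unfolding xz(3) by (simp add: dist_norm norm_axis_1)
    finally have "dist x y < \<epsilon>" using xz(2) t \<epsilon>(1) by (simp add: r_def)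
    then have "y \<in> (\<Union>x\<in>K. ball x \<epsilon>)" using xz(1) by auto
    then show "y \<in> B" using \<epsilon>(2) by (rule subsetD[rotated])
  qed
  have r: "r > 0" using \<epsilon>(1) by (simp add: r_def)
  have "U \<subseteq> B" using UB[of 0] r by simp
  then have Ub: "bounded U" using B(2) bounded_subset by blast
  have "K \<subseteq> U" using \<epsilon>(1) by (force simp: U_def)
  then have \<psi>U: "\<psi> \<in> test_functions U" unfolding test_functions_def using K(1,2,4) by blast
  have bwd: "bounded_weak_derivative B U j r M N (X k) (G k)" for k
    by (rule bounded_weak_derivative.intro[OF U Ub r UB X G weak])
  define Y where "Y x = (\<chi> k. X k x)" for x
  have Ym[measurable]: "Y \<in> borel_measurable borel"
    unfolding borel_measurable_vec_iff by (simp add: Y_def X(1))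
  have [measurable]: "X k \<in> borel_measurable borel" "G k \<in> borel_measurable borel" for k
    by (rule X(1), rule G(1))
  note [measurable] = test_function_borel_measurable[OF \<phi>] test_function_borel_measurable[OF \<psi>]
    test_function_borel_measurable[OF test_functions_partial_deriv[OF \<phi>]]
  obtain C where C: "\<And>x. \<bar>\<phi> x\<bar> \<le> C" using test_function_bounded[OF \<phi>] by blast
  obtain C\<psi> where C\<psi>: "\<And>x. \<bar>\<psi> x\<bar> \<le> C\<psi>" using test_function_bounded[OF \<psi>] by blast
  have "\<forall>k. \<exists>M. \<forall>x. \<bar>partial_deriv k \<phi> x\<bar> \<le> M"
    using test_function_bounded[OF test_functions_partial_deriv[OF \<phi>]] by metis
  then obtain C' where C': "\<And>k x. \<bar>partial_deriv k \<phi> x\<bar> \<le> C' k" by metis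
  obtain L where L: "L > 0"
    "\<And>x y. \<bar>\<phi> y - \<phi> x - (\<Sum>k\<in>UNIV. partial_deriv k \<phi> x * (y - x) $ k)\<bar> \<le> L * (norm (y - x))\<^sup>2"
    using test_function_taylor[OF \<phi>] by blast
  have N0: "0 \<le> N" using G(2)[of undefined 0] by linarith
  define h where "h n = r * (1 / (real n + 1))" for n
  have h: "h \<longlonglongrightarrow> 0" "\<And>n. h n > 0" "\<And>n. h n \<le> r"
    using tendsto_mult_right[OF reciprocal_sequence(1), of r] r by (auto simp: h_def[abs_def] field_simps)
  define q where "q n k x = (X k (x + h n *\<^sub>R axis j 1) - X k x) / h n" for n k x
  \<comment> \<open>The factor \<psi> times the outer derivative is independent of the step and
    serves as weight in the weak limit of the inner quotients. It is bounded, Borel and supported in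
    \<open>U\<close>, but not smooth.\<close>
  define f where "f k x = \<psi> x * partial_deriv k \<phi> (Y x)" for k x
  define Q where "Q n x = (\<phi> (Y (x + h n *\<^sub>R axis j 1)) - \<phi> (Y x)) / h n" for n x
  have qm[measurable]: "q n k \<in> borel_measurable borel" for n k unfolding q_def[abs_def] by measurable
  have Qm[measurable]: "Q n \<in> borel_measurable borel" for n unfolding Q_def[abs_def] by measurable
  have fm[measurable]: "f k \<in> borel_measurable borel" for k unfolding f_def[abs_def] by measurable
  have fb: "\<bar>f k x\<bar> \<le> C\<psi> * C' k" for k x
    unfolding f_def abs_mult by (intro mult_mono C\<psi> C' abs_ge_zero order_trans[OF abs_ge_zero C\<psi>])
  have f0: "f k x = 0" if "x \<notin> U" for k x
    using that test_function_outside[OF \<psi>U] by (simp add: f_def)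
  have qb: "\<bar>q n k x\<bar> \<le> 2 * M / h n" for n k x
    unfolding q_def abs_divide using X(2)[of k x] X(2)[of k "x + h n *\<^sub>R axis j 1"] h(2)[of n]
    by (simp add: divide_right_mono)
  have Qb: "\<bar>Q n x\<bar> \<le> 2 * C / h n" for n x
    unfolding Q_def abs_divide using C[of "Y x"] C[of "Y (x + h n *\<^sub>R axis j 1)"] h(2)[of n]
    by (simp add: divide_right_mono)
  have fi: "integrable lborel (f k)" for k by (rule bounded_support_integrable[OF U Ub fm fb f0])
  have \<psi>i: "integrable lborel \<psi>" by (rule test_function_integrable[OF \<psi>])
  have qfi: "integrable lborel (\<lambda>x. q n k x * f k x)" for n k
    by (rule bounded_times_integrable[OF _ qb fi]) simp
  have Q\<psi>i: "integrable lborel (\<lambda>x. Q n x * \<psi> x)" for n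
    by (rule bounded_times_integrable[OF _ Qb \<psi>i]) simp
  \<comment> \<open>Coefficient of \<open>h n\<close> in the remainder: the l1 bound
    \<open>CARD('n) * N * h n\<close> of the increment enters squared and is divided by
    \<open>h n\<close>.\<close>
  define S where "S = L * (real CARD('n) * N)\<^sup>2 * (LINT x|lborel. \<bar>\<psi> x\<bar>)"
  have rem: "\<bar>(LINT x|lborel. Q n x * \<psi> x) - (\<Sum>k\<in>UNIV. LINT x|lborel. q n k x * f k x)\<bar> \<le> S * h n" for n
  proof -
    have ae: "AE x in lborel. \<forall>k\<in>UNIV. x \<in> U \<longrightarrow> \<bar>X k (x + h n *\<^sub>R axis j 1) - X k x\<bar> \<le> N * \<bar>h n\<bar>"
    proof (intro AE_finite_allI finite)
      fix k
      have "\<bar>h n\<bar> \<le> r" using h(2,3)[of n] by simp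
      then show "AE x in lborel. x \<in> U \<longrightarrow> \<bar>X k (x + h n *\<^sub>R axis j 1) - X k x\<bar> \<le> N * \<bar>h n\<bar>"
        by (rule bounded_weak_derivative.difference_bound[OF bwd])
    qed
    have "(LINT x|lborel. Q n x * \<psi> x) - (\<Sum>k\<in>UNIV. LINT x|lborel. q n k x * f k x)
        = (LINT x|lborel. Q n x * \<psi> x - (\<Sum>k\<in>UNIV. q n k x * f k x))"
      using Q\<psi>i qfi by (simp add: Bochner_Integration.integral_sum Bochner_Integration.integrable_sum)
    also have "\<bar>\<dots>\<bar> \<le> (LINT x|lborel. \<bar>Q n x * \<psi> x - (\<Sum>k\<in>UNIV. q n k x * f k x)\<bar>)"
      using integral_norm_bound[of lborel "\<lambda>x. Q n x * \<psi> x - (\<Sum>k\<in>UNIV. q n k x * f k x)"] by simp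
    also have "\<dots> \<le> (LINT x|lborel. L * (real CARD('n) * N)\<^sup>2 * h n * \<bar>\<psi> x\<bar>)"
    proof (rule integral_mono_AE)
      show "AE x in lborel. \<bar>Q n x * \<psi> x - (\<Sum>k\<in>UNIV. q n k x * f k x)\<bar>
          \<le> L * (real CARD('n) * N)\<^sup>2 * h n * \<bar>\<psi> x\<bar>"
        using ae
      proof eventually_elim
        fix x assume ax: "\<forall>k\<in>UNIV. x \<in> U \<longrightarrow> \<bar>X k (x + h n *\<^sub>R axis j 1) - X k x\<bar> \<le> N * \<bar>h n\<bar>"
        show "\<bar>Q n x * \<psi> x - (\<Sum>k\<in>UNIV. q n k x * f k x)\<bar> \<le> L * (real CARD('n) * N)\<^sup>2 * h n * \<bar>\<psi> x\<bar>"
        proof (cases "x \<in> U")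
          case False
          then show ?thesis using f0[of x] test_function_outside[OF \<psi>U] by simp
        next
          case True
          define y where "y = Y (x + h n *\<^sub>R axis j 1)"
          have yk: "(y - Y x) $ k = X k (x + h n *\<^sub>R axis j 1) - X k x" for k
            by (simp add: y_def Y_def)
          have "norm (y - Y x) \<le> (\<Sum>k\<in>UNIV. \<bar>(y - Y x) $ k\<bar>)" by (rule norm_le_l1_cart)
          also have "\<dots> \<le> (\<Sum>k\<in>(UNIV :: 'n set). N * h n)"
            using ax True h(2)[of n] unfolding yk by (intro sum_mono) simp
          finally have "norm (y - Y x) \<le> real CARD('n) * N * h n" by simp
          then have "(norm (y - Y x))\<^sup>2 \<le> (real CARD('n) * N * h n)\<^sup>2" by (intro power_mono) simp_all
          then have "L * (norm (y - Y x))\<^sup>2 \<le> L * (real CARD('n) * N * h n)\<^sup>2" using L(1) by simp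
          with L(2)[of y "Y x"] have t: "\<bar>\<phi> y - \<phi> (Y x) - (\<Sum>k\<in>UNIV. partial_deriv k \<phi> (Y x) * (y - Y x) $ k)\<bar>
              \<le> L * (real CARD('n) * N * h n)\<^sup>2" by linarith
          have "Q n x * \<psi> x - (\<Sum>k\<in>UNIV. q n k x * f k x)
              = (\<phi> y - \<phi> (Y x) - (\<Sum>k\<in>UNIV. partial_deriv k \<phi> (Y x) * (y - Y x) $ k)) / h n * \<psi> x"
          proof -
            have "(\<Sum>k\<in>UNIV. q n k x * f k x) = (\<Sum>k\<in>UNIV. partial_deriv k \<phi> (Y x) * (y - Y x) $ k) / h n * \<psi> x"
              unfolding yk q_def f_def sum_divide_distrib sum_distrib_right by (intro sum.cong) simp_all
            moreover have "Q n x = (\<phi> y - \<phi> (Y x)) / h n" by (simp add: Q_def y_def)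
            ultimately show ?thesis by (simp only: diff_divide_distrib left_diff_distrib)
          qed
          also have "\<bar>\<dots>\<bar> \<le> L * (real CARD('n) * N * h n)\<^sup>2 / h n * \<bar>\<psi> x\<bar>"
            unfolding abs_mult abs_divide using t h(2)[of n]
            by (intro mult_right_mono) (simp_all add: divide_right_mono)
          also have "\<dots> = L * (real CARD('n) * N)\<^sup>2 * h n * \<bar>\<psi> x\<bar>"
            using h(2)[of n] by (simp add: power2_eq_square)
          finally show ?thesis .
        qed
      qed
    qed (use Q\<psi>i qfi \<psi>i in \<open>simp_all add: Bochner_Integration.integrable_sum\<close>)
    also have "\<dots> = S * h n" by (simp add: S_def mult_ac)
    finally show ?thesis .
  qed
  have lim_f: "(\<lambda>n. LINT x|lborel. q n k x * f k x) \<longlonglongrightarrow> (LINT x|lborel. f k x * G k x)" for k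
  proof -
    have "h n \<noteq> 0" "\<bar>h n\<bar> \<le> r" for n using h(2,3)[of n] by auto
    from bounded_weak_derivative.difference_quotient_weak_limit[OF bwd fm fb f0 h(1) this]
    have "(\<lambda>n. LINT x|lborel. f k x * q n k x) \<longlonglongrightarrow> (LINT x|lborel. f k x * G k x)"
      unfolding q_def by blast
    then show ?thesis by (simp only: mult.commute)
  qed
  have "(\<lambda>n. (LINT x|lborel. Q n x * \<psi> x) - (\<Sum>k\<in>UNIV. LINT x|lborel. q n k x * f k x)) \<longlonglongrightarrow> 0"
  proof (rule Lim_null_comparison)
    show "\<forall>\<^sub>F n in sequentially. norm ((LINT x|lborel. Q n x * \<psi> x) - (\<Sum>k\<in>UNIV. LINT x|lborel. q n k x * f k x)) \<le> S * h n"
      using rem by simp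
    show "(\<lambda>n. S * h n) \<longlonglongrightarrow> 0" using tendsto_mult_left[OF h(1), of S] by simp
  qed
  moreover have "(\<lambda>n. \<Sum>k\<in>UNIV. LINT x|lborel. q n k x * f k x) \<longlonglongrightarrow> (\<Sum>k\<in>UNIV. LINT x|lborel. f k x * G k x)"
    by (intro tendsto_sum lim_f)
  ultimately have "(\<lambda>n. ((LINT x|lborel. Q n x * \<psi> x) - (\<Sum>k\<in>UNIV. LINT x|lborel. q n k x * f k x))
      + (\<Sum>k\<in>UNIV. LINT x|lborel. q n k x * f k x)) \<longlonglongrightarrow> 0 + (\<Sum>k\<in>UNIV. LINT x|lborel. f k x * G k x)"
    by (rule tendsto_add)
  then
  have lim1: "(\<lambda>n. LINT x|lborel. Q n x * \<psi> x) \<longlonglongrightarrow> (\<Sum>k\<in>UNIV. LINT x|lborel. f k x * G k x)" by simp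
  have h': "(\<lambda>n. - h n) \<longlonglongrightarrow> 0" "- h n \<noteq> 0" for n
    using tendsto_minus[OF h(1)] h(2)[of n] by simp_all
  have \<phi>Ym: "(\<lambda>x. \<phi> (Y x)) \<in> borel_measurable borel" by measurable
  have "(\<lambda>n. LINT x|lborel. \<phi> (Y x) * ((\<psi> (x + (- h n) *\<^sub>R axis j 1) - \<psi> x) / (- h n)))
      \<longlonglongrightarrow> (LINT x|lborel. \<phi> (Y x) * partial_deriv j \<psi> x)"
    by (rule difference_quotient_limit[OF \<psi> \<phi>Ym C h'])
  moreover have "(LINT x|lborel. \<phi> (Y x) * ((\<psi> (x + (- h n) *\<^sub>R axis j 1) - \<psi> x) / (- h n)))
      = - (LINT x|lborel. Q n x * \<psi> x)" for n
    using integral_shift[OF \<psi>i \<phi>Ym C, of "(- h n) *\<^sub>R axis j 1"] by (simp add: Q_def)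
  ultimately have "(\<lambda>n. - (LINT x|lborel. Q n x * \<psi> x)) \<longlonglongrightarrow> (LINT x|lborel. \<phi> (Y x) * partial_deriv j \<psi> x)"
    by simp
  from LIMSEQ_unique[OF this tendsto_minus[OF lim1]]
  have "(LINT x|lborel. \<phi> (Y x) * partial_deriv j \<psi> x) = - (\<Sum>k\<in>UNIV. LINT x|lborel. f k x * G k x)" .
  also have "(\<Sum>k\<in>UNIV. LINT x|lborel. f k x * G k x) = (LINT x|lborel. (\<Sum>k\<in>UNIV. f k x * G k x))"
  proof (rule Bochner_Integration.integral_sum[symmetric])
    fix k
    have "integrable lborel (\<lambda>x. G k x * f k x)"
      by (rule bounded_times_integrable[OF _ G(2) fi]) simp
    then show "integrable lborel (\<lambda>x. f k x * G k x)" by (simp only: mult.commute)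
  qed
  also have "\<dots> = (LINT x|lborel. (\<Sum>k\<in>UNIV. partial_deriv k \<phi> (Y x) * G k x) * \<psi> x)"
    by (simp add: f_def sum_distrib_right sum_distrib_left mult_ac)
  finally show ?thesis by (simp add: Y_def)
qed

section \<open>Composition as a bounded operator between Sobolev spaces\<close>

lemma l2_norm_square_vec:
  fixes u :: "'a::euclidean_space \<Rightarrow> 'b::euclidean_space ^ 'n"
  assumes "u \<in> L2 D"
  shows "(l2_norm D u)\<^sup>2 = (\<Sum>i\<in>UNIV. (l2_norm D (\<lambda>x. u x $ i))\<^sup>2)"
proof -
  have int: "integrable (lebesgue_on D) (\<lambda>x. (norm (u x $ i))\<^sup>2)" for i
    using assms L2_square_integrable by (auto simp: L2_vec_iff)
  have "(norm v)\<^sup>2 = (\<Sum>i\<in>UNIV. (norm (v $ i))\<^sup>2)" for v :: "'b^'n"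
    by (simp add: norm_vec_def L2_set_def sum_nonneg)
  then show ?thesis
    unfolding l2_norm_square using Bochner_Integration.integral_sum[OF int] by simp
qed

lemma norm_matrix_mult_le:
  fixes A :: "real^'n^'m" and G :: "real^'k^'n"
  shows "norm (A ** G) \<le> (real CARD('m) * real CARD('k) * real CARD('n)) * (norm A * norm G)"
proof -
  have entry: "\<bar>(A ** G) $ i $ j\<bar> \<le> real CARD('n) * (norm A * norm G)" for i j
  proof -
    have "\<bar>(A ** G) $ i $ j\<bar> \<le> (\<Sum>k\<in>UNIV. \<bar>A $ i $ k\<bar> * \<bar>G $ k $ j\<bar>)"
      unfolding matrix_matrix_mult_def by (simp add: abs_mult[symmetric] sum_abs)
    also have "\<dots> \<le> (\<Sum>k\<in>(UNIV :: 'n set). norm A * norm G)"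
      by (intro sum_mono mult_mono order_trans[OF component_le_norm_cart Finite_Cartesian_Product.norm_nth_le]) simp_all
    finally show ?thesis by simp
  qed
  have "norm (A ** G) \<le> (\<Sum>i\<in>UNIV. norm ((A ** G) $ i))"
    unfolding norm_vec_def by (rule L2_set_le_sum) simp
  also have "\<dots> \<le> (\<Sum>i\<in>(UNIV :: 'm set). \<Sum>j\<in>(UNIV :: 'k set). real CARD('n) * (norm A * norm G))"
    by (intro sum_mono order_trans[OF norm_le_l1_cart] entry)
  finally show ?thesis by (simp add: mult_ac)
qed

lemma L2_matrix_mult:
  fixes A :: "'a::euclidean_space \<Rightarrow> real^'n^'m" and G :: "'a \<Rightarrow> real^'k^'n"
  assumes A: "A \<in> L2 D" and G: "G \<in> borel_measurable (lebesgue_on D)" "AE x in lebesgue_on D. norm (G x) \<le> N" and N: "0 \<le> N"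
  shows "(\<lambda>x. A x ** G x) \<in> L2 D"
    and "l2_norm D (\<lambda>x. A x ** G x) \<le> real CARD('m) * real CARD('k) * real CARD('n) * N * l2_norm D A"
proof -
  let ?c = "real CARD('m) * real CARD('k) * real CARD('n) * N"
  have ae: "AE x in lebesgue_on D. norm (A x ** G x) \<le> ?c * norm (A x)"
    using G(2)
  proof eventually_elim
    fix x assume "norm (G x) \<le> N"
    then have "norm (A x) * norm (G x) \<le> norm (A x) * N" by (rule mult_left_mono) simp
    then have "(real CARD('m) * real CARD('k) * real CARD('n)) * (norm (A x) * norm (G x))
        \<le> (real CARD('m) * real CARD('k) * real CARD('n)) * (norm (A x) * N)"
      by (rule mult_left_mono) simp
    also have "\<dots> = ?c * norm (A x)" by simp
    finally show "norm (A x ** G x) \<le> ?c * norm (A x)"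
      using norm_matrix_mult_le[of "A x" "G x"] by linarith
  qed
  show L: "(\<lambda>x. A x ** G x) \<in> L2 D"
  proof (rule L2_bound)
    have Am: "(\<lambda>x. A x $ i $ k) \<in> borel_measurable (lebesgue_on D)" for i k
      using L2_measurable[OF A] by (simp add: borel_measurable_vec_iff)
    have Gm: "(\<lambda>x. G x $ k $ j) \<in> borel_measurable (lebesgue_on D)" for k j
      using G(1) by (simp add: borel_measurable_vec_iff)
    show "(\<lambda>x. A x ** G x) \<in> borel_measurable (lebesgue_on D)"
      unfolding borel_measurable_vec_iff matrix_matrix_mult_def vec_lambda_beta
      by (intro allI borel_measurable_sum borel_measurable_times Am Gm)
    show "integrable (lebesgue_on D) (\<lambda>x. ?c\<^sup>2 * (norm (A x))\<^sup>2)"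
      using L2_square_integrable[OF A] by simp
    show "AE x in lebesgue_on D. (norm (A x ** G x))\<^sup>2 \<le> ?c\<^sup>2 * (norm (A x))\<^sup>2"
      using ae
    proof eventually_elim
      fix x assume "norm (A x ** G x) \<le> ?c * norm (A x)"
      then have "(norm (A x ** G x))\<^sup>2 \<le> (?c * norm (A x))\<^sup>2" by (intro power_mono) simp_all
      then show "(norm (A x ** G x))\<^sup>2 \<le> ?c\<^sup>2 * (norm (A x))\<^sup>2" by (simp only: power_mult_distrib)
    qed
  qed
  show "l2_norm D (\<lambda>x. A x ** G x) \<le> ?c * l2_norm D A"
    using N by (intro l2_norm_mono[OF A L _ ae]) simp
qed

lemma integral_representative_mult:
  fixes f g k :: "'a::euclidean_space \<Rightarrow> real"
  assumes U: "U \<in> sets borel" and f: "f \<in> borel_measurable (lebesgue_on U)" and g: "g \<in> borel_measurable borel"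
    and ae: "AE x in lebesgue_on U. f x = g x" and k: "k \<in> borel_measurable borel"
    and zero: "\<And>x. x \<notin> U \<Longrightarrow> g x * k x = 0"
  shows "(LINT x|lebesgue_on U. f x * k x) = (LINT x|lborel. g x * k x)"
proof (rule integral_borel_representative[OF U])
  show "(\<lambda>x. f x * k x) \<in> borel_measurable (lebesgue_on U)"
    using f borel_measurable_lebesgue_on[OF k] by (rule borel_measurable_times)
  show "(\<lambda>x. g x * k x) \<in> borel_measurable borel" using g k by (rule borel_measurable_times)
  show "AE x in lebesgue_on U. f x * k x = g x * k x" using ae by eventually_elim simp
qed (rule zero)

lemma matrix_mult_diff_left: "(A - B) ** (G :: real^'k^'n) = A ** G - B ** G"
  by (simp add: matrix_matrix_mult_def vec_eq_iff left_diff_distrib sum_subtractf)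

lemma abs_entry_le_norm: "\<bar>A $ i $ j\<bar> \<le> norm (A :: real^'n^'m)"
  using component_le_norm_cart[of "A $ i" j] Finite_Cartesian_Product.norm_nth_le[of A i] by linarith

context pushforward_bound
begin

lemma
  fixes w :: "real^'n \<Rightarrow> real^'m"
  assumes w: "w \<in> L2 \<Omega>"
  shows L2_pushforward_vec: "(\<lambda>x. w (X x)) \<in> L2 B"
    and l2_norm_pushforward_vec: "(l2_norm B (\<lambda>x. w (X x)))\<^sup>2 \<le> C * (l2_norm \<Omega> w)\<^sup>2"
proof -
  have c: "(\<lambda>x. w x $ i) \<in> L2 \<Omega>" for i using w by (simp add: L2_vec_iff)
  show L: "(\<lambda>x. w (X x)) \<in> L2 B" using L2_pushforward_real[OF c] by (simp add: L2_vec_iff)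
  show "(l2_norm B (\<lambda>x. w (X x)))\<^sup>2 \<le> C * (l2_norm \<Omega> w)\<^sup>2"
    unfolding l2_norm_square_vec[OF L] l2_norm_square_vec[OF w] sum_distrib_left
    by (intro sum_mono l2_norm_pushforward_real c)
qed

lemma
  fixes w :: "real^'n \<Rightarrow> real^'k^'m"
  assumes w: "w \<in> L2 \<Omega>"
  shows L2_pushforward_matrix: "(\<lambda>x. w (X x)) \<in> L2 B"
    and l2_norm_pushforward_matrix: "(l2_norm B (\<lambda>x. w (X x)))\<^sup>2 \<le> C * (l2_norm \<Omega> w)\<^sup>2"
proof -
  have c: "(\<lambda>x. w x $ i) \<in> L2 \<Omega>" for i using iffD1[OF L2_vec_iff w] by (rule spec)
  have "\<forall>i. (\<lambda>x. w (X x) $ i) \<in> L2 B" by (rule allI, rule L2_pushforward_vec[OF c])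
  then show L: "(\<lambda>x. w (X x)) \<in> L2 B" by (rule iffD2[OF L2_vec_iff])
  show "(l2_norm B (\<lambda>x. w (X x)))\<^sup>2 \<le> C * (l2_norm \<Omega> w)\<^sup>2"
    unfolding l2_norm_square_vec[OF L] l2_norm_square_vec[OF w] sum_distrib_left
    by (intro sum_mono l2_norm_pushforward_vec c)
qed

lemma sqrt_C_bound:
  assumes "a\<^sup>2 \<le> C * b\<^sup>2" "0 \<le> b"
  shows "a \<le> sqrt C * b"
proof (rule power2_le_imp_le)
  show "a\<^sup>2 \<le> (sqrt C * b)\<^sup>2" using assms(1) C by (simp add: power_mult_distrib)
  show "0 \<le> sqrt C * b" using assms(2) C by simp
qed

end

locale lipschitz_pullback = pushforward_bound B \<Omega> X C
  for B \<Omega> :: "(real^'n) set" and X C +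
  fixes G :: "real^'n \<Rightarrow> real^'n^'n"
  assumes XL: "X \<in> Linf B" and GL: "G \<in> Linf B" and weak: "weak_gradient B X G"
begin

text \<open>\<open>weak_chain_rule\<close> lives on the whole space and needs everywhere bounded
  Borel functions, so the components of \<open>X\<close> and column \<open>j\<close> of
  \<open>G\<close> are replaced by such representatives and the integrals are transferred
  back.\<close>

lemma weak_gradient_compose_test_field:
  fixes \<phi> :: "real^'n \<Rightarrow> real^'m"
  assumes \<phi>: "\<And>i. (\<lambda>x. \<phi> x $ i) \<in> test_functions \<Omega>"
  shows "weak_gradient B (\<lambda>x. \<phi> (X x)) (\<lambda>x. jacobian \<phi> (X x) ** G x)"
  unfolding weak_gradient_def
proof (intro ballI allI)
  fix \<psi> i j assume \<psi>: "\<psi> \<in> test_functions B"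
  have d\<psi>: "partial_deriv j \<psi> \<in> test_functions B" by (rule test_functions_partial_deriv[OF \<psi>])
  obtain M' where M': "AE x in lebesgue_on B. norm (X x) \<le> M'" using XL by (auto simp: Linf_def)
  obtain N' where N': "AE x in lebesgue_on B. norm (G x) \<le> N'" using GL by (auto simp: Linf_def)
  define M where "M = \<bar>M'\<bar>"
  define N where "N = \<bar>N'\<bar>"
  have Xc: "(\<lambda>x. X x $ k) \<in> borel_measurable (lebesgue_on B)" for k
    using X by (simp add: borel_measurable_vec_iff)
  have "G \<in> borel_measurable (lebesgue_on B)" using GL by (simp add: Linf_def)
  then have Gc: "(\<lambda>x. G x $ k $ j) \<in> borel_measurable (lebesgue_on B)" for k
    by (simp add: borel_measurable_vec_iff)
  have XM: "AE x in lebesgue_on B. \<bar>X x $ k\<bar> \<le> M" for k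
    using M'
  proof eventually_elim
    fix x assume "norm (X x) \<le> M'"
    then show "\<bar>X x $ k\<bar> \<le> M" using component_le_norm_cart[of "X x" k] by (simp add: M_def)
  qed
  have GN: "AE x in lebesgue_on B. \<bar>G x $ k $ j\<bar> \<le> N" for k
    using N'
  proof eventually_elim
    fix x assume "norm (G x) \<le> N'"
    then show "\<bar>G x $ k $ j\<bar> \<le> N" using abs_entry_le_norm[of "G x" k j] by (simp add: N_def)
  qed
  have MN: "0 \<le> M" "0 \<le> N" by (simp_all add: M_def N_def)
  have "\<forall>k. \<exists>g. g \<in> borel_measurable borel \<and> (\<forall>x. x \<notin> B \<longrightarrow> g x = 0) \<and> (AE x in lebesgue_on B. X x $ k = g x) \<and> (\<forall>x. \<bar>g x\<bar> \<le> M)"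
  proof
    fix k
    show "\<exists>g. g \<in> borel_measurable borel \<and> (\<forall>x. x \<notin> B \<longrightarrow> g x = 0) \<and> (AE x in lebesgue_on B. X x $ k = g x) \<and> (\<forall>x. \<bar>g x\<bar> \<le> M)"
      by (rule bounded_borel_representative[OF Bb(1) Xc XM MN(1)]) blast
  qed
  from choice[OF this] obtain X0 where X0: "\<And>k. X0 k \<in> borel_measurable borel" "\<And>k x. x \<notin> B \<Longrightarrow> X0 k x = 0"
    "\<And>k. AE x in lebesgue_on B. X x $ k = X0 k x" "\<And>k x. \<bar>X0 k x\<bar> \<le> M" by blast
  have "\<forall>k. \<exists>g. g \<in> borel_measurable borel \<and> (\<forall>x. x \<notin> B \<longrightarrow> g x = 0) \<and> (AE x in lebesgue_on B. G x $ k $ j = g x) \<and> (\<forall>x. \<bar>g x\<bar> \<le> N)"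
  proof
    fix k
    show "\<exists>g. g \<in> borel_measurable borel \<and> (\<forall>x. x \<notin> B \<longrightarrow> g x = 0) \<and> (AE x in lebesgue_on B. G x $ k $ j = g x) \<and> (\<forall>x. \<bar>g x\<bar> \<le> N)"
      by (rule bounded_borel_representative[OF Bb(1) Gc GN MN(2)]) blast
  qed
  from choice[OF this] obtain G0 where G0: "\<And>k. G0 k \<in> borel_measurable borel" "\<And>k x. x \<notin> B \<Longrightarrow> G0 k x = 0"
    "\<And>k. AE x in lebesgue_on B. G x $ k $ j = G0 k x" "\<And>k x. \<bar>G0 k x\<bar> \<le> N" by blast
  have weak0: "(LINT x|lborel. X0 k x * partial_deriv j \<eta> x) = - (LINT x|lborel. G0 k x * \<eta> x)"
    if \<eta>: "\<eta> \<in> test_functions B" for k \<eta>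
  proof -
    have "(LINT x|lborel. X0 k x * partial_deriv j \<eta> x) = (LINT x|lebesgue_on B. X x $ k * partial_deriv j \<eta> x)"
      by (rule integral_representative_mult[OF Bb(1) Xc X0(1) X0(3), symmetric])
        (simp_all add: X0(2) test_function_borel_measurable[OF test_functions_partial_deriv[OF \<eta>]])
    also have "\<dots> = - (LINT x|lebesgue_on B. G x $ k $ j * \<eta> x)"
      using weak \<eta> by (simp add: weak_gradient_def)
    also have "(LINT x|lebesgue_on B. G x $ k $ j * \<eta> x) = (LINT x|lborel. G0 k x * \<eta> x)"
      by (rule integral_representative_mult[OF Bb(1) Gc G0(1) G0(3)])
        (simp_all add: G0(2) test_function_borel_measurable[OF \<eta>])
    finally show ?thesis .
  qed
  define Y where "Y x = (\<chi> k. X0 k x)" for x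
  have Ym: "Y \<in> borel_measurable borel" unfolding borel_measurable_vec_iff by (simp add: Y_def X0(1))
  have "AE x in lebesgue_on B. \<forall>k\<in>UNIV. X x $ k = X0 k x" by (intro AE_finite_allI X0(3) finite)
  then have XY: "AE x in lebesgue_on B. X x = Y x" by eventually_elim (simp add: Y_def vec_eq_iff)
  have "AE x in lebesgue_on B. \<forall>k\<in>UNIV. G x $ k $ j = G0 k x" by (intro AE_finite_allI G0(3) finite)
  note GG = this
  have \<phi>m: "(\<lambda>x. \<phi> x $ i) \<in> borel_measurable borel" by (rule test_function_borel_measurable[OF \<phi>])
  have d\<phi>m: "partial_deriv k (\<lambda>x. \<phi> x $ i) \<in> borel_measurable borel" for k
    by (rule test_function_borel_measurable[OF test_functions_partial_deriv[OF \<phi>]])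
  have "(LINT x|lebesgue_on B. \<phi> (X x) $ i * partial_deriv j \<psi> x) = (LINT x|lborel. \<phi> (Y x) $ i * partial_deriv j \<psi> x)"
  proof (rule integral_representative_mult[OF Bb(1)])
    show "(\<lambda>x. \<phi> (X x) $ i) \<in> borel_measurable (lebesgue_on B)" by (rule measurable_compose[OF X \<phi>m])
    show "(\<lambda>x. \<phi> (Y x) $ i) \<in> borel_measurable borel" by (rule measurable_compose[OF Ym \<phi>m])
    show "AE x in lebesgue_on B. \<phi> (X x) $ i = \<phi> (Y x) $ i" using XY by eventually_elim simp
    show "partial_deriv j \<psi> \<in> borel_measurable borel" by (rule test_function_borel_measurable[OF d\<psi>])
    show "\<phi> (Y x) $ i * partial_deriv j \<psi> x = 0" if "x \<notin> B" for x
      using test_function_outside[OF d\<psi> that] by simp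
  qed
  also have "\<dots> = - (LINT x|lborel. (\<Sum>k\<in>UNIV. partial_deriv k (\<lambda>y. \<phi> y $ i) (Y x) * G0 k x) * \<psi> x)"
    unfolding Y_def by (rule weak_chain_rule[OF B X0(1,4) G0(1,4) weak0 \<phi> \<psi>])
  also have "(LINT x|lborel. (\<Sum>k\<in>UNIV. partial_deriv k (\<lambda>y. \<phi> y $ i) (Y x) * G0 k x) * \<psi> x)
      = (LINT x|lebesgue_on B. (jacobian \<phi> (X x) ** G x) $ i $ j * \<psi> x)"
  proof (rule integral_representative_mult[OF Bb(1), symmetric])
    have e: "(jacobian \<phi> (X x) ** G x) $ i $ j = (\<Sum>k\<in>UNIV. partial_deriv k (\<lambda>y. \<phi> y $ i) (X x) * G x $ k $ j)" for x
      by (simp add: matrix_matrix_mult_def jacobian_def)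
    show "(\<lambda>x. (jacobian \<phi> (X x) ** G x) $ i $ j) \<in> borel_measurable (lebesgue_on B)"
      unfolding e by (intro borel_measurable_sum borel_measurable_times Gc measurable_compose[OF X d\<phi>m])
    show "(\<lambda>x. \<Sum>k\<in>UNIV. partial_deriv k (\<lambda>y. \<phi> y $ i) (Y x) * G0 k x) \<in> borel_measurable borel"
      by (intro borel_measurable_sum borel_measurable_times G0(1) measurable_compose[OF Ym d\<phi>m])
    show "AE x in lebesgue_on B. (jacobian \<phi> (X x) ** G x) $ i $ j = (\<Sum>k\<in>UNIV. partial_deriv k (\<lambda>y. \<phi> y $ i) (Y x) * G0 k x)"
      unfolding e using XY GG by eventually_elim simp
    show "\<psi> \<in> borel_measurable borel" by (rule test_function_borel_measurable[OF \<psi>])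
    show "(\<Sum>k\<in>UNIV. partial_deriv k (\<lambda>y. \<phi> y $ i) (Y x) * G0 k x) * \<psi> x = 0" if "x \<notin> B" for x
      using test_function_outside[OF \<psi> that] by simp
  qed
  finally show "(LINT x|lebesgue_on B. \<phi> (X x) $ i * partial_deriv j \<psi> x)
      = - (LINT x|lebesgue_on B. (jacobian \<phi> (X x) ** G x) $ i $ j * \<psi> x)" .
qed

text \<open>The dimensional constant of \<open>L2_matrix_mult\<close> for square matrices, with
  \<open>N\<close> bounding \<open>G\<close>.\<close>

definition gradient_factor :: "real \<Rightarrow> real" where
  "gradient_factor N = real CARD('n) * real CARD('n) * real CARD('n) * N"

text \<open>The defect \<open>d\<close> of the weak identity is continuous in \<open>u\<close> for
  the H1 norm, by the change of variables and the bound on \<open>G\<close>. It vanishes for test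
  fields, and \<open>H10\<close> is by definition their closure.\<close>

lemma weak_gradient_compose:
  fixes u :: "real^'n \<Rightarrow> real^'n"
  assumes u: "u \<in> H10 \<Omega>" and N: "AE x in lebesgue_on B. norm (G x) \<le> N" "0 \<le> N"
  shows "weak_gradient B (\<lambda>x. u (X x)) (\<lambda>x. grad \<Omega> u (X x) ** G x)"
  unfolding weak_gradient_def
proof (intro ballI allI)
  fix \<psi> i j assume \<psi>: "\<psi> \<in> test_functions B"
  have Gm: "G \<in> borel_measurable (lebesgue_on B)" using GL by (simp add: Linf_def)
  have uH: "u \<in> H1 \<Omega>" using u by (simp add: H10_def)
  let ?dp = "partial_deriv j \<psi>"
  have pL: "\<psi> \<in> L2 B" by (rule test_function_L2[OF B \<psi>])
  have dpL: "?dp \<in> L2 B" by (rule test_function_L2[OF B test_functions_partial_deriv[OF \<psi>]])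
  define a where "a w x = w (X x) $ i" for w :: "real^'n \<Rightarrow> real^'n" and x
  define m where "m A x = (A (X x) ** G x) $ i $ j" for A :: "real^'n \<Rightarrow> real^'n^'n" and x
  have aL: "a w \<in> L2 B" if "w \<in> L2 \<Omega>" for w
    using L2_pushforward_vec[OF that] by (simp add: L2_vec_iff a_def[abs_def])
  have mL': "(\<lambda>x. A (X x) ** G x) \<in> L2 B" if "A \<in> L2 \<Omega>" for A :: "real^'n \<Rightarrow> real^'n^'n"
    by (rule L2_matrix_mult(1)[OF L2_pushforward_matrix[OF that] Gm N])
  have mL: "m A \<in> L2 B" if "A \<in> L2 \<Omega>" for A
    using mL'[OF that] by (simp add: L2_vec_iff m_def[abs_def])
  have an: "l2_norm B (a w) \<le> sqrt C * l2_norm \<Omega> w" if w: "w \<in> L2 \<Omega>" for w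
  proof -
    have "l2_norm B (a w) \<le> 1 * l2_norm B (\<lambda>x. w (X x))"
      by (rule l2_norm_mono[OF L2_pushforward_vec[OF w] aL[OF w]]) (simp_all add: a_def component_le_norm_cart)
    also have "\<dots> \<le> sqrt C * l2_norm \<Omega> w"
      using sqrt_C_bound[OF l2_norm_pushforward_vec[OF w]] by simp
    finally show ?thesis .
  qed
  have mn: "l2_norm B (m A) \<le> gradient_factor N * (sqrt C * l2_norm \<Omega> A)" if A: "A \<in> L2 \<Omega>" for A
  proof -
    have "l2_norm B (m A) \<le> 1 * l2_norm B (\<lambda>x. A (X x) ** G x)"
      by (rule l2_norm_mono[OF mL'[OF A] mL[OF A]]) (simp_all add: m_def abs_entry_le_norm)
    also have "\<dots> \<le> gradient_factor N * l2_norm B (\<lambda>x. A (X x))"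
      using L2_matrix_mult(2)[OF L2_pushforward_matrix[OF A] Gm N] by (simp add: gradient_factor_def)
    also have "\<dots> \<le> gradient_factor N * (sqrt C * l2_norm \<Omega> A)"
      using sqrt_C_bound[OF l2_norm_pushforward_matrix[OF A]] N(2)
      by (intro mult_left_mono) (simp_all add: gradient_factor_def)
    finally show ?thesis .
  qed
  define d where "d = l2_inner B (a u) ?dp + l2_inner B (m (grad \<Omega> u)) \<psi>"
  define S where "S = sqrt C * l2_norm B ?dp + gradient_factor N * sqrt C * l2_norm B \<psi>"
  have gf: "0 \<le> gradient_factor N" using N(2) by (simp add: gradient_factor_def)
  have S: "0 \<le> S" using C gf by (simp add: S_def)
  have bound: "\<bar>d\<bar> \<le> S * \<delta>" if \<delta>: "\<delta> > 0" for \<delta>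
  proof -
    obtain \<phi> where \<phi>: "\<And>i. (\<lambda>x. \<phi> x $ i) \<in> test_functions \<Omega>" "h1_norm \<Omega> (u - \<phi>) < \<delta>"
      using u \<delta> unfolding H10_def by blast
    have \<phi>H: "\<phi> \<in> H1 \<Omega>" by (rule test_field_H1[OF \<Omega> \<phi>(1)])
    have JL: "jacobian \<phi> \<in> L2 \<Omega>" by (rule jacobian_L2[OF \<Omega> \<phi>(1)])
    note L = H1_L2[OF uH] H1_L2[OF \<phi>H] grad_L2[OF uH] JL
    have z: "l2_inner B (a \<phi>) ?dp + l2_inner B (m (jacobian \<phi>)) \<psi> = 0"
      using weak_gradient_compose_test_field[OF \<phi>(1)] \<psi>
      by (simp add: weak_gradient_def l2_inner_def a_def m_def)
    have ad: "a u - a \<phi> = a (u - \<phi>)" by (auto simp: a_def)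
    have md: "m (grad \<Omega> u) - m (jacobian \<phi>) = m (grad \<Omega> u - jacobian \<phi>)"
      by (auto simp: m_def matrix_mult_diff_left)
    have "d = d - (l2_inner B (a \<phi>) ?dp + l2_inner B (m (jacobian \<phi>)) \<psi>)" using z by simp
    also have "\<dots> = l2_inner B (a u - a \<phi>) ?dp + l2_inner B (m (grad \<Omega> u) - m (jacobian \<phi>)) \<psi>"
      unfolding d_def L2.diff_left[OF aL[OF L(1)] aL[OF L(2)] dpL] L2.diff_left[OF mL[OF L(3)] mL[OF L(4)] pL] by simp
    finally have deq: "d = l2_inner B (a (u - \<phi>)) ?dp + l2_inner B (m (grad \<Omega> u - jacobian \<phi>)) \<psi>"
      unfolding ad md .
    have uL: "u - \<phi> \<in> L2 \<Omega>" by (rule L2.closed_diff[OF L(1,2)])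
    have gL: "grad \<Omega> u - jacobian \<phi> \<in> L2 \<Omega>" by (rule L2.closed_diff[OF L(3,4)])
    have n1: "l2_norm \<Omega> (u - \<phi>) \<le> \<delta>" using l2_norm_le_h1_norm[of \<Omega> "u - \<phi>"] \<phi>(2) by linarith
    have n2: "l2_norm \<Omega> (grad \<Omega> u - jacobian \<phi>) \<le> \<delta>"
    proof -
      have "l2_norm \<Omega> (grad \<Omega> u - jacobian \<phi>) = l2_norm \<Omega> (grad \<Omega> u - grad \<Omega> \<phi>)"
      proof (rule l2_norm_cong_AE[OF gL L2.closed_diff[OF L(3) grad_L2[OF \<phi>H]]])
        show "AE x in lebesgue_on \<Omega>. (grad \<Omega> u - jacobian \<phi>) x = (grad \<Omega> u - grad \<Omega> \<phi>) x"
          using grad_test_field[OF \<Omega> \<phi>(1)] by eventually_elim simp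
      qed
      also have "\<dots> = l2_norm \<Omega> (grad \<Omega> (u - \<phi>))" by (rule l2_norm_grad_diff[OF \<Omega> uH \<phi>H])
      also have "\<dots> \<le> h1_norm \<Omega> (u - \<phi>)" by (rule l2_norm_grad_le_h1_norm)
      finally show ?thesis using \<phi>(2) by simp
    qed
    have "\<bar>l2_inner B (a (u - \<phi>)) ?dp\<bar> \<le> l2_norm B (a (u - \<phi>)) * l2_norm B ?dp"
      by (rule L2.cauchy_schwarz[OF aL[OF uL] dpL])
    also have "\<dots> \<le> (sqrt C * \<delta>) * l2_norm B ?dp"
      using order_trans[OF an[OF uL] mult_left_mono[OF n1, of "sqrt C"]] C by (intro mult_right_mono) simp_all
    finally have 1: "\<bar>l2_inner B (a (u - \<phi>)) ?dp\<bar> \<le> sqrt C * \<delta> * l2_norm B ?dp" .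
    have "\<bar>l2_inner B (m (grad \<Omega> u - jacobian \<phi>)) \<psi>\<bar> \<le> l2_norm B (m (grad \<Omega> u - jacobian \<phi>)) * l2_norm B \<psi>"
      by (rule L2.cauchy_schwarz[OF mL[OF gL] pL])
    also have "\<dots> \<le> (gradient_factor N * (sqrt C * \<delta>)) * l2_norm B \<psi>"
    proof (rule mult_right_mono)
      have "gradient_factor N * (sqrt C * l2_norm \<Omega> (grad \<Omega> u - jacobian \<phi>)) \<le> gradient_factor N * (sqrt C * \<delta>)"
        using n2 C gf by (intro mult_left_mono) simp_all
      with mn[OF gL] show "l2_norm B (m (grad \<Omega> u - jacobian \<phi>)) \<le> gradient_factor N * (sqrt C * \<delta>)" by linarith
    qed simp
    finally have 2: "\<bar>l2_inner B (m (grad \<Omega> u - jacobian \<phi>)) \<psi>\<bar> \<le> gradient_factor N * (sqrt C * \<delta>) * l2_norm B \<psi>" .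
    have "S * \<delta> = sqrt C * \<delta> * l2_norm B ?dp + gradient_factor N * (sqrt C * \<delta>) * l2_norm B \<psi>"
      by (simp add: S_def algebra_simps)
    then show ?thesis using 1 2 unfolding deq by linarith
  qed
  have "\<bar>d\<bar> \<le> 0"
  proof (rule field_le_epsilon)
    fix e :: real assume "e > 0"
    then have "S * (e / (S + 1)) \<le> e" using S by (simp add: field_simps)
    then show "\<bar>d\<bar> \<le> 0 + e" using bound[of "e / (S + 1)"] S \<open>e > 0\<close> by simp
  qed
  then have "d = 0" by simp
  then show "(LINT x|lebesgue_on B. u (X x) $ i * ?dp x) = - (LINT x|lebesgue_on B. (grad \<Omega> u (X x) ** G x) $ i $ j * \<psi> x)"
    by (simp add: d_def l2_inner_def a_def m_def)
qed

text \<open>The change of variables contributes \<open>sqrt C\<close>; the gradient part carries in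
  addition the factor from \<open>G\<close>.\<close>

theorem compose_H10_bounded:
  "\<exists>K\<ge>0. \<forall>u \<in> H10 \<Omega>. (\<lambda>x. u (X x)) \<in> H1 B \<and> h1_norm B (\<lambda>x. u (X x) :: real^'n) \<le> K * h1_norm \<Omega> u"
proof -
  obtain N' where "AE x in lebesgue_on B. norm (G x) \<le> N'" using GL by (auto simp: Linf_def)
  then have N: "AE x in lebesgue_on B. norm (G x) \<le> \<bar>N'\<bar>" by eventually_elim simp
  have Gm: "G \<in> borel_measurable (lebesgue_on B)" using GL by (simp add: Linf_def)
  let ?c = "gradient_factor \<bar>N'\<bar>"
  have c: "0 \<le> ?c" by (simp add: gradient_factor_def)
  have "(\<lambda>x. u (X x)) \<in> H1 B \<and> h1_norm B (\<lambda>x. u (X x)) \<le> ((?c + 1) * sqrt C) * h1_norm \<Omega> u"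
    if u: "u \<in> H10 \<Omega>" for u :: "real^'n \<Rightarrow> real^'n"
  proof
    have uH: "u \<in> H1 \<Omega>" using u by (simp add: H10_def)
    note w = weak_gradient_compose[OF u N abs_ge_zero]
    have L: "(\<lambda>x. u (X x)) \<in> L2 B" by (rule L2_pushforward_vec[OF H1_L2[OF uH]])
    have gL: "(\<lambda>x. grad \<Omega> u (X x) ** G x) \<in> L2 B"
      by (rule L2_matrix_mult(1)[OF L2_pushforward_matrix[OF grad_L2[OF uH]] Gm N abs_ge_zero])
    show H: "(\<lambda>x. u (X x)) \<in> H1 B" by (rule H1I[OF L gL w])
    have "l2_norm B (grad B (\<lambda>x. u (X x))) = l2_norm B (\<lambda>x. grad \<Omega> u (X x) ** G x)"
      by (rule l2_norm_cong_AE[OF grad_L2[OF H] gL grad_eq_AE[OF B L gL w]])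
    also have "\<dots> \<le> ?c * l2_norm B (\<lambda>x. grad \<Omega> u (X x))"
      using L2_matrix_mult(2)[OF L2_pushforward_matrix[OF grad_L2[OF uH]] Gm N abs_ge_zero]
      by (simp add: gradient_factor_def)
    also have "\<dots> \<le> ?c * (sqrt C * h1_norm \<Omega> u)"
    proof (rule mult_left_mono[OF _ c])
      have "l2_norm B (\<lambda>x. grad \<Omega> u (X x)) \<le> sqrt C * l2_norm \<Omega> (grad \<Omega> u)"
        using sqrt_C_bound[OF l2_norm_pushforward_matrix[OF grad_L2[OF uH]]] by simp
      also have "\<dots> \<le> sqrt C * h1_norm \<Omega> u"
        using C by (intro mult_left_mono l2_norm_grad_le_h1_norm) simp
      finally show "l2_norm B (\<lambda>x. grad \<Omega> u (X x)) \<le> sqrt C * h1_norm \<Omega> u" .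
    qed
    finally have 1: "l2_norm B (grad B (\<lambda>x. u (X x))) \<le> ?c * (sqrt C * h1_norm \<Omega> u)" .
    have "l2_norm B (\<lambda>x. u (X x)) \<le> sqrt C * l2_norm \<Omega> u"
      using sqrt_C_bound[OF l2_norm_pushforward_vec[OF H1_L2[OF uH]]] by simp
    also have "\<dots> \<le> sqrt C * h1_norm \<Omega> u"
      using C by (intro mult_left_mono l2_norm_le_h1_norm) simp
    finally show "h1_norm B (\<lambda>x. u (X x)) \<le> ((?c + 1) * sqrt C) * h1_norm \<Omega> u"
      using 1 h1_norm_le[of B "\<lambda>x. u (X x)"] by (simp add: algebra_simps)
  qed
  moreover have "0 \<le> (?c + 1) * sqrt C" using c C by simp
  ultimately show ?thesis by blast
qed

end

text \<open>Needed for the continuous approximation error \<open>u - v\<close>, whose composition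
  with \<open>Xbar\<close> is estimated as well.\<close>

lemma H10_diff:
  fixes D :: "(real^'n) set" and u v :: "real^'n \<Rightarrow> real^'m"
  assumes D: "open D" "bounded D" and u: "u \<in> H10 D" and v: "v \<in> H10 D"
  shows "u - v \<in> H10 D"
proof -
  interpret semi_inner_space "H1 D" "h1_inner D :: (real^'n \<Rightarrow> real^'m) \<Rightarrow> _ \<Rightarrow> real" by (rule semi_inner_space_H1[OF D])
  have uv: "u \<in> H1 D" "v \<in> H1 D" using u v by (simp_all add: H10_def)
  have "\<exists>\<phi>. (\<forall>i. (\<lambda>x. \<phi> x $ i) \<in> test_functions D) \<and> h1_norm D ((u - v) - \<phi>) < \<epsilon>" if \<epsilon>: "\<epsilon> > 0" for \<epsilon>
  proof -
    have h: "\<epsilon> / 2 > 0" using \<epsilon> by simp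
    obtain \<phi> where \<phi>: "\<And>i. (\<lambda>x. \<phi> x $ i) \<in> test_functions D" "h1_norm D (u - \<phi>) < \<epsilon> / 2"
      using u h unfolding H10_def by blast
    obtain \<psi> where \<psi>: "\<And>i. (\<lambda>x. \<psi> x $ i) \<in> test_functions D" "h1_norm D (v - \<psi>) < \<epsilon> / 2"
      using v h unfolding H10_def by blast
    have H: "\<phi> \<in> H1 D" "\<psi> \<in> H1 D" using test_field_H1[OF D] \<phi>(1) \<psi>(1) by blast+
    have "(\<lambda>x. (\<phi> - \<psi>) x $ i) \<in> test_functions D" for i
      using test_functions_linear_combination[OF \<phi>(1)[of i] \<psi>(1)[of i], of 1 "- 1"] by simp
    moreover have "(u - v) - (\<phi> - \<psi>) = (\<lambda>x. 1 *\<^sub>R (u - \<phi>) x + (- 1) *\<^sub>R (v - \<psi>) x)"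
      by (auto simp: fun_diff_def)
    then have "h1_norm D ((u - v) - (\<phi> - \<psi>)) \<le> h1_norm D (u - \<phi>) + h1_norm D (v - \<psi>)"
      using nm_combination[OF closed_diff[OF uv(1) H(1)] closed_diff[OF uv(2) H(2)], of 1 "- 1"]
      by (simp add: h1_nm[OF D])
    then have "h1_norm D ((u - v) - (\<phi> - \<psi>)) < \<epsilon>" using \<phi>(2) \<psi>(2) by simp
    ultimately show ?thesis by blast
  qed
  then show ?thesis using H1_diff[OF D uv] unfolding H10_def by blast
qed

lemma composition_bounded:
  fixes \<Omega> B :: "(real^'n) set" and X :: "real^'n \<Rightarrow> real^'n"
  assumes \<Omega>: "open \<Omega>" "bounded \<Omega>" and B: "open B" "bounded B"
    and X: "X \<in> W1inf B" "inj_on X B" "L-lipschitz_on (X ` B) (inv_into B X)" "X ` B \<subseteq> \<Omega>"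
  obtains K where "K \<ge> 0" "\<And>u :: real^'n \<Rightarrow> real^'n. u \<in> H10 \<Omega> \<Longrightarrow> u \<circ> X \<in> H1 B"
    "\<And>u :: real^'n \<Rightarrow> real^'n. u \<in> H10 \<Omega> \<Longrightarrow> h1_norm B (u \<circ> X) \<le> K * h1_norm \<Omega> u"
proof -
  obtain G where G: "G \<in> Linf B" "weak_gradient B X G" using X(1) by (auto simp: W1inf_def)
  have XL: "X \<in> Linf B" using X(1) by (auto simp: W1inf_def)
  then have Xm: "X \<in> borel_measurable (lebesgue_on B)" by (simp add: Linf_def)
  have bd: "bounded (X ` B)" using \<Omega>(2) X(4) by (rule bounded_subset)
  have Bl: "B \<in> sets lebesgue" using B(1) by auto
  obtain C where C: "C \<ge> 0" "\<And>E. E \<in> sets borel \<Longrightarrow> emeasure lebesgue {x \<in> B. X x \<in> E} \<le> ennreal C * emeasure lborel E"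
    using preimage_emeasure_le[OF Xm X(2) bd Bl X(3)] by blast
  interpret lipschitz_pullback B \<Omega> X C G
    by (rule lipschitz_pullback.intro[OF pushforward_bound.intro[OF B \<Omega> Xm X(4) C]
          lipschitz_pullback_axioms.intro[OF XL G]])
  obtain K where K: "K \<ge> 0" "\<And>u :: real^'n \<Rightarrow> real^'n. u \<in> H10 \<Omega> \<Longrightarrow> (\<lambda>x. u (X x)) \<in> H1 B"
    "\<And>u :: real^'n \<Rightarrow> real^'n. u \<in> H10 \<Omega> \<Longrightarrow> h1_norm B (\<lambda>x. u (X x)) \<le> K * h1_norm \<Omega> u"
    using compose_H10_bounded by blast
  then show ?thesis
    by (intro that[of K]) (simp_all only: comp_def)
qed

section \<open>Orthogonal projections onto finite element spaces\<close>

text \<open>Finite dimension is replaced by a finite list \<open>gs\<close> that determines the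
  elements of \<open>T\<close> up to norm zero, so no basis is required. The induction passes to the
  kernel \<open>T'\<close> of one functional and adds back one direction \<open>z\<close> orthogonal
  to \<open>T'\<close>. Both \<open>v\<close> and an auxiliary \<open>z0\<close> are projected onto
  \<open>T'\<close>, so the claim is generalised over the projected vector.\<close>

lemma (in semi_inner_space) projection_exists:
  assumes "T \<subseteq> S" "T \<noteq> {}" "\<And>f g a b. f \<in> T \<Longrightarrow> g \<in> T \<Longrightarrow> (\<lambda>x. a *\<^sub>R f x + b *\<^sub>R g x) \<in> T"
    and "set gs \<subseteq> S" "\<And>Y. Y \<in> T \<Longrightarrow> (\<And>g. g \<in> set gs \<Longrightarrow> ip Y g = 0) \<Longrightarrow> ip Y Y = 0"
    and "v \<in> S"
  shows "\<exists>w\<in>T. \<forall>Y\<in>T. ip w Y = ip v Y"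
  using assms
proof (induction gs arbitrary: T v)
  case Nil
  have null: "ip w Y = 0" if "Y \<in> T" "w \<in> S" for w Y
  proof -
    have "nm Y = 0" using Nil.prems(5)[OF that(1)] by (simp add: nm_def)
    then show ?thesis using cauchy_schwarz[OF that(2), of Y] that(1) Nil.prems(1) by auto
  qed
  obtain w where w: "w \<in> T" using Nil.prems(2) by blast
  then have "\<forall>Y\<in>T. ip w Y = ip v Y" using null Nil.prems(1,6) by auto
  with w show ?case by blast
next
  case (Cons g gs)
  define T' where "T' = {Y \<in> T. ip Y g = 0}"
  have TS: "\<And>Y. Y \<in> T \<Longrightarrow> Y \<in> S" and gS: "g \<in> S" using Cons.prems(1,4) by auto
  have sub: "T' \<subseteq> S" using TS by (auto simp: T'_def)
  obtain f0 where f0: "f0 \<in> T" using Cons.prems(2) by blast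
  have "(\<lambda>x. 0 *\<^sub>R f0 x + 0 *\<^sub>R f0 x) \<in> T'"
  proof -
    have "(\<lambda>x. 0 *\<^sub>R f0 x + 0 *\<^sub>R f0 x) \<in> T" by (rule Cons.prems(3)[OF f0 f0])
    moreover have "ip (\<lambda>x. 0 *\<^sub>R f0 x + 0 *\<^sub>R f0 x) g = 0"
      unfolding linear[OF TS[OF f0] TS[OF f0] gS] by simp
    ultimately show ?thesis unfolding T'_def by blast
  qed
  then have ne: "T' \<noteq> {}" by blast
  have cl: "(\<lambda>x. a *\<^sub>R f x + b *\<^sub>R h x) \<in> T'" if "f \<in> T'" "h \<in> T'" for f h a b
    using that Cons.prems(3)[of f h a b] linear[OF TS TS gS, of f h a b] by (simp add: T'_def)
  have det: "ip Y Y = 0" if "Y \<in> T'" "\<And>g. g \<in> set gs \<Longrightarrow> ip Y g = 0" for Y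
    using that Cons.prems(5)[of Y] by (auto simp: T'_def)
  have proj: "\<exists>w\<in>T'. \<forall>Y\<in>T'. ip w Y = ip v Y" if "v \<in> S" for v
    by (rule Cons.IH[OF sub ne cl _ det that]) (use Cons.prems(4) in auto)
  show ?case
  proof (cases "\<exists>z\<in>T. ip z g \<noteq> 0")
    case False
    then have "T' = T" by (auto simp: T'_def)
    then show ?thesis using proj[OF Cons.prems(6)] by simp
  next
    case True
    then obtain z0 where z0: "z0 \<in> T" "ip z0 g \<noteq> 0" by blast
    \<comment> \<open>Subtracting from \<open>z0\<close> its projection \<open>p\<close> yields
      \<open>z\<close>, orthogonal to \<open>T'\<close>. The value on \<open>g\<close> is unchanged,
      as \<open>p\<close> lies in the kernel of \<open>g\<close>.\<close>
    obtain p where p: "p \<in> T'" "\<And>Y. Y \<in> T' \<Longrightarrow> ip p Y = ip z0 Y" using proj[OF TS[OF z0(1)]] by blast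
    obtain w' where w': "w' \<in> T'" "\<And>Y. Y \<in> T' \<Longrightarrow> ip w' Y = ip v Y" using proj[OF Cons.prems(6)] by blast
    have pT: "p \<in> T" "ip p g = 0" and w'T: "w' \<in> T" using p(1) w'(1) by (auto simp: T'_def)
    define z where "z x = 1 *\<^sub>R z0 x + (- 1) *\<^sub>R p x" for x
    have zT: "z \<in> T" unfolding z_def[abs_def] by (rule Cons.prems(3)[OF z0(1) pT(1)])
    have zip: "ip z k = ip z0 k - ip p k" if "k \<in> S" for k
      unfolding z_def[abs_def] using linear[OF TS[OF z0(1)] TS[OF pT(1)] that, of 1 "- 1"] by simp
    have zg: "ip z g \<noteq> 0" using zip[OF gS] z0(2) pT(2) by simp
    have orth: "ip z Y = 0" if "Y \<in> T'" for Y using zip[of Y] p(2)[OF that] that sub by auto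
    \<comment> \<open>If \<open>ip z z = 0\<close>, then \<open>s\<close> is 0 by the convention on
      division, and Cauchy-Schwarz gives \<open>ip v z = 0\<close>; the identity for
      \<open>s\<close> thus holds in both cases.\<close>
    define s where "s = ip v z / ip z z"
    have s: "s * ip z z = ip v z"
    proof (cases "ip z z = 0")
      case True
      then have "ip v z = 0" using cauchy_schwarz[OF Cons.prems(6) TS[OF zT]] by (simp add: nm_def)
      with True show ?thesis by simp
    qed (simp add: s_def)
    define w where "w x = 1 *\<^sub>R w' x + s *\<^sub>R z x" for x
    have wT: "w \<in> T" unfolding w_def[abs_def] by (rule Cons.prems(3)[OF w'T zT])
    have "ip w Y = ip v Y" if Y: "Y \<in> T" for Y
    proof -
      \<comment> \<open>Chosen so that subtracting \<open>t\<close> times \<open>z\<close> puts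
        \<open>Y\<close> into the kernel \<open>T'\<close>.\<close>
      define t where "t = ip Y g / ip z g"
      define Y' where "Y' x = 1 *\<^sub>R Y x + (- t) *\<^sub>R z x" for x
      have Y'T: "Y' \<in> T" unfolding Y'_def[abs_def] by (rule Cons.prems(3)[OF Y zT])
      have "ip Y' g = 0"
        unfolding Y'_def[abs_def] using linear[OF TS[OF Y] TS[OF zT] gS, of 1 "- t"] zg by (simp add: t_def)
      then have Y': "Y' \<in> T'" using Y'T by (simp add: T'_def)
      have Yeq: "Y = (\<lambda>x. 1 *\<^sub>R Y' x + t *\<^sub>R z x)" by (auto simp: Y'_def)
      have exp: "ip k Y = ip k Y' + t * ip k z" if "k \<in> S" for k
        using linear_right[OF TS[OF Y'T] TS[OF zT] that, of 1 t] Yeq by simp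
      have wk: "ip w k = ip w' k + s * ip z k" if "k \<in> S" for k
        unfolding w_def[abs_def] using linear[OF TS[OF w'T] TS[OF zT] that, of 1 s] by simp
      have "ip w Y = ip w' Y' + s * ip z Y' + t * (ip w' z + s * ip z z)"
        using exp[OF TS[OF wT]] wk[OF TS[OF Y'T]] wk[OF TS[OF zT]] by simp
      also have "\<dots> = ip v Y' + t * ip v z"
        using w'(2)[OF Y'] orth[OF Y'] orth[OF w'(1)] s by (simp add: commute[of w' z])
      also have "\<dots> = ip v Y" using exp[OF Cons.prems(6)] by simp
      finally show ?thesis .
    qed
    then show ?thesis using wT by blast
  qed
qed

lemma P1_space_closed:
  fixes Y Z :: "real^'n \<Rightarrow> real^'m"
  assumes D: "open D" "bounded D" and Y: "Y \<in> P1_space D T" and Z: "Z \<in> P1_space D T"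
  shows "(\<lambda>x. a *\<^sub>R Y x + b *\<^sub>R Z x) \<in> P1_space D T"
proof -
  have "\<exists>A c. AE x in lebesgue_on K. a *\<^sub>R Y x + b *\<^sub>R Z x = A *v x + c" if K: "K \<in> T" for K
  proof -
    obtain A c where 1: "AE x in lebesgue_on K. Y x = A *v x + c" using Y K unfolding P1_space_def by blast
    obtain A' c' where 2: "AE x in lebesgue_on K. Z x = A' *v x + c'" using Z K unfolding P1_space_def by blast
    have "AE x in lebesgue_on K. a *\<^sub>R Y x + b *\<^sub>R Z x = (a *\<^sub>R A + b *\<^sub>R A') *v x + (a *\<^sub>R c + b *\<^sub>R c')"
      using 1 2 by eventually_elim
        (simp add: matrix_vector_mult_add_rdistrib scaleR_matrix_vector_assoc[symmetric] scaleR_add_right)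
    then show ?thesis by blast
  qed
  then show ?thesis
    using H1_linear_combination(1)[OF D] Y Z unfolding P1_space_def by blast
qed

text \<open>On a cell \<open>Y\<close> is affine, so |Y|^2 = Y . (A x + c) is there a combination of
  the products of \<open>Y\<close> with the constants and coordinate functions in each component,
  truncated to the cell. If \<open>Y\<close> is orthogonal to all of these, its L2 norm vanishes
  cell by cell. They are the list required by \<open>projection_exists\<close>.\<close>

lemma P1_space_determined:
  fixes D :: "(real^'n) set"
  assumes D: "open D" "bounded D" and T: "finite T" "\<And>K. K \<in> T \<Longrightarrow> closed K" "D \<subseteq> \<Union>T"
  obtains gs :: "(real^'n \<Rightarrow> real^'m) list" where "set gs \<subseteq> L2 D"
    "\<And>Y. Y \<in> P1_space D T \<Longrightarrow> (\<And>g. g \<in> set gs \<Longrightarrow> l2_inner D Y g = 0) \<Longrightarrow> l2_inner D Y Y = 0"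
proof -
  define g where "g K i x = (indicator K x :: real) *\<^sub>R axis i (1::real)" for K :: "(real^'n) set" and i :: 'm and x
  define g' where "g' K i j x = (indicator K x * x $ j) *\<^sub>R axis i (1::real)" for K and i :: 'm and j :: 'n and x
  let ?F = "(\<lambda>(K, i). g K i) ` (T \<times> UNIV) \<union> (\<lambda>(K, i, j). g' K i j) ` (T \<times> UNIV \<times> UNIV)"
  define F where "F = ?F"
  have "finite F" using T(1) by (simp add: F_def)
  then obtain gs where "set gs = F" using finite_list by blast
  then have gs: "set gs = ?F" by (simp only: F_def)
  obtain R where R: "\<And>x. x \<in> D \<Longrightarrow> norm x \<le> R" using D(2) bounded_iff by blast
  have Kb: "K \<in> sets borel" if "K \<in> T" for K using T(2)[OF that] by (rule borel_closed)
  have gL: "g K i \<in> L2 D" if K: "K \<in> T" for K i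
  proof (rule bounded_L2[OF D])
    show "g K i \<in> borel_measurable (lebesgue_on D)"
      unfolding g_def[abs_def] using Kb[OF K]
      by (intro borel_measurable_lebesgue_on borel_measurable_scaleR borel_measurable_indicator borel_measurable_const)
    show "AE x in lebesgue_on D. norm (g K i x) \<le> 1"
    proof (rule AE_I2)
      fix x show "norm (g K i x) \<le> 1" by (cases "x \<in> K") (simp_all add: g_def norm_axis_1)
    qed
  qed
  have g'L: "g' K i j \<in> L2 D" if K: "K \<in> T" for K i j
  proof (rule bounded_L2[OF D])
    have "(\<lambda>x::real^'n. x $ j) \<in> borel_measurable borel"
      by (rule borel_measurable_continuous_onI[OF linear_continuous_on[OF bounded_linear_vec_nth]])
    then show "g' K i j \<in> borel_measurable (lebesgue_on D)"
      unfolding g'_def[abs_def] using Kb[OF K]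
      by (intro borel_measurable_lebesgue_on borel_measurable_scaleR borel_measurable_times
          borel_measurable_indicator borel_measurable_const)
    show "AE x in lebesgue_on D. norm (g' K i j x) \<le> \<bar>R\<bar>"
    proof (rule AE_I2)
      fix x assume "x \<in> space (lebesgue_on D)"
      then have "\<bar>x $ j\<bar> \<le> \<bar>R\<bar>" using R[of x] component_le_norm_cart[of x j] by simp
      then show "norm (g' K i j x) \<le> \<bar>R\<bar>"
        by (simp add: g'_def norm_axis_1 indicator_def)
    qed
  qed
  show ?thesis
  proof (rule that)
    show "set gs \<subseteq> L2 D" unfolding gs using gL g'L by auto
    fix Y assume Y: "Y \<in> P1_space D T" and zero: "\<And>g. g \<in> set gs \<Longrightarrow> l2_inner D Y g = 0"
    have YL: "Y \<in> L2 D" using Y by (simp add: P1_space_def H1_L2)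
    have z1: "(LINT x|lebesgue_on D. Y x \<bullet> g K i x) = 0" if "K \<in> T" for K i
      using zero[of "g K i"] that unfolding gs l2_inner_def by auto
    have z2: "(LINT x|lebesgue_on D. Y x \<bullet> g' K i j x) = 0" if "K \<in> T" for K i j
      using zero[of "g' K i j"] that unfolding gs l2_inner_def by (force simp: image_iff)
    have Ysq: "(\<lambda>x. (norm (Y x))\<^sup>2) \<in> borel_measurable (lebesgue_on D)"
      using L2_square_integrable[OF YL] by auto
    have ind: "integrable (lebesgue_on D) (\<lambda>x. indicator K x * (norm (Y x))\<^sup>2)" if K: "K \<in> T" for K
    proof (rule Bochner_Integration.integrable_bound[OF L2_square_integrable[OF YL]])
      show "(\<lambda>x. indicator K x * (norm (Y x))\<^sup>2) \<in> borel_measurable (lebesgue_on D)"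
        using Kb[OF K] Ysq by (intro borel_measurable_times borel_measurable_lebesgue_on[OF borel_measurable_indicator])
    qed (auto simp: indicator_def)
    have null: "(LINT x|lebesgue_on D. indicator K x * (norm (Y x))\<^sup>2) = 0" if K: "K \<in> T" for K
    proof -
      obtain A c where Ac: "AE x in lebesgue_on K. Y x = A *v x + c" using Y K by (auto simp: P1_space_def)
      let ?k = "\<lambda>x. (\<Sum>i\<in>UNIV. \<Sum>j\<in>UNIV. A $ i $ j * (Y x \<bullet> g' K i j x)) + (\<Sum>i\<in>UNIV. c $ i * (Y x \<bullet> g K i x))"
      note int1 = L2_inner_integrable[OF YL gL[OF K]] and int2 = L2_inner_integrable[OF YL g'L[OF K]]
      have ki: "integrable (lebesgue_on D) ?k"
        using int1 int2 by (intro Bochner_Integration.integrable_add Bochner_Integration.integrable_sum integrable_mult_right)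
      have dotk: "indicator K x * (Y x \<bullet> (A *v x + c)) = ?k x" for x
      proof -
        have "Y x \<bullet> (A *v x + c) = (\<Sum>i\<in>UNIV. Y x $ i * ((\<Sum>j\<in>UNIV. A $ i $ j * x $ j) + c $ i))"
          by (simp add: inner_vec_def matrix_vector_mult_def)
        also have "indicator K x * \<dots> = (\<Sum>i\<in>UNIV. (\<Sum>j\<in>UNIV. A $ i $ j * (Y x $ i * (indicator K x * x $ j)))
            + c $ i * (Y x $ i * indicator K x))"
          by (simp add: sum_distrib_left distrib_left mult_ac)
        also have "\<dots> = ?k x"
          by (simp add: g_def g'_def inner_axis sum.distrib mult_ac)
        finally show ?thesis .
      qed
      have "AE x in lebesgue_on D. indicator K x * (norm (Y x))\<^sup>2 = ?k x"
      proof -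
        have Db: "D \<in> sets borel" using D(1) by simp
        have "AE x in lborel. x \<in> K \<longrightarrow> Y x = A *v x + c"
          using Ac unfolding AE_lebesgue_on_iff[OF Kb[OF K]] .
        then show ?thesis
          unfolding AE_lebesgue_on_iff[OF Db]
        proof eventually_elim
          fix x assume "x \<in> K \<longrightarrow> Y x = A *v x + c"
          then have "indicator K x * (norm (Y x))\<^sup>2 = indicator K x * (Y x \<bullet> (A *v x + c))"
            by (cases "x \<in> K") (simp_all add: power2_norm_eq_inner)
          then show "x \<in> D \<longrightarrow> indicator K x * (norm (Y x))\<^sup>2 = ?k x" using dotk by simp
        qed
      qed
      then have "(LINT x|lebesgue_on D. indicator K x * (norm (Y x))\<^sup>2) = (LINT x|lebesgue_on D. ?k x)"
        using ind[OF K] ki by (intro integral_cong_AE) auto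
      also have "\<dots> = (\<Sum>i\<in>UNIV. \<Sum>j\<in>UNIV. A $ i $ j * (LINT x|lebesgue_on D. Y x \<bullet> g' K i j x))
          + (\<Sum>i\<in>UNIV. c $ i * (LINT x|lebesgue_on D. Y x \<bullet> g K i x))"
        using int1 int2
        by (simp add: Bochner_Integration.integral_sum Bochner_Integration.integrable_sum)
      also have "\<dots> = 0" using z1[OF K] z2[OF K] by simp
      finally show ?thesis .
    qed
    \<comment> \<open>Cells may share boundary points, so the sum over the cells is only an upper
      bound; this suffices.\<close>
    have "(LINT x|lebesgue_on D. (norm (Y x))\<^sup>2) \<le> (LINT x|lebesgue_on D. (\<Sum>K\<in>T. indicator K x * (norm (Y x))\<^sup>2))"
    proof (rule integral_mono[OF L2_square_integrable[OF YL]])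
      show "integrable (lebesgue_on D) (\<lambda>x. \<Sum>K\<in>T. indicator K x * (norm (Y x))\<^sup>2)"
        using ind by (intro Bochner_Integration.integrable_sum)
      fix x assume "x \<in> space (lebesgue_on D)"
      then obtain K where K: "K \<in> T" "x \<in> K" using T(3) by auto
      have "(norm (Y x))\<^sup>2 = (\<Sum>K'\<in>{K}. indicator K' x * (norm (Y x))\<^sup>2)" using K by simp
      also have "\<dots> \<le> (\<Sum>K\<in>T. indicator K x * (norm (Y x))\<^sup>2)"
        using K T(1) by (intro sum_mono2) auto
      finally show "(norm (Y x))\<^sup>2 \<le> (\<Sum>K\<in>T. indicator K x * (norm (Y x))\<^sup>2)" .
    qed
    also have "\<dots> = (\<Sum>K\<in>T. LINT x|lebesgue_on D. indicator K x * (norm (Y x))\<^sup>2)"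
      by (rule Bochner_Integration.integral_sum[OF ind])
    also have "\<dots> = 0" using null by simp
    finally have "l2_inner D Y Y \<le> 0" by (simp add: l2_inner_def power2_norm_eq_inner)
    then show "l2_inner D Y Y = 0" using L2.nonneg[OF YL] by linarith
  qed
qed

section \<open>The forms of the coupled problem\<close>

lemma lipschitz_polytopal_domain_open_bounded:
  "lipschitz_polytopal_domain D \<Longrightarrow> open D \<and> bounded D"
  by (simp add: lipschitz_polytopal_domain_def lipschitz_domain_def)

lemma h1_norm_diff_le:
  fixes u v :: "real^'n \<Rightarrow> real^'m"
  assumes D: "open D" "bounded D" and uv: "u \<in> H1 D" "v \<in> H1 D"
  shows "h1_norm D (u - v) \<le> h1_norm D u + h1_norm D v"
proof -
  interpret semi_inner_space "H1 D" "h1_inner D :: (real^'n \<Rightarrow> real^'m) \<Rightarrow> _ \<Rightarrow> real"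
    by (rule semi_inner_space_H1[OF D])
  show ?thesis
    using nm_combination[OF uv, of 1 "- 1"] unfolding diff_eq h1_nm[OF D] by simp
qed

lemma AE_sym_grad_diff:
  assumes D: "open D" "bounded D" and uv: "u \<in> H1 D" "v \<in> H1 D"
  shows "AE x in lebesgue_on D. sym_grad D (u - v) x = (sym_grad D u - sym_grad D v) x"
  using grad_diff[OF assms] by eventually_elim (simp add: sym_grad_eq sym_part_diff)

lemma sym_grad_L2: "u \<in> H1 D \<Longrightarrow> sym_grad D u \<in> L2 D"
  unfolding sym_grad_eq by (intro bounded_linear_L2[OF bounded_linear_sym_part] grad_L2)

lemma l2_norm_sym_grad_le: "u \<in> H1 D \<Longrightarrow> l2_norm D (sym_grad D u) \<le> h1_norm D u"
proof -
  assume u: "u \<in> H1 D"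
  have "l2_norm D (sym_grad D u) \<le> 1 * l2_norm D (grad D u)"
    by (rule l2_norm_mono[OF grad_L2[OF u] sym_grad_L2[OF u]]) (simp_all add: sym_grad_eq sym_part_norm_le)
  then show ?thesis using l2_norm_grad_le_h1_norm[of D u] by simp
qed

lemma form_f_diff:
  assumes D: "open D" "bounded D" and "u \<in> H1 D" "v \<in> H1 D" "w \<in> H1 D"
  shows "form_f \<alpha> \<nu> D (u - v) w = form_f \<alpha> \<nu> D u w - form_f \<alpha> \<nu> D v w"
proof -
  have "l2_inner D (sym_grad D (u - v)) (sym_grad D w) = l2_inner D (sym_grad D u - sym_grad D v) (sym_grad D w)"
    using assms AE_sym_grad_diff[OF assms(1-4)]
    by (intro l2_inner_cong_AE sym_grad_L2 L2.closed_diff H1_diff) auto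
  also have "\<dots> = l2_inner D (sym_grad D u) (sym_grad D w) - l2_inner D (sym_grad D v) (sym_grad D w)"
    using assms by (intro L2.diff_left sym_grad_L2)
  finally have eq: "l2_inner D (sym_grad D (u - v)) (sym_grad D w)
      = l2_inner D (sym_grad D u) (sym_grad D w) - l2_inner D (sym_grad D v) (sym_grad D w)" .
  show ?thesis
    using assms by (simp add: form_f_def eq L2.diff_left H1_L2 right_diff_distrib)
qed

lemma form_f_bound:
  assumes "\<alpha> \<ge> 0" "\<nu> \<ge> 0" and u: "u \<in> H1 D" and w: "w \<in> H1 D"
  shows "\<bar>form_f \<alpha> \<nu> D u w\<bar> \<le> (\<alpha> + \<nu>) * (h1_norm D u * h1_norm D w)"
proof -
  have 1: "\<bar>l2_inner D u w\<bar> \<le> h1_norm D u * h1_norm D w"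
    by (rule order_trans[OF L2.cauchy_schwarz[OF H1_L2[OF u] H1_L2[OF w]]
          mult_mono[OF l2_norm_le_h1_norm l2_norm_le_h1_norm h1_norm_nonneg l2_norm_nonneg]])
  have 2: "\<bar>l2_inner D (sym_grad D u) (sym_grad D w)\<bar> \<le> h1_norm D u * h1_norm D w"
    by (rule order_trans[OF L2.cauchy_schwarz[OF sym_grad_L2[OF u] sym_grad_L2[OF w]]
          mult_mono[OF l2_norm_sym_grad_le[OF u] l2_norm_sym_grad_le[OF w] h1_norm_nonneg l2_norm_nonneg]])
  have "\<bar>form_f \<alpha> \<nu> D u w\<bar> \<le> \<bar>\<alpha> * l2_inner D u w\<bar> + \<bar>\<nu> * l2_inner D (sym_grad D u) (sym_grad D w)\<bar>"
    unfolding form_f_def by (rule abs_triangle_ineq)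
  also have "\<dots> \<le> \<alpha> * (h1_norm D u * h1_norm D w) + \<nu> * (h1_norm D u * h1_norm D w)"
    using mult_left_mono[OF 1 assms(1)] mult_left_mono[OF 2 assms(2)] assms(1,2)
    unfolding abs_mult by simp
  finally show ?thesis by (simp add: distrib_right)
qed

text \<open>The \<nu> / 2 is Korn's constant \<open>sqrt 2\<close> squared; the L2 part of the norm
  is supplied by \<alpha>.\<close>

lemma form_f_coercive:
  assumes D: "open D" "bounded D" and "\<alpha> > 0" "\<nu> > 0" and u: "u \<in> H10 D"
  shows "min \<alpha> (\<nu> / 2) * (h1_norm D u)\<^sup>2 \<le> form_f \<alpha> \<nu> D u u"
proof -
  have "(l2_norm D (grad D u))\<^sup>2 \<le> (sqrt 2 * l2_norm D (sym_grad D u))\<^sup>2"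
    by (rule power_mono[OF korn_H10[OF D u]]) simp
  then have k: "(l2_norm D (grad D u))\<^sup>2 / 2 \<le> (l2_norm D (sym_grad D u))\<^sup>2" by (simp add: power_mult_distrib)
  have "min \<alpha> (\<nu> / 2) * (h1_norm D u)\<^sup>2 = min \<alpha> (\<nu> / 2) * (l2_norm D (grad D u))\<^sup>2 + min \<alpha> (\<nu> / 2) * (l2_norm D u)\<^sup>2"
    by (simp add: h1_norm_square distrib_left)
  also have "\<dots> \<le> \<nu> / 2 * (l2_norm D (grad D u))\<^sup>2 + \<alpha> * (l2_norm D u)\<^sup>2"
    by (intro add_mono mult_right_mono) simp_all
  also have "\<dots> \<le> \<nu> * (l2_norm D (sym_grad D u))\<^sup>2 + \<alpha> * (l2_norm D u)\<^sup>2"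
    using mult_left_mono[OF k, of \<nu>] assms(4) by simp
  also have "\<dots> = form_f \<alpha> \<nu> D u u"
    using u by (simp add: form_f_def L2.nm_square[symmetric] H10_def H1_L2 sym_grad_L2)
  finally show ?thesis .
qed

lemma form_s_diff:
  assumes D: "open D" "bounded D" and "X \<in> H1 D" "Y \<in> H1 D" "Z \<in> H1 D"
  shows "form_s \<beta> \<gamma> D (X - Y) Z = form_s \<beta> \<gamma> D X Z - form_s \<beta> \<gamma> D Y Z"
proof -
  have "l2_inner D (grad D (X - Y)) (grad D Z) = l2_inner D (grad D X - grad D Y) (grad D Z)"
    using assms grad_diff[OF assms(1-4)]
    by (intro l2_inner_cong_AE grad_L2 L2.closed_diff H1_diff) auto
  also have "\<dots> = l2_inner D (grad D X) (grad D Z) - l2_inner D (grad D Y) (grad D Z)"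
    using assms by (intro L2.diff_left grad_L2)
  finally have eq: "l2_inner D (grad D (X - Y)) (grad D Z)
      = l2_inner D (grad D X) (grad D Z) - l2_inner D (grad D Y) (grad D Z)" .
  show ?thesis
    using assms by (simp add: form_s_def eq L2.diff_left H1_L2 right_diff_distrib)
qed

lemma form_s_bound:
  assumes "\<beta> \<ge> 0" "\<gamma> \<ge> 0" and u: "u \<in> H1 D" and w: "w \<in> H1 D"
  shows "\<bar>form_s \<beta> \<gamma> D u w\<bar> \<le> (\<beta> + \<gamma>) * (h1_norm D u * h1_norm D w)"
proof -
  have 1: "\<bar>l2_inner D u w\<bar> \<le> h1_norm D u * h1_norm D w"
    by (rule order_trans[OF L2.cauchy_schwarz[OF H1_L2[OF u] H1_L2[OF w]]
          mult_mono[OF l2_norm_le_h1_norm l2_norm_le_h1_norm h1_norm_nonneg l2_norm_nonneg]])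
  have 2: "\<bar>l2_inner D (grad D u) (grad D w)\<bar> \<le> h1_norm D u * h1_norm D w"
    by (rule order_trans[OF L2.cauchy_schwarz[OF grad_L2[OF u] grad_L2[OF w]]
          mult_mono[OF l2_norm_grad_le_h1_norm l2_norm_grad_le_h1_norm h1_norm_nonneg l2_norm_nonneg]])
  have "\<bar>form_s \<beta> \<gamma> D u w\<bar> \<le> \<bar>\<beta> * l2_inner D u w\<bar> + \<bar>\<gamma> * l2_inner D (grad D u) (grad D w)\<bar>"
    unfolding form_s_def by (rule abs_triangle_ineq)
  also have "\<dots> \<le> \<beta> * (h1_norm D u * h1_norm D w) + \<gamma> * (h1_norm D u * h1_norm D w)"
    using mult_left_mono[OF 1 assms(1)] mult_left_mono[OF 2 assms(2)] assms(1,2)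
    unfolding abs_mult by simp
  finally show ?thesis by (simp add: distrib_right)
qed

lemma form_s_coercive:
  assumes "\<beta> \<ge> 0" "X \<in> H1 D"
  shows "\<gamma> * (l2_norm D (grad D X))\<^sup>2 \<le> form_s \<beta> \<gamma> D X X"
  using assms L2.nonneg[OF H1_L2[OF assms(2)]]
  by (simp add: form_s_def L2.nm_square grad_L2)

section \<open>The divergence form\<close>

lemma bounded_linear_trace: "bounded_linear (trace :: real^'n^'n \<Rightarrow> real)"
  unfolding trace_def
  by (intro bounded_linear_sum bounded_linear_compose[OF bounded_linear_vec_nth bounded_linear_vec_nth])

lemma divergence_L2: "u \<in> H1 D \<Longrightarrow> divergence D u \<in> L2 D"
  unfolding divergence_def[abs_def] by (intro bounded_linear_L2[OF bounded_linear_trace] grad_L2)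

lemma divergence_diff:
  assumes D: "open D" "bounded D" and "u \<in> H1 D" "v \<in> H1 D" "q \<in> L2 D"
  shows "l2_inner D (divergence D (u - v)) q = l2_inner D (divergence D u) q - l2_inner D (divergence D v) q"
proof -
  have "AE x in lebesgue_on D. divergence D (u - v) x = (divergence D u - divergence D v) x"
    using grad_diff[OF assms(1-4)]
    by eventually_elim (simp add: divergence_def linear_diff[OF bounded_linear.linear[OF bounded_linear_trace]])
  then have "l2_inner D (divergence D (u - v)) q = l2_inner D (divergence D u - divergence D v) q"
    using assms by (intro l2_inner_cong_AE divergence_L2 L2.closed_diff H1_diff) auto
  also have "\<dots> = l2_inner D (divergence D u) q - l2_inner D (divergence D v) q"
    using assms by (intro L2.diff_left divergence_L2)
  finally show ?thesis .
qed

lemma divergence_bound: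
  fixes u :: "real^'n \<Rightarrow> real^'n"
  assumes u: "u \<in> H1 D" and q: "q \<in> L2 D"
  shows "\<bar>l2_inner D (divergence D u) q\<bar> \<le> real CARD('n) * (h1_norm D u * l2_norm D q)"
proof -
  have tr: "\<bar>trace A\<bar> \<le> real CARD('n) * norm A" for A :: "real^'n^'n"
  proof -
    have "\<bar>trace A\<bar> \<le> (\<Sum>i\<in>UNIV. \<bar>A $ i $ i\<bar>)" unfolding trace_def by (rule sum_abs)
    also have "\<dots> \<le> (\<Sum>i\<in>(UNIV :: 'n set). norm A)" by (intro sum_mono abs_entry_le_norm)
    finally show ?thesis by simp
  qed
  have "l2_norm D (divergence D u) \<le> real CARD('n) * l2_norm D (grad D u)"
    by (rule l2_norm_mono[OF grad_L2[OF u] divergence_L2[OF u]]) (simp_all add: divergence_def tr)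
  also have "\<dots> \<le> real CARD('n) * h1_norm D u"
    by (intro mult_left_mono l2_norm_grad_le_h1_norm) simp
  finally have "l2_norm D (divergence D u) * l2_norm D q \<le> real CARD('n) * h1_norm D u * l2_norm D q"
    by (rule mult_right_mono) simp
  then show ?thesis
    using L2.cauchy_schwarz[OF divergence_L2[OF u] q] by (simp add: mult.assoc)
qed

section \<open>Quasi-optimality\<close>

text \<open>The unknowns are the norms of the discrete errors: \<open>x\<close> of the velocity, \<open>s\<close> and \<open>y0\<close> of the
  gradient and the values of the displacement, \<open>z\<close> of the pressure and \<open>w\<close> of the multiplier.\<close>
lemma discrete_error_bound:
  fixes c1 c2 c3 c4 \<kappa> :: real
  assumes c: "c1 \<ge> 0" "c2 \<ge> 0" "c3 \<ge> 0" "c4 \<ge> 0" and \<kappa>: "\<kappa> > 0"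
  shows "\<exists>C\<ge>0. \<forall>x y z w s y0 \<delta>. 0 \<le> x \<longrightarrow> 0 \<le> s \<longrightarrow> 0 \<le> \<delta> \<longrightarrow> w \<le> c1 * (y + \<delta>) \<longrightarrow> z \<le> c2 * (x + w + \<delta>) \<longrightarrow>
    y0 \<le> c3 * (x + \<delta>) \<longrightarrow> y \<le> s + y0 \<longrightarrow> \<kappa> * (x\<^sup>2 + s\<^sup>2) \<le> c4 * (\<delta> * (x + y + z + w)) \<longrightarrow>
    x + y + z + w \<le> C * \<delta>"
proof -
  \<comment> \<open>The coefficients of t + \<delta> in the linear bounds for x, y, w and z, in this
    order.\<close>
  define A where "A = 1 + (1 + c3) + c1 * (2 + c3) + c2 * (1 + c1 * (2 + c3))"
  \<comment> \<open>The constant for which the energy inequality becomes t^2 <= D \<delta> (t +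
    \<delta>); the 2 comes from (x + s)^2 <= 2 (x^2 + s^2).\<close>
  define D where "D = 2 * c4 * A / \<kappa>"
  have A: "A \<ge> 0" using c by (simp add: A_def)
  have D: "D \<ge> 0" using c A \<kappa> by (simp add: D_def)
  have "x + y + z + w \<le> A * (D + 2) * \<delta>"
    if h: "0 \<le> x" "0 \<le> s" "0 \<le> \<delta>" "w \<le> c1 * (y + \<delta>)" "z \<le> c2 * (x + w + \<delta>)" "y0 \<le> c3 * (x + \<delta>)"
      "y \<le> s + y0" "\<kappa> * (x\<^sup>2 + s\<^sup>2) \<le> c4 * (\<delta> * (x + y + z + w))" for x y z w s y0 \<delta>
  proof -
    define t where "t = x + s"
    have t: "0 \<le> t" "x \<le> t" "s \<le> t" using h by (simp_all add: t_def)
    have "c3 * (x + \<delta>) \<le> c3 * (t + \<delta>)" using t c(3) by (intro mult_left_mono) auto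
    then have y: "y \<le> (1 + c3) * (t + \<delta>)" using h(3,6,7) t by (simp add: distrib_right)
    have "c1 * (y + \<delta>) \<le> c1 * ((2 + c3) * (t + \<delta>))"
      using y t h(3) c(1) by (intro mult_left_mono) (simp_all add: distrib_right)
    then have w: "w \<le> c1 * (2 + c3) * (t + \<delta>)" using h(4) by simp
    have "c2 * (x + w + \<delta>) \<le> c2 * ((1 + c1 * (2 + c3)) * (t + \<delta>))"
      using w t c(2) by (intro mult_left_mono) (simp_all add: distrib_right)
    then have z: "z \<le> c2 * (1 + c1 * (2 + c3)) * (t + \<delta>)" using h(5) by simp
    have sum: "x + y + z + w \<le> A * (t + \<delta>)"
    proof -
      have "A * (t + \<delta>) = (t + \<delta>) + (1 + c3) * (t + \<delta>) + c1 * (2 + c3) * (t + \<delta>) + c2 * (1 + c1 * (2 + c3)) * (t + \<delta>)"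
        by (simp add: A_def algebra_simps)
      then show ?thesis using y w z t(2) h(3) by linarith
    qed
    have "t\<^sup>2 \<le> 2 * (x\<^sup>2 + s\<^sup>2)"
      using sum_squares_bound[of x s] by (simp add: t_def power2_sum)
    also have "\<dots> \<le> 2 * (c4 * (\<delta> * (A * (t + \<delta>))) / \<kappa>)"
    proof -
      have "\<delta> * (x + y + z + w) \<le> \<delta> * (A * (t + \<delta>))" using sum h(3) by (rule mult_left_mono)
      then have "c4 * (\<delta> * (x + y + z + w)) \<le> c4 * (\<delta> * (A * (t + \<delta>)))" using c(4) by (rule mult_left_mono)
      then have "(x\<^sup>2 + s\<^sup>2) * \<kappa> \<le> c4 * (\<delta> * (A * (t + \<delta>)))" using h(8) by (simp add: mult.commute)
      then have "x\<^sup>2 + s\<^sup>2 \<le> c4 * (\<delta> * (A * (t + \<delta>))) / \<kappa>" by (simp only: pos_le_divide_eq[OF \<kappa>])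
      then show ?thesis by (rule mult_left_mono) simp
    qed
    also have "\<dots> = D * \<delta> * (t + \<delta>)" by (simp add: D_def)
    finally have q: "t * t \<le> D * \<delta> * (t + \<delta>)" by (simp add: power2_eq_square)
    \<comment> \<open>Otherwise D \<delta> (t + \<delta>) <= (D + 1) \<delta> t < t^2, which
      contradicts the quadratic inequality.\<close>
    have "t \<le> (D + 1) * \<delta>"
    proof (rule ccontr)
      assume "\<not> t \<le> (D + 1) * \<delta>"
      then have n: "(D + 1) * \<delta> < t" by simp
      have tpos: "t > 0" using n D h(3) by (smt (verit) mult_nonneg_nonneg)
      have 1: "(D + 1) * \<delta> * t < t * t" using n tpos by (rule mult_strict_right_mono)
      have "\<delta> * ((D + 1) * \<delta>) \<le> \<delta> * t" using n h(3) by (intro mult_left_mono) auto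
      moreover have "\<delta> * ((D + 1) * \<delta>) = D * \<delta> * \<delta> + \<delta> * \<delta>" by (simp add: algebra_simps)
      ultimately have "D * \<delta> * \<delta> \<le> \<delta> * t" using mult_nonneg_nonneg[OF h(3) h(3)] by linarith
      then have "D * \<delta> * (t + \<delta>) \<le> (D + 1) * \<delta> * t" by (simp add: algebra_simps)
      with 1 q show False by linarith
    qed
    then have "A * (t + \<delta>) \<le> A * ((D + 2) * \<delta>)" using A by (intro mult_left_mono) (simp_all add: algebra_simps)
    with sum show ?thesis by (simp add: mult.assoc)
  qed
  moreover have "0 \<le> A * (D + 2)" using A D by simp
  ultimately show ?thesis by blast
qed

lemma le_scaled_INF:
  fixes F :: "'a \<Rightarrow> real"
  assumes "S \<noteq> {}" "C \<ge> 0" "\<And>s. s \<in> S \<Longrightarrow> a \<le> C * F s"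
  shows "a \<le> C * (INF s\<in>S. F s)"
proof (cases "C = 0")
  case True
  then show ?thesis using assms by auto
next
  case False
  then have C: "C > 0" using assms(2) by simp
  have "a / C \<le> (INF s\<in>S. F s)"
    using assms(1,3) C by (intro cINF_greatest) (simp_all add: pos_divide_le_eq mult.commute)
  then show ?thesis using C by (simp add: pos_divide_le_eq mult.commute)
qed

text \<open>\<open>\<Lambda>\<close> is the multiplier space with norm \<open>nl\<close> and coupling form \<open>c\<close>. No lifting of the constraints is
  needed because the velocity form is coercive on all of \<open>H10 \<Omega>\<close>; only the values of the displacement
  are controlled through the discrete constraint, which is what \<open>control\<close> expresses.\<close>
locale coupled_discretization =
  fixes \<Omega> B :: "(real^'n) set" and X\<^sub>0 :: "real^'n \<Rightarrow> real^'n" and \<alpha> \<nu> \<beta> \<gamma> K \<beta>\<^sub>s \<kappa>\<^sub>s :: real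
    and V :: "(real^'n \<Rightarrow> real^'n) set" and Q :: "(real^'n \<Rightarrow> real) set" and S :: "(real^'n \<Rightarrow> real^'n) set"
    and c :: "'l::minus \<Rightarrow> (real^'n \<Rightarrow> real^'n) \<Rightarrow> real" and \<Lambda> \<Lambda>h :: "'l set" and nl :: "'l \<Rightarrow> real"
  assumes \<Omega>: "open \<Omega>" "bounded \<Omega>" and B: "open B" "bounded B"
    and coeffs: "\<alpha> > 0" "\<nu> > 0" "\<gamma> > 0" "\<beta> \<ge> 0"
    and K: "K \<ge> 0" "\<And>u :: real^'n \<Rightarrow> real^'n. u \<in> H10 \<Omega> \<Longrightarrow> u \<circ> X\<^sub>0 \<in> H1 B"
      "\<And>u :: real^'n \<Rightarrow> real^'n. u \<in> H10 \<Omega> \<Longrightarrow> h1_norm B (u \<circ> X\<^sub>0) \<le> K * h1_norm \<Omega> u"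
    and V: "V \<subseteq> H10 \<Omega>" "\<And>u v. u \<in> V \<Longrightarrow> v \<in> V \<Longrightarrow> u - v \<in> V"
    and Q: "Q \<subseteq> L2_zero_mean \<Omega>" "\<And>p q. p \<in> Q \<Longrightarrow> q \<in> Q \<Longrightarrow> p - q \<in> Q"
    and S: "S \<subseteq> H1 B" "\<And>Y Z. Y \<in> S \<Longrightarrow> Z \<in> S \<Longrightarrow> Y - Z \<in> S"
    and stokes: "\<beta>\<^sub>s > 0" "\<And>q. q \<in> Q \<Longrightarrow> \<beta>\<^sub>s * l2_norm \<Omega> q \<le> (SUP v\<in>V. l2_inner \<Omega> (divergence \<Omega> v) q / h1_norm \<Omega> v)"
    and c_diff: "\<And>l m Y. l \<in> \<Lambda> \<Longrightarrow> m \<in> \<Lambda> \<Longrightarrow> Y \<in> H1 B \<Longrightarrow> c (l - m) Y = c l Y - c m Y"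
    and c_diff_right: "\<And>l Y Z. l \<in> \<Lambda> \<Longrightarrow> Y \<in> H1 B \<Longrightarrow> Z \<in> H1 B \<Longrightarrow> c l (Y - Z) = c l Y - c l Z"
    and c_bound: "\<And>l Y. l \<in> \<Lambda> \<Longrightarrow> Y \<in> H1 B \<Longrightarrow> \<bar>c l Y\<bar> \<le> nl l * h1_norm B Y"
    and \<Lambda>: "\<And>l m. l \<in> \<Lambda> \<Longrightarrow> m \<in> \<Lambda> \<Longrightarrow> l - m \<in> \<Lambda>" "\<Lambda>h \<subseteq> \<Lambda>"
    and nl: "\<And>l. l \<in> \<Lambda> \<Longrightarrow> 0 \<le> nl l" "\<And>l m k. l \<in> \<Lambda> \<Longrightarrow> m \<in> \<Lambda> \<Longrightarrow> k \<in> \<Lambda> \<Longrightarrow> nl (l - k) \<le> nl (l - m) + nl (k - m)"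
    and inf_sup: "\<kappa>\<^sub>s \<ge> 0" "\<And>l m M. l \<in> \<Lambda>h \<Longrightarrow> m \<in> \<Lambda>h \<Longrightarrow> M \<ge> 0 \<Longrightarrow>
      (\<And>Z. Z \<in> S \<Longrightarrow> \<bar>c (l - m) Z\<bar> \<le> M * h1_norm B Z) \<Longrightarrow> nl (l - m) \<le> \<kappa>\<^sub>s * M"
    and control: "\<And>Y W. Y \<in> S \<Longrightarrow> W \<in> H1 B \<Longrightarrow> (\<And>m. m \<in> \<Lambda>h \<Longrightarrow> c m Y = c m W) \<Longrightarrow> l2_norm B Y \<le> h1_norm B W"
begin

lemma V_H1: "v \<in> V \<Longrightarrow> v \<in> H1 \<Omega>" "v \<in> V \<Longrightarrow> v \<in> H10 \<Omega>"
  using V(1) by (auto simp: H10_def)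

lemma Q_L2: "q \<in> Q \<Longrightarrow> q \<in> L2 \<Omega>" "q \<in> Q \<Longrightarrow> q \<in> L2_zero_mean \<Omega>"
  using Q(1) by (auto simp: L2_zero_mean_def)

text \<open>Where the norm of \<open>v\<close> vanishes the quotient is 0 by the convention on
  division and is covered by \<open>M \<ge> 0\<close>. The supremum of an empty set of reals would
  be unspecified, hence the assumption on \<open>V\<close>.\<close>

lemma pressure_bound:
  assumes q: "q \<in> Q" and M: "M \<ge> 0" and ne: "V \<noteq> {}"
    and b: "\<And>v. v \<in> V \<Longrightarrow> l2_inner \<Omega> (divergence \<Omega> v) q \<le> M * h1_norm \<Omega> v"
  shows "l2_norm \<Omega> q \<le> M / \<beta>\<^sub>s"
proof -
  have "(SUP v\<in>V. l2_inner \<Omega> (divergence \<Omega> v) q / h1_norm \<Omega> v) \<le> M"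
  proof (rule cSUP_least[OF ne])
    fix v assume v: "v \<in> V"
    show "l2_inner \<Omega> (divergence \<Omega> v) q / h1_norm \<Omega> v \<le> M"
    proof (cases "h1_norm \<Omega> v = 0")
      case False
      then have "h1_norm \<Omega> v > 0" using h1_norm_nonneg[of \<Omega> v] by linarith
      then show ?thesis using b[OF v] by (simp add: pos_divide_le_eq)
    qed (simp add: M)
  qed
  then have "\<beta>\<^sub>s * l2_norm \<Omega> q \<le> M" using stokes(2)[OF q] by linarith
  then show ?thesis using stokes(1) by (simp add: pos_le_divide_eq mult.commute)
qed

text \<open>The differences between the discrete solution and arbitrary discrete approximants are
  admissible test functions or, for the multiplier, accessible to \<open>inf_sup\<close>. The first
  four conclusions, together with \<delta> >= 0, are the hypotheses that
  \<open>discrete_error_bound\<close> requires; the last one returns to the true errors by the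
  triangle inequality.\<close>

lemma discrete_estimates:
  assumes sol: "fsi_solution \<alpha> \<nu> \<beta> \<gamma> \<Omega> B X\<^sub>0 c (H10 \<Omega>) (L2_zero_mean \<Omega>) (H1 B) \<Lambda> f g d (u, p, X, l)"
    and solh: "fsi_solution \<alpha> \<nu> \<beta> \<gamma> \<Omega> B X\<^sub>0 c V Q S \<Lambda>h f g d (uh, ph, Xh, lh)"
    and v: "v \<in> V" and q: "q \<in> Q" and Y: "Y \<in> S" and m: "m \<in> \<Lambda>h"
  defines "x \<equiv> h1_norm \<Omega> (uh - v)" and "y \<equiv> h1_norm B (Xh - Y)" and "z \<equiv> l2_norm \<Omega> (ph - q)" and "w \<equiv> nl (lh - m)"
    and "s \<equiv> l2_norm B (grad B (Xh - Y))" and "y0 \<equiv> l2_norm B (Xh - Y)"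
    and "\<delta> \<equiv> h1_norm \<Omega> (u - v) + l2_norm \<Omega> (p - q) + h1_norm B (X - Y) + nl (l - m)"
  shows "w \<le> \<kappa>\<^sub>s * (\<beta> + \<gamma> + 1) * (y + \<delta>)"
    and "z \<le> (\<alpha> + \<nu> + K + real CARD('n)) / \<beta>\<^sub>s * (x + w + \<delta>)"
    and "y0 \<le> (K + 1) * (x + \<delta>)"
    and "min (min \<alpha> (\<nu> / 2)) \<gamma> * (x\<^sup>2 + s\<^sup>2) \<le> (\<alpha> + \<nu> + \<beta> + \<gamma> + real CARD('n) + K + 1) * (\<delta> * (x + y + z + w))"
    and "0 \<le> \<delta>" and "0 \<le> w"
    and "h1_norm \<Omega> (u - uh) + l2_norm \<Omega> (p - ph) + h1_norm B (X - Xh) + nl (l - lh) \<le> \<delta> + (x + y + z + w)"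
proof -
  have mem: "u \<in> H10 \<Omega>" "p \<in> L2_zero_mean \<Omega>" "X \<in> H1 B" "l \<in> \<Lambda>"
    and e1: "\<And>t. t \<in> H10 \<Omega> \<Longrightarrow> form_f \<alpha> \<nu> \<Omega> u t - l2_inner \<Omega> (divergence \<Omega> t) p + c l (t \<circ> X\<^sub>0) = l2_inner \<Omega> f t"
    and e2: "\<And>t. t \<in> L2_zero_mean \<Omega> \<Longrightarrow> l2_inner \<Omega> (divergence \<Omega> u) t = 0"
    and e3: "\<And>Z. Z \<in> H1 B \<Longrightarrow> form_s \<beta> \<gamma> B X Z - c l Z = l2_inner B g Z"
    and e4: "\<And>k. k \<in> \<Lambda> \<Longrightarrow> c k ((u \<circ> X\<^sub>0) - X) = c k d"
    using sol by (auto simp: fsi_solution_def)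
  have memh: "uh \<in> V" "ph \<in> Q" "Xh \<in> S" "lh \<in> \<Lambda>h"
    and h1: "\<And>t. t \<in> V \<Longrightarrow> form_f \<alpha> \<nu> \<Omega> uh t - l2_inner \<Omega> (divergence \<Omega> t) ph + c lh (t \<circ> X\<^sub>0) = l2_inner \<Omega> f t"
    and h2: "\<And>t. t \<in> Q \<Longrightarrow> l2_inner \<Omega> (divergence \<Omega> uh) t = 0"
    and h3: "\<And>Z. Z \<in> S \<Longrightarrow> form_s \<beta> \<gamma> B Xh Z - c lh Z = l2_inner B g Z"
    and h4: "\<And>k. k \<in> \<Lambda>h \<Longrightarrow> c k ((uh \<circ> X\<^sub>0) - Xh) = c k d"
    using solh by (auto simp: fsi_solution_def)
  have H: "u \<in> H1 \<Omega>" "p \<in> L2 \<Omega>" "v \<in> H1 \<Omega>" "uh \<in> H1 \<Omega>" "q \<in> L2 \<Omega>" "ph \<in> L2 \<Omega>" "Y \<in> H1 B" "Xh \<in> H1 B"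
    "m \<in> \<Lambda>" "lh \<in> \<Lambda>" "v \<in> H10 \<Omega>" "uh \<in> H10 \<Omega>"
    using mem memh V_H1 v Q_L2 q S(1) Y \<Lambda>(2) m by (auto simp: H10_def L2_zero_mean_def)
  have Eu: "uh - v \<in> V" and Ep: "ph - q \<in> Q" and EX: "Xh - Y \<in> S"
    using V(2)[OF memh(1) v] Q(2)[OF memh(2) q] S(2)[OF memh(3) Y] by auto
  have Eu': "uh - v \<in> H10 \<Omega>" "uh - v \<in> H1 \<Omega>" and Ep': "ph - q \<in> L2 \<Omega>" "ph - q \<in> L2_zero_mean \<Omega>" and EX': "Xh - Y \<in> H1 B"
    using V_H1[OF Eu] Q_L2[OF Ep] EX S(1) by auto
  have El: "lh - m \<in> \<Lambda>" "l - m \<in> \<Lambda>" "l - lh \<in> \<Lambda>" using \<Lambda>(1) H(9,10) mem(4) by auto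
  have du: "u - v \<in> H10 \<Omega>" "u - v \<in> H1 \<Omega>"
    using H10_diff[OF \<Omega> mem(1) H(11)] by (auto simp: H10_def)
  have dX: "X - Y \<in> H1 B" by (rule H1_diff[OF B mem(3) H(7)])
  have dp: "p - q \<in> L2 \<Omega>" by (rule L2.closed_diff[OF H(2,5)])
  define U where "U = h1_norm \<Omega> (u - v)"
  define P where "P = l2_norm \<Omega> (p - q)"
  define W where "W = h1_norm B (X - Y)"
  define N where "N = nl (l - m)"
  have nn: "0 \<le> U" "0 \<le> P" "0 \<le> W" "0 \<le> N" "0 \<le> x" "0 \<le> y" "0 \<le> z" "0 \<le> w" "0 \<le> s"
    unfolding U_def P_def W_def N_def x_def y_def z_def w_def s_def using nl(1) El by simp_all
  have \<delta>: "\<delta> = U + P + W + N" by (simp add: \<delta>_def U_def P_def W_def N_def)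
  then have le\<delta>: "U \<le> \<delta>" "P \<le> \<delta>" "W \<le> \<delta>" "N \<le> \<delta>" "0 \<le> \<delta>" using nn by auto
  show "0 \<le> \<delta>" "0 \<le> w" by (fact le\<delta>(5), fact nn(8))
  have co: "(t \<circ> X\<^sub>0) - (r \<circ> X\<^sub>0) = (t - r) \<circ> X\<^sub>0" for t r :: "real^'n \<Rightarrow> real^'n" by (rule ext) simp
  \<comment> \<open>Galerkin orthogonality, arranged so that discrete errors stand on the left and
    approximation errors on the right; \<open>eqB\<close> does the same for the structure.\<close>
  have eqA: "form_f \<alpha> \<nu> \<Omega> (uh - v) t - l2_inner \<Omega> (divergence \<Omega> t) (ph - q) + c (lh - m) (t \<circ> X\<^sub>0)
      = form_f \<alpha> \<nu> \<Omega> (u - v) t - l2_inner \<Omega> (divergence \<Omega> t) (p - q) + c (l - m) (t \<circ> X\<^sub>0)" if t: "t \<in> V" for t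
  proof -
    have t': "t \<in> H10 \<Omega>" "t \<in> H1 \<Omega>" "t \<circ> X\<^sub>0 \<in> H1 B" using V_H1[OF t] K(2) by auto
    have "form_f \<alpha> \<nu> \<Omega> (uh - v) t = form_f \<alpha> \<nu> \<Omega> uh t - form_f \<alpha> \<nu> \<Omega> v t"
      "form_f \<alpha> \<nu> \<Omega> (u - v) t = form_f \<alpha> \<nu> \<Omega> u t - form_f \<alpha> \<nu> \<Omega> v t"
      using form_f_diff[OF \<Omega>] H t' by auto
    moreover have "l2_inner \<Omega> (divergence \<Omega> t) (ph - q) = l2_inner \<Omega> (divergence \<Omega> t) ph - l2_inner \<Omega> (divergence \<Omega> t) q"
      "l2_inner \<Omega> (divergence \<Omega> t) (p - q) = l2_inner \<Omega> (divergence \<Omega> t) p - l2_inner \<Omega> (divergence \<Omega> t) q"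
      using H t' by (simp_all add: L2.diff_right divergence_L2)
    moreover have "c (lh - m) (t \<circ> X\<^sub>0) = c lh (t \<circ> X\<^sub>0) - c m (t \<circ> X\<^sub>0)" "c (l - m) (t \<circ> X\<^sub>0) = c l (t \<circ> X\<^sub>0) - c m (t \<circ> X\<^sub>0)"
      using c_diff H mem t' by auto
    ultimately show ?thesis using e1[OF t'(1)] h1[OF t] by linarith
  qed
  have eqB: "form_s \<beta> \<gamma> B (Xh - Y) Z - c (lh - m) Z = form_s \<beta> \<gamma> B (X - Y) Z - c (l - m) Z" if Z: "Z \<in> S" for Z
  proof -
    have Z': "Z \<in> H1 B" using Z S(1) by auto
    have "form_s \<beta> \<gamma> B (Xh - Y) Z = form_s \<beta> \<gamma> B Xh Z - form_s \<beta> \<gamma> B Y Z"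
      "form_s \<beta> \<gamma> B (X - Y) Z = form_s \<beta> \<gamma> B X Z - form_s \<beta> \<gamma> B Y Z"
      using form_s_diff[OF B] H mem Z' by auto
    moreover have "c (lh - m) Z = c lh Z - c m Z" "c (l - m) Z = c l Z - c m Z" using c_diff H mem Z' by auto
    ultimately show ?thesis using e3[OF Z'] h3[OF Z] by linarith
  qed
  \<comment> \<open>The approximants \<open>v\<close> and \<open>Y\<close> need not satisfy the
    coupling constraint. \<open>R\<close> is the resulting residual, of the order of the
    approximation error.\<close>
  define R where "R = ((u - v) \<circ> X\<^sub>0) - (X - Y)"
  have R: "R \<in> H1 B" unfolding R_def by (rule H1_diff[OF B K(2)[OF du(1)] dX])
  have EuX: "(uh - v) \<circ> X\<^sub>0 \<in> H1 B" by (rule K(2)[OF Eu'(1)])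
  have eqC: "c k (Xh - Y) = c k ((uh - v) \<circ> X\<^sub>0) - c k R" if k: "k \<in> \<Lambda>h" for k
  proof -
    have k': "k \<in> \<Lambda>" using k \<Lambda>(2) by auto
    note K2 = K(2)[OF mem(1)] K(2)[OF H(11)] K(2)[OF H(12)]
    have "c k (u \<circ> X\<^sub>0) - c k X = c k (uh \<circ> X\<^sub>0) - c k Xh"
      using e4[OF k'] h4[OF k] c_diff_right[OF k' K2(1) mem(3)] c_diff_right[OF k' K2(3) H(8)] by linarith
    moreover have "c k ((uh - v) \<circ> X\<^sub>0) = c k (uh \<circ> X\<^sub>0) - c k (v \<circ> X\<^sub>0)"
      unfolding co[symmetric] by (rule c_diff_right[OF k' K2(3,2)])
    moreover have "c k R = c k ((u - v) \<circ> X\<^sub>0) - c k (X - Y)"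
      unfolding R_def by (rule c_diff_right[OF k' K(2)[OF du(1)] dX])
    moreover have "c k ((u - v) \<circ> X\<^sub>0) = c k (u \<circ> X\<^sub>0) - c k (v \<circ> X\<^sub>0)"
      unfolding co[symmetric] by (rule c_diff_right[OF k' K2(1,2)])
    moreover have "c k (X - Y) = c k X - c k Y" by (rule c_diff_right[OF k' mem(3) H(7)])
    moreover have "c k (Xh - Y) = c k Xh - c k Y" by (rule c_diff_right[OF k' H(8,7)])
    ultimately show ?thesis by linarith
  qed
  have hR: "h1_norm B R \<le> (K + 1) * \<delta>"
  proof -
    have "h1_norm B R \<le> h1_norm B ((u - v) \<circ> X\<^sub>0) + W"
      unfolding R_def W_def by (rule h1_norm_diff_le[OF B K(2)[OF du(1)] dX])
    also have "\<dots> \<le> K * U + W" using K(3)[OF du(1)] by (simp add: U_def)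
    also have "\<dots> \<le> K * \<delta> + \<delta>" using le\<delta> K(1) by (intro add_mono mult_left_mono) auto
    finally show ?thesis by (simp add: distrib_right)
  qed
  have hEuX: "h1_norm B ((uh - v) \<circ> X\<^sub>0) \<le> K * x" using K(3)[OF Eu'(1)] by (simp add: x_def)
  \<comment> \<open>The structure equation bounds the multiplier error on all of \<open>S\<close>;
    the inf-sup condition turns this into a norm bound.\<close>
  show "w \<le> \<kappa>\<^sub>s * (\<beta> + \<gamma> + 1) * (y + \<delta>)"
  proof -
    define M where "M = (\<beta> + \<gamma> + 1) * (y + \<delta>)"
    have M: "M \<ge> 0" using coeffs nn le\<delta> by (simp add: M_def)
    have "\<bar>c (lh - m) Z\<bar> \<le> M * h1_norm B Z" if Z: "Z \<in> S" for Z
    proof -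
      have Z': "Z \<in> H1 B" using Z S(1) by auto
      have "\<bar>form_s \<beta> \<gamma> B (Xh - Y) Z\<bar> \<le> (\<beta> + \<gamma>) * (y * h1_norm B Z)"
        unfolding y_def using coeffs by (intro form_s_bound EX' Z') auto
      moreover have "\<bar>form_s \<beta> \<gamma> B (X - Y) Z\<bar> \<le> (\<beta> + \<gamma>) * (W * h1_norm B Z)"
        unfolding W_def using coeffs by (intro form_s_bound dX Z') auto
      moreover have "(\<beta> + \<gamma>) * (W * h1_norm B Z) \<le> (\<beta> + \<gamma>) * (\<delta> * h1_norm B Z)"
        using le\<delta>(3) coeffs by (intro mult_left_mono mult_right_mono) auto
      moreover have "\<bar>c (l - m) Z\<bar> \<le> N * h1_norm B Z" unfolding N_def by (rule c_bound[OF El(2) Z'])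
      moreover have "N * h1_norm B Z \<le> (y + \<delta>) * h1_norm B Z"
        using le\<delta>(4) nn(6) by (intro mult_right_mono) auto
      moreover have "M * h1_norm B Z = (\<beta> + \<gamma>) * (y * h1_norm B Z) + (\<beta> + \<gamma>) * (\<delta> * h1_norm B Z) + (y + \<delta>) * h1_norm B Z"
        by (simp add: M_def algebra_simps)
      ultimately show ?thesis using eqB[OF Z] by linarith
    qed
    from inf_sup(2)[OF memh(4) m M this] show ?thesis by (simp add: w_def M_def mult.assoc)
  qed
  \<comment> \<open>The velocity equation bounds the divergence pairing by the velocity and
    multiplier errors, and Stokes stability applies.\<close>
  show "z \<le> (\<alpha> + \<nu> + K + real CARD('n)) / \<beta>\<^sub>s * (x + w + \<delta>)"
  proof -
    define M where "M = (\<alpha> + \<nu> + K + real CARD('n)) * (x + w + \<delta>)"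
    have M: "M \<ge> 0" using coeffs nn le\<delta> K(1) by (simp add: M_def)
    have "l2_inner \<Omega> (divergence \<Omega> t) (ph - q) \<le> M * h1_norm \<Omega> t" if t: "t \<in> V" for t
    proof -
      let ?t = "h1_norm \<Omega> t"
      have t': "t \<in> H10 \<Omega>" "t \<in> H1 \<Omega>" "t \<circ> X\<^sub>0 \<in> H1 B" using V_H1[OF t] K(2) by auto
      have "\<bar>form_f \<alpha> \<nu> \<Omega> (uh - v) t\<bar> \<le> (\<alpha> + \<nu>) * (x * ?t)"
        unfolding x_def using coeffs by (intro form_f_bound Eu' t') auto
      moreover have "\<bar>form_f \<alpha> \<nu> \<Omega> (u - v) t\<bar> \<le> (\<alpha> + \<nu>) * (U * ?t)"
        unfolding U_def using coeffs by (intro form_f_bound du t') auto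
      moreover have "(\<alpha> + \<nu>) * (U * ?t) \<le> (\<alpha> + \<nu>) * (\<delta> * ?t)"
        using le\<delta>(1) coeffs by (intro mult_left_mono mult_right_mono) auto
      moreover have "\<bar>l2_inner \<Omega> (divergence \<Omega> t) (p - q)\<bar> \<le> real CARD('n) * (?t * P)"
        unfolding P_def by (rule divergence_bound[OF t'(2) dp])
      moreover have "real CARD('n) * (?t * P) \<le> real CARD('n) * (?t * \<delta>)"
        using le\<delta>(2) by (intro mult_left_mono) auto
      moreover have "\<bar>c (lh - m) (t \<circ> X\<^sub>0)\<bar> \<le> w * (K * ?t)"
        using order_trans[OF c_bound[OF El(1) t'(3)] mult_left_mono[OF K(3)[OF t'(1)] nn(8)[unfolded w_def]]] by (simp add: w_def)
      moreover have "\<bar>c (l - m) (t \<circ> X\<^sub>0)\<bar> \<le> N * (K * ?t)"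
        using order_trans[OF c_bound[OF El(2) t'(3)] mult_left_mono[OF K(3)[OF t'(1)] nn(4)[unfolded N_def]]] by (simp add: N_def)
      moreover have "N * (K * ?t) \<le> \<delta> * (K * ?t)"
        using le\<delta>(4) K(1) by (intro mult_right_mono) auto
      \<comment> \<open>The bracket added at the end is slack: of the products in \<open>M\<close>
        only the preceding ones occur in the estimate.\<close>
      moreover have "M * ?t = (\<alpha> + \<nu>) * (x * ?t) + (\<alpha> + \<nu>) * (\<delta> * ?t) + real CARD('n) * (?t * \<delta>) + w * (K * ?t) + \<delta> * (K * ?t)
          + ((\<alpha> + \<nu>) * (w * ?t) + real CARD('n) * ((x + w) * ?t) + K * (x * ?t))"
        by (simp add: M_def algebra_simps)
      moreover have "0 \<le> (\<alpha> + \<nu>) * (w * ?t) + real CARD('n) * ((x + w) * ?t) + K * (x * ?t)"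
        using coeffs nn K(1) by simp
      ultimately show ?thesis using eqA[OF t] by linarith
    qed
    then have "z \<le> M / \<beta>\<^sub>s" unfolding z_def by (intro pressure_bound[OF Ep M]) (use v in auto)
    then show ?thesis by (simp add: M_def)
  qed
  \<comment> \<open>By \<open>eqC\<close> the displacement error pairs with every discrete
    multiplier exactly as the velocity trace minus \<open>R\<close> does, which is the premise of
    \<open>control\<close>.\<close>
  show "y0 \<le> (K + 1) * (x + \<delta>)"
  proof -
    let ?W = "((uh - v) \<circ> X\<^sub>0) - R"
    have W': "?W \<in> H1 B" by (rule H1_diff[OF B EuX R])
    have "y0 \<le> h1_norm B ?W"
      unfolding y0_def
    proof (rule control[OF EX W'])
      fix k assume k: "k \<in> \<Lambda>h"
      then have "k \<in> \<Lambda>" using \<Lambda>(2) by auto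
      then show "c k (Xh - Y) = c k ?W" using eqC[OF k] c_diff_right[OF _ EuX R] by simp
    qed
    also have "h1_norm B ?W \<le> h1_norm B ((uh - v) \<circ> X\<^sub>0) + h1_norm B R"
      by (rule h1_norm_diff_le[OF B EuX R])
    also have "\<dots> \<le> K * x + (K + 1) * \<delta>" using hEuX hR by linarith
    also have "\<dots> \<le> (K + 1) * (x + \<delta>)" using nn(5) by (simp add: algebra_simps)
    finally show ?thesis .
  qed
  show "min (min \<alpha> (\<nu> / 2)) \<gamma> * (x\<^sup>2 + s\<^sup>2) \<le> (\<alpha> + \<nu> + \<beta> + \<gamma> + real CARD('n) + K + 1) * (\<delta> * (x + y + z + w))"
  proof -
    have "min (min \<alpha> (\<nu> / 2)) \<gamma> * (x\<^sup>2 + s\<^sup>2) = min (min \<alpha> (\<nu> / 2)) \<gamma> * x\<^sup>2 + min (min \<alpha> (\<nu> / 2)) \<gamma> * s\<^sup>2"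
      by (rule distrib_left)
    also have "\<dots> \<le> min \<alpha> (\<nu> / 2) * x\<^sup>2 + \<gamma> * s\<^sup>2"      by (rule add_mono[OF mult_right_mono[OF min.cobounded1] mult_right_mono[OF min.cobounded2]]) simp_all
    also have "\<dots> \<le> form_f \<alpha> \<nu> \<Omega> (uh - v) (uh - v) + form_s \<beta> \<gamma> B (Xh - Y) (Xh - Y)"
      unfolding x_def s_def
      by (intro add_mono form_f_coercive[OF \<Omega> coeffs(1,2) Eu'(1)] form_s_coercive[OF coeffs(4) EX'])
    finally have coer: "min (min \<alpha> (\<nu> / 2)) \<gamma> * (x\<^sup>2 + s\<^sup>2)
      \<le> form_f \<alpha> \<nu> \<Omega> (uh - v) (uh - v) + form_s \<beta> \<gamma> B (Xh - Y) (Xh - Y)" .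
    \<comment> \<open>Tested with the discrete pressure error, the divergences of \<open>u\<close>
      and \<open>uh\<close> both vanish, so \<open>uh\<close> may be exchanged for \<open>u\<close>.
      The remaining term is small because of \<open>u - v\<close>.\<close>
    have div: "l2_inner \<Omega> (divergence \<Omega> (uh - v)) (ph - q) = l2_inner \<Omega> (divergence \<Omega> (u - v)) (ph - q)"
      using divergence_diff[OF \<Omega> H(4) H(3) Ep'(1)] divergence_diff[OF \<Omega> H(1) H(3) Ep'(1)] e2[OF Ep'(2)] h2[OF Ep] by linarith
    \<comment> \<open>The constraint is used for \<open>lh\<close> and \<open>m\<close> separately,
      because \<open>\<Lambda>h\<close> is not assumed closed under differences.\<close>
    have cE: "c (lh - m) (Xh - Y) = c (lh - m) ((uh - v) \<circ> X\<^sub>0) - c (lh - m) R"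
      using eqC[OF memh(4)] eqC[OF m] c_diff[OF H(10) H(9) EX'] c_diff[OF H(10) H(9) EuX] c_diff[OF H(10) H(9) R] by linarith
    \<comment> \<open>Testing both equations with the discrete errors cancels the multiplier error
      except for its pairing with the residual \<open>R\<close>; every remaining term contains an
      approximation error.\<close>
    have energy: "form_f \<alpha> \<nu> \<Omega> (uh - v) (uh - v) + form_s \<beta> \<gamma> B (Xh - Y) (Xh - Y)
      = l2_inner \<Omega> (divergence \<Omega> (u - v)) (ph - q) - c (lh - m) R
        + form_f \<alpha> \<nu> \<Omega> (u - v) (uh - v) - l2_inner \<Omega> (divergence \<Omega> (uh - v)) (p - q) + c (l - m) ((uh - v) \<circ> X\<^sub>0)
        + form_s \<beta> \<gamma> B (X - Y) (Xh - Y) - c (l - m) (Xh - Y)"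
      using eqA[OF Eu] eqB[OF EX] cE div by linarith
    have a0: "\<bar>l2_inner \<Omega> (divergence \<Omega> (u - v)) (ph - q)\<bar> \<le> real CARD('n) * (U * z)"
      unfolding U_def z_def by (rule divergence_bound[OF du(2) Ep'(1)])
    have a1: "real CARD('n) * (U * z) \<le> real CARD('n) * (\<delta> * z)" using le\<delta> nn by (intro mult_left_mono mult_right_mono) auto
    have a2: "\<bar>c (lh - m) R\<bar> \<le> w * ((K + 1) * \<delta>)"
      using order_trans[OF c_bound[OF El(1) R] mult_left_mono[OF hR nn(8)[unfolded w_def]]] by (simp add: w_def)
    have a3: "\<bar>form_f \<alpha> \<nu> \<Omega> (u - v) (uh - v)\<bar> \<le> (\<alpha> + \<nu>) * (U * x)"
      unfolding U_def x_def using coeffs by (intro form_f_bound du Eu') auto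
    have a4: "(\<alpha> + \<nu>) * (U * x) \<le> (\<alpha> + \<nu>) * (\<delta> * x)"
      using le\<delta> nn coeffs by (intro mult_left_mono mult_right_mono) auto
    have a5: "\<bar>l2_inner \<Omega> (divergence \<Omega> (uh - v)) (p - q)\<bar> \<le> real CARD('n) * (x * P)"
      unfolding P_def x_def by (rule divergence_bound[OF Eu'(2) dp])
    have a6: "real CARD('n) * (x * P) \<le> real CARD('n) * (x * \<delta>)" using le\<delta> nn by (intro mult_left_mono) auto
    have a7: "\<bar>c (l - m) ((uh - v) \<circ> X\<^sub>0)\<bar> \<le> N * (K * x)"
      using order_trans[OF c_bound[OF El(2) EuX] mult_left_mono[OF hEuX nn(4)[unfolded N_def]]] by (simp add: N_def)
    have a8: "N * (K * x) \<le> \<delta> * (K * x)" using le\<delta> nn K(1) by (intro mult_right_mono) auto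
    have a9: "\<bar>form_s \<beta> \<gamma> B (X - Y) (Xh - Y)\<bar> \<le> (\<beta> + \<gamma>) * (W * y)"
      unfolding W_def y_def using coeffs by (intro form_s_bound dX EX') auto
    have a10: "(\<beta> + \<gamma>) * (W * y) \<le> (\<beta> + \<gamma>) * (\<delta> * y)"
      using le\<delta> nn coeffs by (intro mult_left_mono mult_right_mono) auto
    have a11: "\<bar>c (l - m) (Xh - Y)\<bar> \<le> N * y" unfolding N_def y_def by (rule c_bound[OF El(2) EX'])
    have a12: "N * y \<le> \<delta> * y" using le\<delta> nn by (intro mult_right_mono) auto
    \<comment> \<open>After sorting by the products of \<delta> with x, y, z and w, each coefficient
      is at most the sum of all the constants.\<close>
    have a13: "real CARD('n) * (\<delta> * z) + w * ((K + 1) * \<delta>) + (\<alpha> + \<nu>) * (\<delta> * x) + real CARD('n) * (x * \<delta>) + \<delta> * (K * x) + (\<beta> + \<gamma>) * (\<delta> * y) + \<delta> * y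
      \<le> (\<alpha> + \<nu> + \<beta> + \<gamma> + real CARD('n) + K + 1) * (\<delta> * (x + y + z + w))"
    proof -
      have p: "0 \<le> \<delta> * x" "0 \<le> \<delta> * y" "0 \<le> \<delta> * z" "0 \<le> \<delta> * w" using le\<delta> nn by simp_all
      let ?c = "\<alpha> + \<nu> + \<beta> + \<gamma> + real CARD('n) + K + 1"
      have "real CARD('n) \<le> ?c" "K + 1 \<le> ?c" "\<alpha> + \<nu> + real CARD('n) + K \<le> ?c" "\<beta> + \<gamma> + 1 \<le> ?c"
        using coeffs K(1) by simp_all
      note this(1)[THEN mult_right_mono, OF p(3)] this(2)[THEN mult_right_mono, OF p(4)]
        this(3)[THEN mult_right_mono, OF p(1)] this(4)[THEN mult_right_mono, OF p(2)]
      moreover have "real CARD('n) * (\<delta> * z) + w * ((K + 1) * \<delta>) + (\<alpha> + \<nu>) * (\<delta> * x) + real CARD('n) * (x * \<delta>) + \<delta> * (K * x) + (\<beta> + \<gamma>) * (\<delta> * y) + \<delta> * y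
        = real CARD('n) * (\<delta> * z) + (K + 1) * (\<delta> * w) + (\<alpha> + \<nu> + real CARD('n) + K) * (\<delta> * x) + (\<beta> + \<gamma> + 1) * (\<delta> * y)"
        by (simp add: algebra_simps)
      moreover have "?c * (\<delta> * (x + y + z + w)) = ?c * (\<delta> * x) + ?c * (\<delta> * y) + ?c * (\<delta> * z) + ?c * (\<delta> * w)"
        by (simp only: distrib_left)
      ultimately show ?thesis by linarith
    qed
    show ?thesis
      using coer energy order_trans[OF abs_le_D1[OF a0] a1] abs_le_D2[OF a2] order_trans[OF abs_le_D1[OF a3] a4]
        order_trans[OF abs_le_D2[OF a5] a6] order_trans[OF abs_le_D1[OF a7] a8]
        order_trans[OF abs_le_D1[OF a9] a10] order_trans[OF abs_le_D2[OF a11] a12] a13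
      by linarith
  qed
  show "h1_norm \<Omega> (u - uh) + l2_norm \<Omega> (p - ph) + h1_norm B (X - Xh) + nl (l - lh) \<le> \<delta> + (x + y + z + w)"
  proof -
    have "h1_norm \<Omega> (u - uh) \<le> U + x"
    proof -
      interpret semi_inner_space "H1 \<Omega>" "h1_inner \<Omega>" by (rule semi_inner_space_H1[OF \<Omega>])
      show ?thesis using triangle[OF H(1,3,4)] by (simp add: h1_nm[OF \<Omega>] U_def x_def)
    qed
    moreover have "l2_norm \<Omega> (p - ph) \<le> P + z" using L2.triangle[OF H(2,5,6)] by (simp add: P_def z_def)
    moreover have "h1_norm B (X - Xh) \<le> W + y"
    proof -
      interpret semi_inner_space "H1 B" "h1_inner B" by (rule semi_inner_space_H1[OF B])
      show ?thesis using triangle[OF mem(3) H(7,8)] by (simp add: h1_nm[OF B] W_def y_def)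
    qed
    moreover have "nl (l - lh) \<le> N + w" using nl(2)[OF mem(4) H(9,10)] by (simp add: N_def w_def)
    ultimately show ?thesis using \<delta> by linarith
  qed
qed

end

text \<open>The order of quantifiers is the point: \<open>C\<close> is fixed before the domains, the
  discrete spaces, the data and the solutions. This is how the independence of the mesh sizes is
  expressed.\<close>

lemma quasi_optimality_constant:
  fixes \<alpha> \<nu> \<beta> \<gamma> K \<beta>\<^sub>s \<kappa>\<^sub>s :: real
  assumes coeffs: "\<alpha> > 0" "\<nu> > 0" "\<gamma> > 0" "\<beta> \<ge> 0" "K \<ge> 0" "\<beta>\<^sub>s > 0" "\<kappa>\<^sub>s \<ge> 0"
  obtains C where "C \<ge> 0" and "\<And>(\<Omega> :: (real^'n) set) B X\<^sub>0 V Q S (c :: 'l::minus \<Rightarrow> (real^'n \<Rightarrow> real^'n) \<Rightarrow> real) \<Lambda> \<Lambda>h nl f g d u p X l uh ph Xh lh v q Y m.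
    coupled_discretization \<Omega> B X\<^sub>0 \<alpha> \<nu> \<beta> \<gamma> K \<beta>\<^sub>s \<kappa>\<^sub>s V Q S c \<Lambda> \<Lambda>h nl \<Longrightarrow>
    fsi_solution \<alpha> \<nu> \<beta> \<gamma> \<Omega> B X\<^sub>0 c (H10 \<Omega>) (L2_zero_mean \<Omega>) (H1 B) \<Lambda> f g d (u, p, X, l) \<Longrightarrow>
    fsi_solution \<alpha> \<nu> \<beta> \<gamma> \<Omega> B X\<^sub>0 c V Q S \<Lambda>h f g d (uh, ph, Xh, lh) \<Longrightarrow>
    v \<in> V \<Longrightarrow> q \<in> Q \<Longrightarrow> Y \<in> S \<Longrightarrow> m \<in> \<Lambda>h \<Longrightarrow>
    h1_norm \<Omega> (u - uh) + l2_norm \<Omega> (p - ph) + h1_norm B (X - Xh) + nl (l - lh)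
    \<le> C * (h1_norm \<Omega> (u - v) + l2_norm \<Omega> (p - q) + h1_norm B (X - Y) + nl (l - m))"
proof -
  have nn: "0 \<le> \<kappa>\<^sub>s * (\<beta> + \<gamma> + 1)" "0 \<le> (\<alpha> + \<nu> + K + real CARD('n)) / \<beta>\<^sub>s" "0 \<le> K + 1"
    "0 \<le> \<alpha> + \<nu> + \<beta> + \<gamma> + real CARD('n) + K + 1" "0 < min (min \<alpha> (\<nu> / 2)) \<gamma>"
    using coeffs by simp_all
  obtain C where C: "C \<ge> 0" and bound: "\<And>x y z w s y0 \<delta>. 0 \<le> x \<Longrightarrow> 0 \<le> s \<Longrightarrow> 0 \<le> \<delta> \<Longrightarrow>
      w \<le> \<kappa>\<^sub>s * (\<beta> + \<gamma> + 1) * (y + \<delta>) \<Longrightarrow> z \<le> (\<alpha> + \<nu> + K + real CARD('n)) / \<beta>\<^sub>s * (x + w + \<delta>) \<Longrightarrow>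
      y0 \<le> (K + 1) * (x + \<delta>) \<Longrightarrow> y \<le> s + y0 \<Longrightarrow>
      min (min \<alpha> (\<nu> / 2)) \<gamma> * (x\<^sup>2 + s\<^sup>2) \<le> (\<alpha> + \<nu> + \<beta> + \<gamma> + real CARD('n) + K + 1) * (\<delta> * (x + y + z + w)) \<Longrightarrow>
      x + y + z + w \<le> C * \<delta>"
    using discrete_error_bound[OF nn] by blast
  show thesis
  \<comment> \<open>The extra 1 pays for the approximation error itself in the triangle
    inequality.\<close>
  proof (rule that[of "C + 1"])
    show "0 \<le> C + 1" using C by simp
    fix \<Omega> B :: "(real^'n) set" and X\<^sub>0 V Q S and c :: "'l \<Rightarrow> (real^'n \<Rightarrow> real^'n) \<Rightarrow> real" and \<Lambda> \<Lambda>h nl f g d u p X l uh ph Xh lh v q Y m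
    assume "coupled_discretization \<Omega> B X\<^sub>0 \<alpha> \<nu> \<beta> \<gamma> K \<beta>\<^sub>s \<kappa>\<^sub>s V Q S c \<Lambda> \<Lambda>h nl"
      and sol: "fsi_solution \<alpha> \<nu> \<beta> \<gamma> \<Omega> B X\<^sub>0 c (H10 \<Omega>) (L2_zero_mean \<Omega>) (H1 B) \<Lambda> f g d (u, p, X, l)"
      and solh: "fsi_solution \<alpha> \<nu> \<beta> \<gamma> \<Omega> B X\<^sub>0 c V Q S \<Lambda>h f g d (uh, ph, Xh, lh)"
      and mem: "v \<in> V" "q \<in> Q" "Y \<in> S" "m \<in> \<Lambda>h"
    then interpret coupled_discretization \<Omega> B X\<^sub>0 \<alpha> \<nu> \<beta> \<gamma> K \<beta>\<^sub>s \<kappa>\<^sub>s V Q S c \<Lambda> \<Lambda>h nl by blast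
    note e = discrete_estimates[OF sol solh mem]
    let ?\<delta> = "h1_norm \<Omega> (u - v) + l2_norm \<Omega> (p - q) + h1_norm B (X - Y) + nl (l - m)"
    have "h1_norm \<Omega> (uh - v) + h1_norm B (Xh - Y) + l2_norm \<Omega> (ph - q) + nl (lh - m) \<le> C * ?\<delta>"
      by (rule bound[OF h1_norm_nonneg l2_norm_nonneg e(5) e(1) e(2) e(3) h1_norm_le e(4)])
    then show "h1_norm \<Omega> (u - uh) + l2_norm \<Omega> (p - ph) + h1_norm B (X - Xh) + nl (l - lh) \<le> (C + 1) * ?\<delta>"
      using e(7) by (simp add: distrib_right)
  qed
qed

section \<open>The two multiplier spaces\<close>

lemma power2_le_mult_cancel:
  fixes a b :: real
  assumes "a\<^sup>2 \<le> b * a" "0 \<le> a" "0 \<le> b"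
  shows "a \<le> b"
proof (cases "a = 0")
  case False
  then have "a > 0" using assms(2) by simp
  then show ?thesis using assms(1) mult_right_le_imp_le[of a a b] by (simp add: power2_eq_square)
qed (simp add: assms(3))

section \<open>The dual of \<open>H1\<close> and its norm\<close>

lemma H1_zero:
  fixes D :: "(real^'n) set"
  assumes D: "open D" "bounded D"
  shows "(\<lambda>x. 0 :: real^'m) \<in> H1 D"
  by (rule test_field_H1[OF D, of _ D]) (simp add: test_functions_zero)

text \<open>\<open>h1_dual_norm\<close> is a supremum of signed quotients, so the bound on the
  absolute value needs reflection of \<open>Y\<close>. If \<open>Y\<close> has norm 0, boundedness
  of \<open>l\<close> forces \<open>l Y = 0\<close>, in agreement with the quotient being 0. The
  zero function shows that the supremum is nonnegative.\<close>

lemma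
  fixes l :: "(real^'n \<Rightarrow> real^'m) \<Rightarrow> real"
  assumes D: "open D" "bounded D" and l: "l \<in> H1_dual D"
  shows h1_dual_apply: "Y \<in> H1 D \<Longrightarrow> \<bar>l Y\<bar> \<le> h1_dual_norm D l * h1_norm D Y"
    and h1_dual_norm_nonneg: "0 \<le> h1_dual_norm D l"
proof -
  interpret semi_inner_space "H1 D" "h1_inner D :: (real^'n \<Rightarrow> real^'m) \<Rightarrow> _ \<Rightarrow> real"
    by (rule semi_inner_space_H1[OF D])
  obtain M where M: "\<And>u. u \<in> H1 D \<Longrightarrow> \<bar>l u\<bar> \<le> M * h1_norm D u"
    using l unfolding H1_dual_def mem_Collect_eq by blast
  have sc: "l (\<lambda>x. a *\<^sub>R u x) = a * l u" if "u \<in> H1 D" for u a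
    using l that by (simp add: H1_dual_def)
  have bdd: "bdd_above ((\<lambda>v. l v / h1_norm D v) ` H1 D)"
  proof (rule bdd_aboveI2)
    fix v :: "real^'n \<Rightarrow> real^'m" assume v: "v \<in> H1 D"
    show "l v / h1_norm D v \<le> \<bar>M\<bar>"
    proof (cases "h1_norm D v = 0")
      case False
      then have p: "h1_norm D v > 0" using h1_norm_nonneg[of D v] by linarith
      have "M * h1_norm D v \<le> \<bar>M\<bar> * h1_norm D v" using p by (intro mult_right_mono) auto
      then have "l v \<le> \<bar>M\<bar> * h1_norm D v" using M[OF v] by linarith
      then show ?thesis using p by (simp add: pos_divide_le_eq)
    qed simp
  qed
  have upper: "l v \<le> h1_dual_norm D l * h1_norm D v" if v: "v \<in> H1 D" for v
  proof (cases "h1_norm D v = 0")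
    case True
    then show ?thesis using M[OF v] by simp
  next
    case False
    then have p: "h1_norm D v > 0" using h1_norm_nonneg[of D v] by linarith
    have "l v / h1_norm D v \<le> h1_dual_norm D l" unfolding h1_dual_norm_def by (rule cSUP_upper[OF v bdd])
    then show ?thesis using p by (simp add: pos_divide_le_eq)
  qed
  show "\<bar>l Y\<bar> \<le> h1_dual_norm D l * h1_norm D Y" if Y: "Y \<in> H1 D"
  proof -
    have n: "(\<lambda>x. (- 1) *\<^sub>R Y x) = (\<lambda>x. (- 1) *\<^sub>R Y x + 0 *\<^sub>R Y x)" by simp
    have m: "(\<lambda>x. (- 1) *\<^sub>R Y x) \<in> H1 D" unfolding n by (rule closed[OF Y Y])
    have "h1_norm D (\<lambda>x. (- 1) *\<^sub>R Y x) = h1_norm D Y"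
      unfolding h1_norm_def n ip_combination[OF Y Y] by simp
    then have "- l Y \<le> h1_dual_norm D l * h1_norm D Y" using upper[OF m] sc[OF Y, of "- 1"] by simp
    with upper[OF Y] show ?thesis by linarith
  qed
  define o0 where "o0 = (\<lambda>x :: real^'n. 0 :: real^'m)"
  have o0: "o0 \<in> H1 D" unfolding o0_def by (rule H1_zero[OF D])
  have z: "l o0 = 0" using sc[OF o0, of 0] by (simp add: o0_def)
  have "l o0 / h1_norm D o0 \<le> h1_dual_norm D l"
    unfolding h1_dual_norm_def by (rule cSUP_upper[OF o0 bdd])
  then show "0 \<le> h1_dual_norm D l" using z by simp
qed

lemma h1_dual_norm_le:
  fixes l :: "(real^'n \<Rightarrow> real^'m) \<Rightarrow> real"
  assumes D: "open D" "bounded D" and M: "0 \<le> M" "\<And>Y. Y \<in> H1 D \<Longrightarrow> \<bar>l Y\<bar> \<le> M * h1_norm D Y"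
  shows "h1_dual_norm D l \<le> M"
  unfolding h1_dual_norm_def
proof (rule cSUP_least)
  show "H1 D \<noteq> {}" using H1_zero[OF D] by blast
  fix v :: "real^'n \<Rightarrow> real^'m" assume v: "v \<in> H1 D"
  show "l v / h1_norm D v \<le> M"
  proof (cases "h1_norm D v = 0")
    case False
    then have p: "h1_norm D v > 0" using h1_norm_nonneg[of D v] by linarith
    then show ?thesis using M(2)[OF v] by (simp add: pos_divide_le_eq)
  qed (simp add: M(1))
qed

lemma H1_dual_linear_combination:
  fixes l :: "(real^'n \<Rightarrow> real^'m) \<Rightarrow> real"
  assumes D: "open D" "bounded D" and l: "l \<in> H1_dual D" and uv: "u \<in> H1 D" "v \<in> H1 D"
  shows "l (\<lambda>x. a *\<^sub>R u x + b *\<^sub>R v x) = a * l u + b * l v"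
proof -
  have sc: "(\<lambda>x. a *\<^sub>R w x) \<in> H1 D" if "w \<in> H1 D" for w :: "real^'n \<Rightarrow> real^'m" and a
    using H1_linear_combination(1)[OF D that that, of a 0] by simp
  have add: "l (\<lambda>x. u' x + v' x) = l u' + l v'" if "u' \<in> H1 D" "v' \<in> H1 D" for u' v'
    using l that by (simp add: H1_dual_def)
  have "l (\<lambda>x. a *\<^sub>R u x + b *\<^sub>R v x) = l (\<lambda>x. a *\<^sub>R u x) + l (\<lambda>x. b *\<^sub>R v x)"
    by (rule add[OF sc[OF uv(1)] sc[OF uv(2)]])
  then show ?thesis using l uv by (simp add: H1_dual_def)
qed

lemma H1_dual_diff_right:
  fixes l :: "(real^'n \<Rightarrow> real^'m) \<Rightarrow> real"
  assumes D: "open D" "bounded D" and l: "l \<in> H1_dual D" and uv: "u \<in> H1 D" "v \<in> H1 D"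
  shows "l (u - v) = l u - l v"
proof -
  have "u - v = (\<lambda>x. 1 *\<^sub>R u x + (- 1) *\<^sub>R v x)" by (auto simp: fun_diff_def)
  then show ?thesis using H1_dual_linear_combination[OF assms, of 1 "- 1"] by simp
qed

lemma H1_dual_diff:
  fixes l m :: "(real^'n \<Rightarrow> real^'m) \<Rightarrow> real"
  assumes D: "open D" "bounded D" and l: "l \<in> H1_dual D" and m: "m \<in> H1_dual D"
  shows "l - m \<in> H1_dual D"
proof -
  have "\<bar>(l - m) u\<bar> \<le> (h1_dual_norm D l + h1_dual_norm D m) * h1_norm D u" if "u \<in> H1 D" for u
    using h1_dual_apply[OF D l that] h1_dual_apply[OF D m that] by (simp add: distrib_right)
  then show ?thesis
    using l m unfolding H1_dual_def by (auto simp: right_diff_distrib)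
qed

lemma h1_dual_norm_triangle:
  fixes l m k :: "(real^'n \<Rightarrow> real^'m) \<Rightarrow> real"
  assumes D: "open D" "bounded D" and l: "l \<in> H1_dual D" and m: "m \<in> H1_dual D" and k: "k \<in> H1_dual D"
  shows "h1_dual_norm D (l - k) \<le> h1_dual_norm D (l - m) + h1_dual_norm D (k - m)"
proof (rule h1_dual_norm_le[OF D])
  note lm = H1_dual_diff[OF D l m] and km = H1_dual_diff[OF D k m]
  show "0 \<le> h1_dual_norm D (l - m) + h1_dual_norm D (k - m)"
    using h1_dual_norm_nonneg[OF D lm] h1_dual_norm_nonneg[OF D km] by simp
  fix Y :: "real^'n \<Rightarrow> real^'m" assume Y: "Y \<in> H1 D"
  show "\<bar>(l - k) Y\<bar> \<le> (h1_dual_norm D (l - m) + h1_dual_norm D (k - m)) * h1_norm D Y"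
    using h1_dual_apply[OF D lm Y] h1_dual_apply[OF D km Y] by (simp add: distrib_right)
qed

lemma L2_functional_H1_dual:
  fixes m :: "real^'n \<Rightarrow> real^'m"
  assumes m: "m \<in> L2 D"
  shows "L2_functional D m \<in> H1_dual D"
proof -
  have "l2_inner D m (\<lambda>x. u x + v x) = l2_inner D m u + l2_inner D m v" if "u \<in> H1 D" "v \<in> H1 D" for u v
    using L2.linear_right[OF H1_L2[OF that(1)] H1_L2[OF that(2)] m, of 1 1] by simp
  moreover have "l2_inner D m (\<lambda>x. a *\<^sub>R u x) = a * l2_inner D m u" if "u \<in> H1 D" for u a
    using L2.linear_right[OF H1_L2[OF that] H1_L2[OF that] m, of a 0] by simp
  moreover have "\<bar>l2_inner D m u\<bar> \<le> l2_norm D m * h1_norm D u" if "u \<in> H1 D" for u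
    using L2.cauchy_schwarz[OF m H1_L2[OF that]] mult_left_mono[OF l2_norm_le_h1_norm[of D u] l2_norm_nonneg[of D m]]
    by linarith
  ultimately show ?thesis unfolding H1_dual_def L2_functional_def by blast
qed

section \<open>Differences in the discrete spaces and inf-sup stability of the L2 coupling\<close>

lemma fe_space_diff:
  assumes V: "fe_space D T V" and uv: "u \<in> V" "v \<in> V"
  shows "u - v \<in> V"
proof -
  obtain A where A: "V = {v. \<exists>c. AE x in lebesgue_on D. v x = (\<Sum>b\<in>A. c b *\<^sub>R b x)}"
    using V by (auto simp: fe_space_def)
  obtain c where c: "AE x in lebesgue_on D. u x = (\<Sum>b\<in>A. c b *\<^sub>R b x)" using uv(1) A by blast
  obtain c' where c': "AE x in lebesgue_on D. v x = (\<Sum>b\<in>A. c' b *\<^sub>R b x)" using uv(2) A by blast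
  have "AE x in lebesgue_on D. (u - v) x = (\<Sum>b\<in>A. (c b - c' b) *\<^sub>R b x)"
    using c c' by eventually_elim (simp add: scaleR_diff_left sum_subtractf)
  then show ?thesis unfolding A mem_Collect_eq by (rule exI[where x = "\<lambda>b. c b - c' b"])
qed

lemma P1_space_diff:
  assumes D: "open D" "bounded D" and "Y \<in> P1_space D T" "Z \<in> P1_space D T"
  shows "Y - Z \<in> P1_space D T"
proof -
  have "Y - Z = (\<lambda>x. 1 *\<^sub>R Y x + (- 1) *\<^sub>R Z x)" by (auto simp: fun_diff_def)
  then show ?thesis using P1_space_closed[OF assms, of 1 "- 1"] by simp
qed

lemma simplicial_mesh_facts:
  assumes "simplicial_mesh D T"
  shows "finite T" "\<And>K. K \<in> T \<Longrightarrow> closed K" "D \<subseteq> \<Union>T"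
  using assms closure_subset[of D]
  by (auto simp: simplicial_mesh_def triangulation_def dest: simplex_imp_polytope polytope_imp_closed)

text \<open>Duality turns the stability of the projection into an inf-sup condition for the \<open>L\<^sup>2\<close> coupling.\<close>
lemma L2_functional_inf_sup:
  fixes S :: "(real^'n \<Rightarrow> real^'n) set"
  assumes D: "open D" "bounded D" and mesh: "simplicial_mesh D T" and S: "S = P1_space D T"
    and stable: "\<And>v w. v \<in> H1 D \<Longrightarrow> is_L2_projection D S v w \<Longrightarrow> h1_seminorm D w \<le> k * h1_seminorm D v"
    and ab: "a \<in> S" "b \<in> S" and M: "M \<ge> 0" "\<And>Z. Z \<in> S \<Longrightarrow> \<bar>(L2_functional D a - L2_functional D b) Z\<bar> \<le> M * h1_norm D Z"
  shows "h1_dual_norm D (L2_functional D a - L2_functional D b) \<le> (\<bar>k\<bar> + 1) * M"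
proof (rule h1_dual_norm_le[OF D])
  show "0 \<le> (\<bar>k\<bar> + 1) * M" using M(1) by simp
  fix v :: "real^'n \<Rightarrow> real^'n" assume v: "v \<in> H1 D"
  have SH: "Z \<in> H1 D" "Z \<in> L2 D" if "Z \<in> S" for Z
    using that by (auto simp: S P1_space_def H1_L2)
  obtain gs where gs: "set gs \<subseteq> L2 D"
    "\<And>Y. Y \<in> S \<Longrightarrow> (\<And>g. g \<in> set gs \<Longrightarrow> l2_inner D Y g = 0) \<Longrightarrow> l2_inner D Y Y = 0"
    unfolding S using P1_space_determined[OF D simplicial_mesh_facts[OF mesh]] by metis
  have SL: "S \<subseteq> L2 D" "S \<noteq> {}" using SH(2) ab by auto
  \<comment> \<open>The stability hypothesis speaks only about functions already known to be
    projections, so the existence of one has to be established.\<close>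
  have "\<exists>w\<in>S. \<forall>Y\<in>S. l2_inner D w Y = l2_inner D v Y"
    by (rule L2.projection_exists[OF SL _ gs H1_L2[OF v]]) (auto simp: S intro: P1_space_closed[OF D])
  then obtain w where w: "w \<in> S" "\<And>Y. Y \<in> S \<Longrightarrow> l2_inner D w Y = l2_inner D v Y" by blast
  then have "is_L2_projection D S v w" by (simp add: is_L2_projection_def)
  then have semi: "l2_norm D (grad D w) \<le> k * l2_norm D (grad D v)" using stable[OF v] by (simp add: h1_seminorm_def)
  note wL = SH(2)[OF w(1)] and vL = H1_L2[OF v]
  \<comment> \<open>The stability hypothesis controls only the seminorm; the L2 part uses that an
    orthogonal projection does not increase the norm.\<close>
  have "(l2_norm D w)\<^sup>2 \<le> l2_norm D v * l2_norm D w"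
    using L2.cauchy_schwarz[OF vL wL] w(2)[OF w(1)] by (simp add: L2.nm_square[OF wL])
  then have "l2_norm D w \<le> l2_norm D v" by (rule power2_le_mult_cancel) simp_all
  \<comment> \<open>The stability constant is not assumed nonnegative, hence the absolute
    value.\<close>
  moreover have "k * l2_norm D (grad D v) \<le> \<bar>k\<bar> * h1_norm D v"
    by (intro mult_mono l2_norm_grad_le_h1_norm) simp_all
  ultimately have hw: "h1_norm D w \<le> (\<bar>k\<bar> + 1) * h1_norm D v"
    using semi h1_norm_le[of D w] l2_norm_le_h1_norm[of D v] by (simp add: distrib_right)
  \<comment> \<open>Both functionals are represented by elements of \<open>S\<close>, so they see
    \<open>v\<close> only through its projection.\<close>
  have "(L2_functional D a - L2_functional D b) v = (L2_functional D a - L2_functional D b) w"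
    using w(2)[OF ab(1)] w(2)[OF ab(2)] by (simp add: L2_functional_def L2.commute[of _ v] L2.commute[of _ w])
  then have "\<bar>(L2_functional D a - L2_functional D b) v\<bar> \<le> M * h1_norm D w" using M(2)[OF w(1)] by simp
  also have "\<dots> \<le> M * ((\<bar>k\<bar> + 1) * h1_norm D v)" using hw M(1) by (rule mult_left_mono)
  finally show "\<bar>(L2_functional D a - L2_functional D b) v\<bar> \<le> (\<bar>k\<bar> + 1) * M * h1_norm D v"
    by (simp add: mult_ac)
qed

text \<open>Both choices of multiplier space are instances of \<open>coupled_discretization\<close>,
  with inf-sup constant |k| + 1 for the duality pairing and 1 for the H1 inner product.
  \<open>K\<close> and \<open>\<beta>\<^sub>s\<close> are obtained before any mesh index is
  fixed.\<close>

theorem theorem10: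
  fixes \<Omega> B :: "(real^'n) set"
    and Xbar :: "real^'n \<Rightarrow> real^'n"
    and \<alpha> \<nu> \<beta> \<gamma> :: real
    and Th :: "'i \<Rightarrow> (real^'n) set set"
    and ThB :: "'j \<Rightarrow> (real^'n) set set"
    and Vh :: "'i \<Rightarrow> (real^'n \<Rightarrow> real^'n) set"
    and Qh :: "'i \<Rightarrow> (real^'n \<Rightarrow> real) set"
    and Sh :: "'j \<Rightarrow> (real^'n \<Rightarrow> real^'n) set"
  assumes dim: "CARD('n) \<in> {2, 3}"
    and \<Omega>: "lipschitz_polytopal_domain \<Omega>"
    and B: "lipschitz_polytopal_domain B"
    and Xbar: "Xbar \<in> W1inf B" "inj_on Xbar B"
      "\<exists>L. L-lipschitz_on (Xbar ` B) (inv_into B Xbar)" "closure (Xbar ` B) \<subseteq> \<Omega>"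
    and coeffs: "\<alpha> > 0" "\<nu> > 0" "\<gamma> > 0" "\<beta> \<ge> 0"
    and Th: "\<And>i. simplicial_mesh \<Omega> (Th i)" "shape_regular Th"
    and ThB: "\<And>j. simplicial_mesh B (ThB j)" "shape_regular ThB"
    and Vh: "\<And>i. fe_space \<Omega> (Th i) (Vh i)" "\<And>i. Vh i \<subseteq> H10 \<Omega>"
    and Qh: "\<And>i. fe_space \<Omega> (Th i) (Qh i)" "\<And>i. Qh i \<subseteq> L2_zero_mean \<Omega>"
    and stokes: "stokes_stable \<Omega> Vh Qh"
    and Sh: "\<And>j. Sh j = P1_space B (ThB j)"
  shows
    "(L2_projection_H1_stable B Sh \<longrightarrow>
       (\<exists>C. \<forall>i j. \<forall>f \<in> L2 \<Omega>. \<forall>g \<in> L2 B. \<forall>d \<in> H1 B. \<forall>u p X l uh ph Xh lh.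
          fsi_solution \<alpha> \<nu> \<beta> \<gamma> \<Omega> B Xbar duality_pairing
            (H10 \<Omega>) (L2_zero_mean \<Omega>) (H1 B) (H1_dual B) f g d (u, p, X, l) \<longrightarrow>
          fsi_solution \<alpha> \<nu> \<beta> \<gamma> \<Omega> B Xbar duality_pairing
            (Vh i) (Qh i) (Sh j) (L2_functional B ` Sh j) f g d (uh, ph, Xh, lh) \<longrightarrow>
          h1_norm \<Omega> (u - uh) + l2_norm \<Omega> (p - ph) + h1_norm B (X - Xh) + h1_dual_norm B (l - lh)
          \<le> C * (INF (v, q, Y, m) \<in> Vh i \<times> Qh i \<times> Sh j \<times> Sh j.
                   h1_norm \<Omega> (u - v) + l2_norm \<Omega> (p - q) + h1_norm B (X - Y)
                   + h1_dual_norm B (l - L2_functional B m)))) \<and>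
     (\<exists>C. \<forall>i j. \<forall>f \<in> L2 \<Omega>. \<forall>g \<in> L2 B. \<forall>d \<in> H1 B. \<forall>u p X l uh ph Xh lh.
          fsi_solution \<alpha> \<nu> \<beta> \<gamma> \<Omega> B Xbar (h1_inner B)
            (H10 \<Omega>) (L2_zero_mean \<Omega>) (H1 B) (H1 B) f g d (u, p, X, l) \<longrightarrow>
          fsi_solution \<alpha> \<nu> \<beta> \<gamma> \<Omega> B Xbar (h1_inner B)
            (Vh i) (Qh i) (Sh j) (Sh j) f g d (uh, ph, Xh, lh) \<longrightarrow>
          h1_norm \<Omega> (u - uh) + l2_norm \<Omega> (p - ph) + h1_norm B (X - Xh) + h1_norm B (l - lh)
          \<le> C * (INF (v, q, Y, m) \<in> Vh i \<times> Qh i \<times> Sh j \<times> Sh j.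
                   h1_norm \<Omega> (u - v) + l2_norm \<Omega> (p - q) + h1_norm B (X - Y)
                   + h1_norm B (l - m)))"
proof -
  have \<Omega>o: "open \<Omega>" "bounded \<Omega>" and Bo: "open B" "bounded B"
    using lipschitz_polytopal_domain_open_bounded \<Omega> B by auto
  obtain L where L: "L-lipschitz_on (Xbar ` B) (inv_into B Xbar)" using Xbar(3) by blast
  have sub: "Xbar ` B \<subseteq> \<Omega>" using Xbar(4) closure_subset by blast
  obtain K where K: "K \<ge> 0" "\<And>u :: real^'n \<Rightarrow> real^'n. u \<in> H10 \<Omega> \<Longrightarrow> u \<circ> Xbar \<in> H1 B"
    "\<And>u :: real^'n \<Rightarrow> real^'n. u \<in> H10 \<Omega> \<Longrightarrow> h1_norm B (u \<circ> Xbar) \<le> K * h1_norm \<Omega> u"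
    using composition_bounded[OF \<Omega>o Bo Xbar(1,2) L sub] by blast
  obtain \<beta>\<^sub>s where s: "\<beta>\<^sub>s > 0"
    "\<And>i q. q \<in> Qh i \<Longrightarrow> \<beta>\<^sub>s * l2_norm \<Omega> q \<le> (SUP v\<in>Vh i. l2_inner \<Omega> (divergence \<Omega> v) q / h1_norm \<Omega> v)"
    using stokes unfolding stokes_stable_def by blast
  have Vd: "u - v \<in> Vh i" if "u \<in> Vh i" "v \<in> Vh i" for i u v by (rule fe_space_diff[OF Vh(1) that])
  have Qd: "p - q \<in> Qh i" if "p \<in> Qh i" "q \<in> Qh i" for i p q by (rule fe_space_diff[OF Qh(1) that])
  have Sd: "Y - Z \<in> Sh j" if "Y \<in> Sh j" "Z \<in> Sh j" for j Y Z
    using P1_space_diff[OF Bo] that unfolding Sh by blast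
  have SH: "Sh j \<subseteq> H1 B" for j unfolding Sh by (auto simp: P1_space_def)
  interpret H: semi_inner_space "H1 B" "h1_inner B :: (real^'n \<Rightarrow> real^'n) \<Rightarrow> _ \<Rightarrow> real"
    rewrites "semi_inner_space.nm (h1_inner B :: (real^'n \<Rightarrow> real^'n) \<Rightarrow> _ \<Rightarrow> real) = h1_norm B"
    by (rule semi_inner_space_H1[OF Bo], rule h1_nm[OF Bo])
  have dual: "coupled_discretization \<Omega> B Xbar \<alpha> \<nu> \<beta> \<gamma> K \<beta>\<^sub>s (\<bar>k\<bar> + 1) (Vh i) (Qh i) (Sh j)
      duality_pairing (H1_dual B) (L2_functional B ` Sh j) (h1_dual_norm B)"
    if k: "\<And>j v w. v \<in> H1 B \<Longrightarrow> is_L2_projection B (Sh j) v w \<Longrightarrow> h1_seminorm B w \<le> k * h1_seminorm B v" for i j k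
  proof (rule coupled_discretization.intro[OF \<Omega>o Bo coeffs K Vh(2) Vd Qh(2) Qd SH Sd s])
    show "duality_pairing (l - m) Y = duality_pairing l Y - duality_pairing m Y"
      for l m :: "(real^'n \<Rightarrow> real^'n) \<Rightarrow> real" and Y by (simp add: duality_pairing_def)
    show "duality_pairing l (Y - Z) = duality_pairing l Y - duality_pairing l Z"
      if "l \<in> H1_dual B" "Y \<in> H1 B" "Z \<in> H1 B" for l and Y Z :: "real^'n \<Rightarrow> real^'n"
      unfolding duality_pairing_def by (rule H1_dual_diff_right[OF Bo that])
    show "\<bar>duality_pairing l Y\<bar> \<le> h1_dual_norm B l * h1_norm B Y"
      if "l \<in> H1_dual B" "Y \<in> H1 B" for l and Y :: "real^'n \<Rightarrow> real^'n"
      unfolding duality_pairing_def by (rule h1_dual_apply[OF Bo that])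
    show "l - m \<in> H1_dual B" if "l \<in> H1_dual B" "m \<in> H1_dual B" for l m :: "(real^'n \<Rightarrow> real^'n) \<Rightarrow> real"
      by (rule H1_dual_diff[OF Bo that])
    show "L2_functional B ` Sh j \<subseteq> H1_dual B" using L2_functional_H1_dual H1_L2 SH by blast
    show "0 \<le> h1_dual_norm B l" if "l \<in> H1_dual B" for l :: "(real^'n \<Rightarrow> real^'n) \<Rightarrow> real"
      by (rule h1_dual_norm_nonneg[OF Bo that])
    show "h1_dual_norm B (l - k) \<le> h1_dual_norm B (l - m) + h1_dual_norm B (k - m)"
      if "l \<in> H1_dual B" "m \<in> H1_dual B" "k \<in> H1_dual B" for l m k :: "(real^'n \<Rightarrow> real^'n) \<Rightarrow> real"
      by (rule h1_dual_norm_triangle[OF Bo that])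
    show "0 \<le> \<bar>k\<bar> + 1" by simp
    show "h1_dual_norm B (l - m) \<le> (\<bar>k\<bar> + 1) * M"
      if lm: "l \<in> L2_functional B ` Sh j" "m \<in> L2_functional B ` Sh j" and M: "M \<ge> 0"
        "\<And>Z. Z \<in> Sh j \<Longrightarrow> \<bar>duality_pairing (l - m) Z\<bar> \<le> M * h1_norm B Z" for l m M
    proof -
      obtain a b where ab: "a \<in> Sh j" "b \<in> Sh j" "l = L2_functional B a" "m = L2_functional B b" using lm by blast
      show ?thesis
        unfolding ab(3,4)
        by (rule L2_functional_inf_sup[OF Bo ThB(1) Sh k ab(1,2) M(1)])
          (use M(2) in \<open>simp_all add: ab(3,4) duality_pairing_def\<close>)
    qed
    show "l2_norm B Y \<le> h1_norm B W"
      if Y: "Y \<in> Sh j" and W: "W \<in> H1 B" and eq: "\<And>m. m \<in> L2_functional B ` Sh j \<Longrightarrow> duality_pairing m Y = duality_pairing m W" for Y W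
    proof -
      have YL: "Y \<in> L2 B" using Y SH H1_L2 by blast
      \<comment> \<open>\<open>Y\<close> itself is an admissible multiplier because the multiplier
        space is the image of \<open>Sh j\<close>; Cauchy-Schwarz then bounds its L2 norm by that of
        \<open>W\<close>.\<close>
      have "l2_inner B Y Y = l2_inner B Y W" using eq[OF imageI[OF Y]] by (simp add: duality_pairing_def L2_functional_def)
      then have "(l2_norm B Y)\<^sup>2 \<le> l2_norm B W * l2_norm B Y"
        using L2.cauchy_schwarz[OF YL H1_L2[OF W]] by (simp add: L2.nm_square[OF YL] mult.commute)
      then have "l2_norm B Y \<le> l2_norm B W" by (rule power2_le_mult_cancel) simp_all
      then show ?thesis using l2_norm_le_h1_norm[of B W] by linarith
    qed
  qed
  have diff_right: "h1_inner B l (Y - Z) = h1_inner B l Y - h1_inner B l Z"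
    if "l \<in> H1 B" "Y \<in> H1 B" "Z \<in> H1 B" for l Y Z :: "real^'n \<Rightarrow> real^'n"
    by (rule H.diff_right[OF that(2,3,1)])
  have inner: "coupled_discretization \<Omega> B Xbar \<alpha> \<nu> \<beta> \<gamma> K \<beta>\<^sub>s 1 (Vh i) (Qh i) (Sh j)
      (h1_inner B) (H1 B) (Sh j) (h1_norm B)" for i j
  proof (rule coupled_discretization.intro[OF \<Omega>o Bo coeffs K Vh(2) Vd Qh(2) Qd SH Sd s])
    show "h1_inner B (l - m) Y = h1_inner B l Y - h1_inner B m Y"
      if "l \<in> H1 B" "m \<in> H1 B" "Y \<in> H1 B" for l m Y :: "real^'n \<Rightarrow> real^'n"
      by (rule H.diff_left[OF that])
    show "h1_inner B l (Y - Z) = h1_inner B l Y - h1_inner B l Z"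
      if "l \<in> H1 B" "Y \<in> H1 B" "Z \<in> H1 B" for l Y Z :: "real^'n \<Rightarrow> real^'n"
      by (rule diff_right[OF that])
    show "\<bar>h1_inner B l Y\<bar> \<le> h1_norm B l * h1_norm B Y"
      if "l \<in> H1 B" "Y \<in> H1 B" for l Y :: "real^'n \<Rightarrow> real^'n"
      by (rule H.cauchy_schwarz[OF that])
    show "l - m \<in> H1 B" if "l \<in> H1 B" "m \<in> H1 B" for l m :: "real^'n \<Rightarrow> real^'n"
      by (rule H.closed_diff[OF that])
    show "Sh j \<subseteq> H1 B" by (rule SH)
    show "0 \<le> h1_norm B l" for l :: "real^'n \<Rightarrow> real^'n" by (rule h1_norm_nonneg)
    show "h1_norm B (l - k) \<le> h1_norm B (l - m) + h1_norm B (k - m)"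
      if "l \<in> H1 B" "m \<in> H1 B" "k \<in> H1 B" for l m k :: "real^'n \<Rightarrow> real^'n"
      by (rule H.triangle[OF that])
    show "h1_norm B (l - m) \<le> 1 * M"
      if lm: "l \<in> Sh j" "m \<in> Sh j" and M: "M \<ge> 0" "\<And>Z. Z \<in> Sh j \<Longrightarrow> \<bar>h1_inner B (l - m) Z\<bar> \<le> M * h1_norm B Z" for l m M
    proof -
      have d: "l - m \<in> Sh j" by (rule Sd[OF lm])
      have dH: "l - m \<in> H1 B" using d SH by blast
      \<comment> \<open>Here the pairing is the inner product and \<open>l - m\<close> lies in the
        test space, so testing with it gives constant 1.\<close>
      have "(h1_norm B (l - m))\<^sup>2 \<le> M * h1_norm B (l - m)"
        using M(2)[OF d] H.nm_square[OF dH] by linarith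
      then show ?thesis using M(1) power2_le_mult_cancel[of "h1_norm B (l - m)" M] by simp
    qed
    show "l2_norm B Y \<le> h1_norm B W"
      if Y: "Y \<in> Sh j" and W: "W \<in> H1 B" and eq: "\<And>m. m \<in> Sh j \<Longrightarrow> h1_inner B m Y = h1_inner B m W" for Y W
    proof -
      have YH: "Y \<in> H1 B" using Y SH by blast
      \<comment> \<open>Same testing with \<open>Y\<close>, now in the H1 inner product, where the
        constraint bounds even the full H1 norm of \<open>Y\<close>.\<close>
      have "(h1_norm B Y)\<^sup>2 \<le> h1_norm B W * h1_norm B Y"
        using H.cauchy_schwarz[OF YH W] eq[OF Y] by (simp add: H.nm_square[OF YH] mult.commute)
      then have "h1_norm B Y \<le> h1_norm B W" by (rule power2_le_mult_cancel) simp_all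
      then show ?thesis using l2_norm_le_h1_norm[of B Y] by linarith
    qed
  qed simp_all
  show ?thesis
  proof (intro conjI impI)
    assume "L2_projection_H1_stable B Sh"
    then obtain k where k: "\<And>j v w. v \<in> H1 B \<Longrightarrow> is_L2_projection B (Sh j) v w \<Longrightarrow> h1_seminorm B w \<le> k * h1_seminorm B v"
      unfolding L2_projection_H1_stable_def by blast
    have k1: "0 \<le> \<bar>k\<bar> + 1" by simp
    have dk: "coupled_discretization \<Omega> B Xbar \<alpha> \<nu> \<beta> \<gamma> K \<beta>\<^sub>s (\<bar>k\<bar> + 1) (Vh i) (Qh i) (Sh j)
        duality_pairing (H1_dual B) (L2_functional B ` Sh j) (h1_dual_norm B)" for i j
      by (rule dual, rule k)
    obtain C where C: "C \<ge> 0" and bound: "\<And>i j f g d u p X l uh ph Xh lh v q Y m.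
        fsi_solution \<alpha> \<nu> \<beta> \<gamma> \<Omega> B Xbar duality_pairing (H10 \<Omega>) (L2_zero_mean \<Omega>) (H1 B) (H1_dual B) f g d (u, p, X, l) \<Longrightarrow>
        fsi_solution \<alpha> \<nu> \<beta> \<gamma> \<Omega> B Xbar duality_pairing (Vh i) (Qh i) (Sh j) (L2_functional B ` Sh j) f g d (uh, ph, Xh, lh) \<Longrightarrow>
        v \<in> Vh i \<Longrightarrow> q \<in> Qh i \<Longrightarrow> Y \<in> Sh j \<Longrightarrow> m \<in> L2_functional B ` Sh j \<Longrightarrow>
        h1_norm \<Omega> (u - uh) + l2_norm \<Omega> (p - ph) + h1_norm B (X - Xh) + h1_dual_norm B (l - lh)
        \<le> C * (h1_norm \<Omega> (u - v) + l2_norm \<Omega> (p - q) + h1_norm B (X - Y) + h1_dual_norm B (l - m))"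
    proof (rule quasi_optimality_constant[OF coeffs K(1) s(1) k1, where 'n = 'n and 'l = "(real^'n \<Rightarrow> real^'n) \<Rightarrow> real"], goal_cases)
      case (1 C)
      show ?case by (rule 1(1), rule 1(2), rule 1(3)[OF dk], assumption+)
    qed
    show "\<exists>C. \<forall>i j. \<forall>f \<in> L2 \<Omega>. \<forall>g \<in> L2 B. \<forall>d \<in> H1 B. \<forall>u p X l uh ph Xh lh.
          fsi_solution \<alpha> \<nu> \<beta> \<gamma> \<Omega> B Xbar duality_pairing
            (H10 \<Omega>) (L2_zero_mean \<Omega>) (H1 B) (H1_dual B) f g d (u, p, X, l) \<longrightarrow>
          fsi_solution \<alpha> \<nu> \<beta> \<gamma> \<Omega> B Xbar duality_pairing
            (Vh i) (Qh i) (Sh j) (L2_functional B ` Sh j) f g d (uh, ph, Xh, lh) \<longrightarrow>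
          h1_norm \<Omega> (u - uh) + l2_norm \<Omega> (p - ph) + h1_norm B (X - Xh) + h1_dual_norm B (l - lh)
          \<le> C * (INF (v, q, Y, m) \<in> Vh i \<times> Qh i \<times> Sh j \<times> Sh j.
                   h1_norm \<Omega> (u - v) + l2_norm \<Omega> (p - q) + h1_norm B (X - Y)
                   + h1_dual_norm B (l - L2_functional B m))"
    proof (intro exI[of _ C] allI ballI impI)
      fix i j f g d u p X l uh ph Xh lh
      assume sol: "fsi_solution \<alpha> \<nu> \<beta> \<gamma> \<Omega> B Xbar duality_pairing (H10 \<Omega>) (L2_zero_mean \<Omega>) (H1 B) (H1_dual B) f g d (u, p, X, l)"
        and solh: "fsi_solution \<alpha> \<nu> \<beta> \<gamma> \<Omega> B Xbar duality_pairing (Vh i) (Qh i) (Sh j) (L2_functional B ` Sh j) f g d (uh, ph, Xh, lh)"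
      \<comment> \<open>The infimum over an empty set would be unspecified. The discrete solution
        provides an element of each space; its multiplier is the image of some element of
        \<open>Sh j\<close>.\<close>
      have ne: "Vh i \<times> Qh i \<times> Sh j \<times> Sh j \<noteq> {}" using solh by (auto simp: fsi_solution_def)
      show "h1_norm \<Omega> (u - uh) + l2_norm \<Omega> (p - ph) + h1_norm B (X - Xh) + h1_dual_norm B (l - lh)
          \<le> C * (INF (v, q, Y, m) \<in> Vh i \<times> Qh i \<times> Sh j \<times> Sh j.
                   h1_norm \<Omega> (u - v) + l2_norm \<Omega> (p - q) + h1_norm B (X - Y)
                   + h1_dual_norm B (l - L2_functional B m))"
        by (rule le_scaled_INF[OF ne C]) (auto intro!: bound[OF sol solh])
    qed
  next
    obtain C where C: "C \<ge> 0" and bound: "\<And>i j f g d u p X l uh ph Xh lh v q Y m.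
        fsi_solution \<alpha> \<nu> \<beta> \<gamma> \<Omega> B Xbar (h1_inner B) (H10 \<Omega>) (L2_zero_mean \<Omega>) (H1 B) (H1 B) f g d (u, p, X, l) \<Longrightarrow>
        fsi_solution \<alpha> \<nu> \<beta> \<gamma> \<Omega> B Xbar (h1_inner B) (Vh i) (Qh i) (Sh j) (Sh j) f g d (uh, ph, Xh, lh) \<Longrightarrow>
        v \<in> Vh i \<Longrightarrow> q \<in> Qh i \<Longrightarrow> Y \<in> Sh j \<Longrightarrow> m \<in> Sh j \<Longrightarrow>
        h1_norm \<Omega> (u - uh) + l2_norm \<Omega> (p - ph) + h1_norm B (X - Xh) + h1_norm B (l - lh)
        \<le> C * (h1_norm \<Omega> (u - v) + l2_norm \<Omega> (p - q) + h1_norm B (X - Y) + h1_norm B (l - m))"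
    proof (rule quasi_optimality_constant[OF coeffs K(1) s(1) zero_le_one, where 'n = 'n and 'l = "real^'n \<Rightarrow> real^'n"], goal_cases)
      case (1 C)
      show ?case by (rule 1(1), rule 1(2), rule 1(3)[OF inner], assumption+)
    qed
    show "\<exists>C. \<forall>i j. \<forall>f \<in> L2 \<Omega>. \<forall>g \<in> L2 B. \<forall>d \<in> H1 B. \<forall>u p X l uh ph Xh lh.
          fsi_solution \<alpha> \<nu> \<beta> \<gamma> \<Omega> B Xbar (h1_inner B)
            (H10 \<Omega>) (L2_zero_mean \<Omega>) (H1 B) (H1 B) f g d (u, p, X, l) \<longrightarrow>
          fsi_solution \<alpha> \<nu> \<beta> \<gamma> \<Omega> B Xbar (h1_inner B)
            (Vh i) (Qh i) (Sh j) (Sh j) f g d (uh, ph, Xh, lh) \<longrightarrow>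
          h1_norm \<Omega> (u - uh) + l2_norm \<Omega> (p - ph) + h1_norm B (X - Xh) + h1_norm B (l - lh)
          \<le> C * (INF (v, q, Y, m) \<in> Vh i \<times> Qh i \<times> Sh j \<times> Sh j.
                   h1_norm \<Omega> (u - v) + l2_norm \<Omega> (p - q) + h1_norm B (X - Y)
                   + h1_norm B (l - m))"
    proof (intro exI[of _ C] allI ballI impI)
      fix i j f g d u p X l uh ph Xh lh
      assume sol: "fsi_solution \<alpha> \<nu> \<beta> \<gamma> \<Omega> B Xbar (h1_inner B) (H10 \<Omega>) (L2_zero_mean \<Omega>) (H1 B) (H1 B) f g d (u, p, X, l)"
        and solh: "fsi_solution \<alpha> \<nu> \<beta> \<gamma> \<Omega> B Xbar (h1_inner B) (Vh i) (Qh i) (Sh j) (Sh j) f g d (uh, ph, Xh, lh)"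
      have ne: "Vh i \<times> Qh i \<times> Sh j \<times> Sh j \<noteq> {}" using solh by (auto simp: fsi_solution_def)
      show "h1_norm \<Omega> (u - uh) + l2_norm \<Omega> (p - ph) + h1_norm B (X - Xh) + h1_norm B (l - lh)
          \<le> C * (INF (v, q, Y, m) \<in> Vh i \<times> Qh i \<times> Sh j \<times> Sh j.
                   h1_norm \<Omega> (u - v) + l2_norm \<Omega> (p - q) + h1_norm B (X - Y) + h1_norm B (l - m))"
        by (rule le_scaled_INF[OF ne C]) (auto intro!: bound[OF sol solh])
    qed
  qed
qed

end
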